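(* Let $A$ be an Archdeacon array on an abelian group $G$ that is simple with respect to two compatible orderings $\omega_r$ (for the rows) and $\omega_c$ (for the columns). Then there exists a biembedding of the $G$-regular cycle decompositions $\mathcal{D}_{\omega_r^{-1}}$ and $\mathcal{D}_{\omega_c}$ of $\mathrm{Cay}[G:\pm\mathcal{E}(A)]$ into an orientable surface.
   Context: A partially filled (p.f.) array is a matrix in which some cells may be empty; $\mathcal{E}(A)$ is the list of the elements in the filled cells of $A$, and $\overline R_i,\overline C_j$ are its $i$-th row and $j$-th column. An Archdeacon array over an abelian group $(G,+)$ is an $m\times n$ p.f. array $A$ with elements in $G$ such that: (a) $\mathcal{E}(A)$ is a set (no repeated entries); (b) for every $g\in G$, $g\in\mathcal{E}(A)$ implies $-g\notin\mathcal{E}(A)$; (c) the elements in every row and column sum to $0$. An ordering $\omega=(t_1,\dots,t_\ell)$ of elements of $G$ has partial sums $s_i=t_1+\dots+t_i$, and $\mathcal{S}(\omega)=(s_1,\dots,s_\ell)$, regarded as a cycle; $\omega$ is simple if $s_1,\dots,s_\ell$ are pairwise distinct; $\omega^{-1}=(t_\ell,\dots,t_1)$. $A$ is simple with respect to $\omega_r,\omega_c$ if $\omega_r$ consists of a simple ordering $\omega_{\overline R_i}$ of the entries of each row, and $\omega_c$ of a simple ordering $\omega_{\overline C_j}$ of the entries of each column. $\omega_r^{-1}$ is obtained by replacing each $\omega_{\overline R_i}$ by $\omega_{\overline R_i}^{-1}$. Regarding each ordering $(t_1,\dots,t_\ell)$ as the cyclic permutation $t_1\mapsto t_2\mapsto\dots\mapsto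 t_\ell\mapsto t_1$, $\omega_r=\omega_{\overline R_1}\circ\dots\circ\omega_{\overline R_m}$ and $\omega_c=\omega_{\overline C_1}\circ\dots\circ\omega_{\overline C_n}$ are permutations of $\mathcal{E}(A)$; they are compatible if $\omega_c\circ\omega_r$ is a cycle of length $|\mathcal{E}(A)|$. For $\Lambda\subseteq G\setminus\{0\}$ with $\Lambda=-\Lambda$, $\mathrm{Cay}[G:\Lambda]$ is the simple graph with vertex set $G$ in which $x,y$ are adjacent iff $x-y\in\Lambda$. For row orderings $\omega$, $\mathcal{D}_\omega$ is the set of all translates by elements of $G$ of the cycles $\mathcal{S}(\omega_{\overline R_i})$, and similarly for column orderings; these are cycle decompositions of $\mathrm{Cay}[G:\pm\mathcal{E}(A)]$ (sets of cycles whose edges partition the edge set) that are $G$-regular, i.e. they admit $G$ (acting by translations) as an automorphism group acting sharply transitively on the vertices. An embedding of a graph $\Gamma$ in a surface $\Sigma$ is a continuous injective map $\psi:\Gamma\to\Sigma$, where $\Gamma$ is viewed as a $1$-dimensional simplicial complex; its faces are the connected components of $\Sigma\setminus\psi(\Gamma)$. A biembedding of two cycle decompositions $\mathcal{D},\mathcal{D}'$ of a simple graph $\Gamma$ is a face $2$-colorable embedding of $\Gamma$ in which one color class is comprised of the cycles in $\mathcal{D}$ (as face boundaries) and the other class contains the cycles in $\mathcal{D}'$. *)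

theory Defs
  imports
    "HOL-Complex_Analysis.Complex_Analysis"
    "HOL-Combinatorics.Cycles"
    "HOL-Library.Disjoint_Sets"
    "HOL-Library.Multiset"
begin

section \<open>Archdeacon arrays and orderings\<close>

text \<open>
  An \<open>m \<times> n\<close> partially filled array is a function \<open>A :: nat \<Rightarrow> nat \<Rightarrow> 'g option\<close> of which only the
  cells \<open>(i, j)\<close> with \<open>i < m\<close> and \<open>j < n\<close> matter; \<open>None\<close> is an empty cell. Rows, columns and the
  whole array are represented by the lists of the elements in their filled cells.
\<close>

definition row_entries :: "nat \<Rightarrow> (nat \<Rightarrow> nat \<Rightarrow> 'g option) \<Rightarrow> nat \<Rightarrow> 'g list" where
  "row_entries n A i = List.map_filter (\<lambda>j. A i j) [0..<n]"

definition col_entries :: "nat \<Rightarrow> (nat \<Rightarrow> nat \<Rightarrow> 'g option) \<Rightarrow> nat \<Rightarrow> 'g list" where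
  "col_entries m A j = List.map_filter (\<lambda>i. A i j) [0..<m]"

definition entries :: "nat \<Rightarrow> nat \<Rightarrow> (nat \<Rightarrow> nat \<Rightarrow> 'g option) \<Rightarrow> 'g list" where
  "entries m n A = concat (map (row_entries n A) [0..<m])"

definition archdeacon_array ::
    "nat \<Rightarrow> nat \<Rightarrow> (nat \<Rightarrow> nat \<Rightarrow> 'g::ab_group_add option) \<Rightarrow> bool" where
  "archdeacon_array m n A \<longleftrightarrow>
     distinct (entries m n A) \<and>
     (\<forall>g. g \<in> set (entries m n A) \<longrightarrow> - g \<notin> set (entries m n A)) \<and>
     (\<forall>i<m. sum_list (row_entries n A i) = 0) \<and>
     (\<forall>j<n. sum_list (col_entries m A j) = 0)"

definition partial_sums :: "'g::ab_group_add list \<Rightarrow> 'g list" where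
  "partial_sums \<omega> = map (\<lambda>k. sum_list (take (Suc k) \<omega>)) [0..<length \<omega>]"

definition simple_ordering :: "'g::ab_group_add list \<Rightarrow> bool" where
  "simple_ordering \<omega> \<longleftrightarrow> distinct (partial_sums \<omega>)"

definition simple_array ::
    "nat \<Rightarrow> nat \<Rightarrow> (nat \<Rightarrow> nat \<Rightarrow> 'g::ab_group_add option) \<Rightarrow>
     (nat \<Rightarrow> 'g list) \<Rightarrow> (nat \<Rightarrow> 'g list) \<Rightarrow> bool" where
  "simple_array m n A \<omega>r \<omega>c \<longleftrightarrow>
     (\<forall>i<m. mset (\<omega>r i) = mset (row_entries n A i) \<and> simple_ordering (\<omega>r i)) \<and>
     (\<forall>j<n. mset (\<omega>c j) = mset (col_entries m A j) \<and> simple_ordering (\<omega>c j))"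

definition ordering_perm :: "nat \<Rightarrow> (nat \<Rightarrow> 'g list) \<Rightarrow> 'g \<Rightarrow> 'g" where
  "ordering_perm k \<omega> = foldr (\<circ>) (map (\<lambda>i. cycle_of_list (\<omega> i)) [0..<k]) id"

text \<open>
  The condition \<open>cs \<noteq> []\<close> excludes the array without filled cells: the empty permutation is not
  regarded as a cycle of length \<open>0\<close>.
\<close>

definition compatible_orderings ::
    "nat \<Rightarrow> nat \<Rightarrow> (nat \<Rightarrow> nat \<Rightarrow> 'g option) \<Rightarrow> (nat \<Rightarrow> 'g list) \<Rightarrow> (nat \<Rightarrow> 'g list) \<Rightarrow> bool" where
  "compatible_orderings m n A \<omega>r \<omega>c \<longleftrightarrow>
     (\<exists>cs. cs \<noteq> [] \<and> distinct cs \<and> length cs = card (set (entries m n A)) \<and>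
           ordering_perm n \<omega>c \<circ> ordering_perm m \<omega>r = cycle_of_list cs)"

section \<open>Cayley graphs and cycle decompositions\<close>

text \<open>
  The vertex set of a Cayley graph is the whole type, so the graph is given by its set of edges.
  A cycle (of length at least \<open>3\<close>) is identified with its set of edges.
\<close>

definition cayley_edges :: "'g::ab_group_add set \<Rightarrow> 'g set set" where
  "cayley_edges \<Lambda> = {{x, y} | x y. x - y \<in> \<Lambda>}"

definition plus_minus :: "'g::ab_group_add set \<Rightarrow> 'g set" where
  "plus_minus S = S \<union> uminus ` S"

definition cycle_edges :: "'v list \<Rightarrow> 'v set set" where
  "cycle_edges vs = {{vs ! i, vs ! (Suc i mod length vs)} | i. i < length vs}"

definition is_graph_cycle :: "'v set set \<Rightarrow> bool" where
  "is_graph_cycle C \<longleftrightarrow> (\<exists>vs. 3 \<le> length vs \<and> distinct vs \<and> C = cycle_edges vs)"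

definition cycle_decomposition :: "'v set set \<Rightarrow> 'v set set set \<Rightarrow> bool" where
  "cycle_decomposition E \<D> \<longleftrightarrow> (\<forall>C\<in>\<D>. is_graph_cycle C) \<and> partition_on E \<D>"

text \<open>
  Translations act on vertices, hence on cycles (sets of edges); the second conjunct is sharp
  transitivity on the vertices.
\<close>

definition group_regular :: "'g::ab_group_add set set set \<Rightarrow> bool" where
  "group_regular \<D> \<longleftrightarrow>
     (\<forall>g. (\<lambda>C. (\<lambda>e. (+) g ` e) ` C) ` \<D> = \<D>) \<and> (\<forall>x y::'g. \<exists>!g. g + x = y)"

text \<open>An empty row or column has an empty ordering and contributes no cycle.\<close>

definition translates_of_orderings ::
    "nat \<Rightarrow> (nat \<Rightarrow> 'g::ab_group_add list) \<Rightarrow> 'g set set set" where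
  "translates_of_orderings k \<omega> =
     {cycle_edges (map ((+) g) (partial_sums (\<omega> i))) | i g. i < k \<and> \<omega> i \<noteq> []}"

section \<open>Graphs as one-dimensional simplicial complexes\<close>

text \<open>
  Points are given by barycentric coordinates. The realization of an abstract complex \<open>K\<close> carries
  the usual coherent (weak) topology, each simplex having the product topology of \<open>'v \<Rightarrow> real\<close>,
  which on a simplex spanned by finitely many vertices is the Euclidean one.
\<close>

definition geom_simplex :: "'v set \<Rightarrow> ('v \<Rightarrow> real) set" where
  "geom_simplex \<sigma> = {f. (\<forall>v. 0 \<le> f v) \<and> (\<forall>v. v \<notin> \<sigma> \<longrightarrow> f v = 0) \<and> sum f \<sigma> = 1}"

definition polyhedron_of :: "'v set set \<Rightarrow> ('v \<Rightarrow> real) set" where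
  "polyhedron_of K = (\<Union>\<sigma>\<in>K. geom_simplex \<sigma>)"

definition realization :: "'v set set \<Rightarrow> ('v \<Rightarrow> real) topology" where
  "realization K = topology (\<lambda>U. U \<subseteq> polyhedron_of K \<and>
     (\<forall>\<sigma>\<in>K. openin (top_of_set (geom_simplex \<sigma>)) (U \<inter> geom_simplex \<sigma>)))"

lemma openin_realization:
  "openin (realization K) U \<longleftrightarrow> U \<subseteq> polyhedron_of K \<and>
     (\<forall>\<sigma>\<in>K. openin (top_of_set (geom_simplex \<sigma>)) (U \<inter> geom_simplex \<sigma>))"
proof -
  have "istopology (\<lambda>U. U \<subseteq> polyhedron_of K \<and>
     (\<forall>\<sigma>\<in>K. openin (top_of_set (geom_simplex \<sigma>)) (U \<inter> geom_simplex \<sigma>)))"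
    unfolding istopology_def
  proof (intro conjI allI impI ballI)
    fix S T \<sigma>
    assume S: "S \<subseteq> polyhedron_of K \<and>
        (\<forall>\<sigma>\<in>K. openin (top_of_set (geom_simplex \<sigma>)) (S \<inter> geom_simplex \<sigma>))"
      and T: "T \<subseteq> polyhedron_of K \<and>
        (\<forall>\<sigma>\<in>K. openin (top_of_set (geom_simplex \<sigma>)) (T \<inter> geom_simplex \<sigma>))"
    show "S \<inter> T \<subseteq> polyhedron_of K" using S by blast
    assume "\<sigma> \<in> K"
    have "openin (top_of_set (geom_simplex \<sigma>)) ((S \<inter> geom_simplex \<sigma>) \<inter> (T \<inter> geom_simplex \<sigma>))"
    proof (rule openin_Int)
      show "openin (top_of_set (geom_simplex \<sigma>)) (S \<inter> geom_simplex \<sigma>)"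
        using S \<open>\<sigma> \<in> K\<close> by blast
      show "openin (top_of_set (geom_simplex \<sigma>)) (T \<inter> geom_simplex \<sigma>)"
        using T \<open>\<sigma> \<in> K\<close> by blast
    qed
    moreover have "(S \<inter> geom_simplex \<sigma>) \<inter> (T \<inter> geom_simplex \<sigma>) = S \<inter> T \<inter> geom_simplex \<sigma>"
      by blast
    ultimately show "openin (top_of_set (geom_simplex \<sigma>)) (S \<inter> T \<inter> geom_simplex \<sigma>)" by simp
  next
    fix \<K> :: "('a \<Rightarrow> real) set set" and \<sigma>
    assume *: "\<forall>S\<in>\<K>. S \<subseteq> polyhedron_of K \<and>
        (\<forall>\<sigma>\<in>K. openin (top_of_set (geom_simplex \<sigma>)) (S \<inter> geom_simplex \<sigma>))"
    show "\<Union>\<K> \<subseteq> polyhedron_of K" using * by blast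
    assume "\<sigma> \<in> K"
    have "openin (top_of_set (geom_simplex \<sigma>)) (\<Union>S\<in>\<K>. S \<inter> geom_simplex \<sigma>)"
    proof (rule openin_Union)
      fix T assume "T \<in> (\<lambda>S. S \<inter> geom_simplex \<sigma>) ` \<K>"
      then obtain S where "S \<in> \<K>" "T = S \<inter> geom_simplex \<sigma>" by (rule imageE)
      then show "openin (top_of_set (geom_simplex \<sigma>)) T" using * \<open>\<sigma> \<in> K\<close> by simp
    qed
    then show "openin (top_of_set (geom_simplex \<sigma>)) (\<Union>\<K> \<inter> geom_simplex \<sigma>)"
      by (simp only: Int_Union2)
  qed
  then show ?thesis
    unfolding realization_def by (simp add: topology_inverse')
qed

lemma topspace_realization: "topspace (realization K) = polyhedron_of K"
proof -
  have "openin (realization K) (polyhedron_of K)"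
    unfolding openin_realization
  proof (intro conjI ballI order.refl)
    fix \<sigma> assume "\<sigma> \<in> K"
    then have "polyhedron_of K \<inter> geom_simplex \<sigma> = geom_simplex \<sigma>"
      by (auto simp: polyhedron_of_def)
    then show "openin (top_of_set (geom_simplex \<sigma>)) (polyhedron_of K \<inter> geom_simplex \<sigma>)" by simp
  qed
  then show ?thesis
    using openin_subset[of "realization K" "polyhedron_of K"]
      openin_topspace[of "realization K", unfolded openin_realization] by (simp add: subset_antisym)
qed

definition graph_complex :: "'v set \<Rightarrow> 'v set set \<Rightarrow> 'v set set" where
  "graph_complex V E = (\<lambda>v. {v}) ` V \<union> E"

section \<open>Orientable surfaces\<close>

definition surface_chart :: "'s topology \<Rightarrow> 's set \<Rightarrow> ('s \<Rightarrow> complex) \<Rightarrow> bool" where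
  "surface_chart X U \<phi> \<longleftrightarrow>
     openin X U \<and> open (\<phi> ` U) \<and> homeomorphic_map (subtopology X U) (top_of_set (\<phi> ` U)) \<phi>"

text \<open>
  A surface is a two-dimensional topological manifold without boundary. It may be disconnected
  (the Cayley graph is disconnected if the entries of the array do not generate the group), and
  it may have uncountably many components, so second countability is required of each component.
\<close>

definition surface :: "'s topology \<Rightarrow> bool" where
  "surface X \<longleftrightarrow>
     Hausdorff_space X \<and>
     (\<forall>x\<in>topspace X. \<exists>U \<phi>. x \<in> U \<and> surface_chart X U \<phi>) \<and>
     (\<forall>C\<in>connected_components_of X. second_countable (subtopology X C))"

text \<open>
  A homeomorphism between open subsets of the plane preserves the orientation at \<open>z\<close> if the image of
  a small positively oriented circle around \<open>z\<close> winds once, positively, around the image of \<open>z\<close>.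
\<close>

definition orientation_preserving_on :: "complex set \<Rightarrow> (complex \<Rightarrow> complex) \<Rightarrow> bool" where
  "orientation_preserving_on S f \<longleftrightarrow>
     (\<forall>z\<in>S. eventually (\<lambda>r. winding_number (f \<circ> circlepath z r) (f z) = 1) (at_right 0))"

definition orientable :: "'s topology \<Rightarrow> bool" where
  "orientable X \<longleftrightarrow>
     (\<exists>\<A>. (\<forall>(U, \<phi>)\<in>\<A>. surface_chart X U \<phi>) \<and>
          (\<Union>(U, \<phi>)\<in>\<A>. U) = topspace X \<and>
          (\<forall>(U, \<phi>)\<in>\<A>. \<forall>(V, \<psi>)\<in>\<A>.
             orientation_preserving_on (\<phi> ` (U \<inter> V)) (\<psi> \<circ> inv_into U \<phi>)))"

section \<open>Embeddings and biembeddings\<close>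

definition graph_embedding ::
    "'v set \<Rightarrow> 'v set set \<Rightarrow> 's topology \<Rightarrow> (('v \<Rightarrow> real) \<Rightarrow> 's) \<Rightarrow> bool" where
  "graph_embedding V E X \<psi> \<longleftrightarrow>
     continuous_map (realization (graph_complex V E)) X \<psi> \<and>
     inj_on \<psi> (polyhedron_of (graph_complex V E))"

definition embedding_faces ::
    "'v set \<Rightarrow> 'v set set \<Rightarrow> 's topology \<Rightarrow> (('v \<Rightarrow> real) \<Rightarrow> 's) \<Rightarrow> 's set set" where
  "embedding_faces V E X \<psi> =
     connected_components_of
       (subtopology X (topspace X - \<psi> ` polyhedron_of (graph_complex V E)))"

text \<open>Faces of the same colour share no edge; an edge is shared by two faces if it lies on the
  boundary of both.\<close>

definition properly_coloured ::
    "'v set set \<Rightarrow> 's topology \<Rightarrow> (('v \<Rightarrow> real) \<Rightarrow> 's) \<Rightarrow> 's set set \<Rightarrow> bool" where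
  "properly_coloured E X \<psi> \<F> \<longleftrightarrow>
     (\<forall>F\<in>\<F>. \<forall>F'\<in>\<F>. F \<noteq> F' \<longrightarrow>
        \<not> (\<exists>e\<in>E. \<psi> ` geom_simplex e \<subseteq> X frontier_of F \<inter> X frontier_of F'))"

definition biembedding ::
    "'v set \<Rightarrow> 'v set set \<Rightarrow> 'v set set set \<Rightarrow> 'v set set set \<Rightarrow>
     's topology \<Rightarrow> (('v \<Rightarrow> real) \<Rightarrow> 's) \<Rightarrow> bool" where
  "biembedding V E \<D> \<D>' X \<psi> \<longleftrightarrow>
     cycle_decomposition E \<D> \<and> cycle_decomposition E \<D>' \<and>
     graph_embedding V E X \<psi> \<and>
     (\<exists>\<F> \<F>'. \<F> \<union> \<F>' = embedding_faces V E X \<psi> \<and> \<F> \<inter> \<F>' = {} \<and>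
        properly_coloured E X \<psi> \<F> \<and> properly_coloured E X \<psi> \<F>' \<and>
        bij_betw (\<lambda>F. X frontier_of F) \<F> ((\<lambda>C. \<psi> ` polyhedron_of C) ` \<D>) \<and>
        bij_betw (\<lambda>F. X frontier_of F) \<F>' ((\<lambda>C. \<psi> ` polyhedron_of C) ` \<D>'))"

end

theory Submission
  imports Defs
begin

text \<open>
  Reverse the row orderings, and reverse and negate the column orderings: the resulting lists contain
  every element of \<open>\<plusminus>\<E>(A)\<close> exactly once. Take a disc for every translate of every list, divide its
  boundary into arcs labelled by the steps of the list, and glue the arc of the step \<open>s\<close> starting at
  the vertex \<open>x\<close> to the arc of the step \<open>- s\<close> starting at \<open>x + s\<close>. The discs are the faces; every edge
  lies on one disc of a row and one disc of a column. Walking around a vertex takes a step \<open>s\<close> to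
  \<open>- \<omega>\<^sub>r(s)\<close> and \<open>- s\<close> to \<open>\<omega>\<^sub>c(s)\<close>, so two corners further on \<open>\<omega>\<^sub>c \<circ> \<omega>\<^sub>r\<close> has been applied: the corners at a
  vertex close up to a single disc precisely because this permutation is one cycle.

  Let \<open>z\<close> be the coordinate on a disc with \<open>l\<close> arcs. The coordinate \<open>\<zeta>\<close> along its \<open>k\<close>-th arc with
  \<open>z = exp ((\<zeta> + 2 \<pi> \<i> k) / l)\<close> glues the two discs at an edge to a strip, and the coordinate \<open>w\<close> with
  \<open>\<zeta> = \<plusminus> \<i> w\<^sup>d\<close>, where \<open>d = |\<E>(A)|\<close>, glues the \<open>2 d\<close> corners at a vertex. All coordinate changes are
  holomorphic, so the surface is orientable.
\<close>

text \<open>The reversals are dictated by orientation. With every disc to the left of its boundary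
  darts, a corner between \<open>rot j\<close> and \<open>rot (Suc j)\<close> requires the boundary
  step \<open>- rot (Suc j)\<close> to be followed by \<open>rot j\<close>: on a row disc
  \<omega>r(e) is followed by e, on a column disc -\<omega>c(u) by -u. The negation makes the two
  discs at an edge traverse it in opposite directions. Reversing and negating a list of sum 0
  traverses its cycle of partial sums backwards, so the columns still yield the cycles of
  \<open>\<omega>c\<close>; reversing alone negates the partial sums, whence the inverse of the row
  orderings.

  Orientability is stated by winding numbers. For arbitrary homeomorphisms this would call for
  degree theory; for injective holomorphic maps a logarithm suffices, which is why exponentials and
  powers replace polygons. Points are concrete triples and the topology is the final one for the
  charts, so the Hausdorff property needs its own argument. The group may be infinite, even
  uncountable: second countability of a component comes from the countable subgroup generated by the
  entries, and compactness is claimed for finite groups only.\<close>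

section \<open>Spaces glued from holomorphically compatible charts\<close>

text \<open>Injectivity makes the difference quotient at \<open>z\<close>, completed by the
  derivative, a holomorphic function without zeros on the disc, so it has a logarithm. This turns
  holomorphic coordinate changes into the orientation condition.\<close>

lemma winding_number_injective_holomorphic:
  assumes holf: "f holomorphic_on ball z R" and inj: "inj_on f (ball z R)" and r: "0 < r" "r < R"
  shows "winding_number (f \<circ> circlepath z r) (f z) = 1"
proof -
  define g where "g y = (if y = z then deriv f z else (f y - f z) / (y - z))" for y
  have zin: "z \<in> ball z R" using r by simp
  have holg: "g holomorphic_on ball z R"
    unfolding g_def using pole_lemma_open[OF holf open_ball] by simp
  have g_nz: "g y \<noteq> 0" if "y \<in> ball z R" for y
  proof (cases "y = z")
    case True
    then show ?thesis
      using holomorphic_injective_imp_regular[OF holf open_ball inj zin] by (simp add: g_def)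
  next
    case False
    then have "f y \<noteq> f z" using inj that zin by (meson inj_onD)
    then show ?thesis using False by (simp add: g_def)
  qed
  obtain h where holh: "h holomorphic_on ball z R" and h: "\<And>y. y \<in> ball z R \<Longrightarrow> g y = exp (h y)"
    using contractible_imp_holomorphic_log[OF holg convex_imp_contractible[OF convex_ball]] g_nz
    by metis
  \<comment> \<open>A logarithm of the loop seen from \<open>f z\<close>. The part coming from
    \<open>h\<close> closes up along the circle, so the increment is exactly that of the term linear
    in \<open>t\<close>.\<close>
  define p where "p t = complex_of_real (ln r) + 2 * of_real pi * \<i> * of_real t + h (circlepath z r t)" for t
  have in_ball: "circlepath z r t \<in> ball z R" for t
    using r by (simp add: circlepath dist_norm norm_mult)
  have circ_ne: "circlepath z r t \<noteq> z" for t
    using r by (simp add: circlepath)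
  have "f (circlepath z r t) - f z = exp (p t)" for t
  proof -
    have "exp (p t) = of_real r * exp (2 * of_real pi * \<i> * of_real t) * g (circlepath z r t)"
      using h[OF in_ball] r unfolding p_def by (simp add: exp_add exp_of_real)
    also have "of_real r * exp (2 * of_real pi * \<i> * of_real t) = circlepath z r t - z"
      by (simp add: circlepath)
    finally show ?thesis
      using circ_ne[of t] by (simp add: g_def)
  qed
  then have eq: "(\<lambda>t. (f \<circ> circlepath z r) t - f z) = exp \<circ> p"
    by (simp add: fun_eq_iff)
  have "path (h \<circ> circlepath z r)"
    by (rule path_continuous_image[OF path_circlepath])
       (use in_ball in \<open>auto intro!: holomorphic_on_imp_continuous_on[OF holomorphic_on_subset[OF holh]] simp: path_image_def\<close>)
  then have "path p"
    unfolding p_def path_def o_def by (intro continuous_intros) auto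
  then have "winding_number (exp \<circ> p) 0 = (pathfinish p - pathstart p) / (2 * of_real pi * \<i>)"
    by (rule winding_number_compose_exp)
  also have "pathfinish p - pathstart p = 2 * of_real pi * \<i>"
    by (simp add: pathfinish_def pathstart_def p_def circlepath)
  finally have "winding_number (exp \<circ> p) 0 = 1" by (simp add: o_def)
  then show ?thesis
    using winding_number_offset[of "f \<circ> circlepath z r" "f z"] eq by simp
qed

text \<open>Two parametrizations are compared near a single pair of parameters, so that such
  comparisons can be inverted and composed like coordinate changes. Injectivity of \<open>T\<close>
  follows from that of \<open>\<sigma>\<close>.\<close>

definition holo_germ ::
    "complex set \<Rightarrow> (complex \<Rightarrow> 'p) \<Rightarrow> complex \<Rightarrow> complex set \<Rightarrow> (complex \<Rightarrow> 'p) \<Rightarrow> complex \<Rightarrow> bool" where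
  "holo_germ S \<sigma> z S' \<tau> w \<longleftrightarrow>
     (\<exists>N T. open N \<and> z \<in> N \<and> N \<subseteq> S \<and> T holomorphic_on N \<and> T z = w \<and> T ` N \<subseteq> S' \<and>
            (\<forall>y\<in>N. \<sigma> y = \<tau> (T y)))"

lemma holo_germ_refl: "open S \<Longrightarrow> z \<in> S \<Longrightarrow> holo_germ S \<sigma> z S \<sigma> z"
  unfolding holo_germ_def by (intro exI[of _ S] exI[of _ id]) (auto intro: holomorphic_on_id)

text \<open>\<open>T\<close> is injective because \<open>\<sigma>\<close> is, and an injective
  holomorphic map is open with holomorphic inverse.\<close>

lemma holo_germ_sym:
  assumes "holo_germ S \<sigma> z S' \<tau> w" and "inj_on \<sigma> S"
  shows "holo_germ S' \<tau> w S \<sigma> z"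
proof -
  obtain N T where N: "open N" "z \<in> N" "N \<subseteq> S" "T holomorphic_on N" "T z = w" "T ` N \<subseteq> S'"
      "\<forall>y\<in>N. \<sigma> y = \<tau> (T y)"
    using assms(1) unfolding holo_germ_def by blast
  have injT: "inj_on T N"
    using N assms(2) by (metis (no_types, lifting) inj_onI inj_on_subset inj_onD)
  obtain g where g: "g holomorphic_on T ` N" "\<And>y. y \<in> N \<Longrightarrow> g (T y) = y"
    using holomorphic_has_inverse[OF N(4,1) injT] by metis
  have "open (T ` N)" using open_mapping_thm3[OF N(4,1) injT] .
  then show ?thesis
    unfolding holo_germ_def using N g
    by (intro exI[of _ "T ` N"] exI[of _ g]) auto
qed

lemma holo_germ_trans:
  assumes "holo_germ S \<sigma> z S' \<tau> w" and "holo_germ S' \<tau> w S'' \<rho> v"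
  shows "holo_germ S \<sigma> z S'' \<rho> v"
proof -
  obtain N T where N: "open N" "z \<in> N" "N \<subseteq> S" "T holomorphic_on N" "T z = w" "T ` N \<subseteq> S'"
      "\<forall>y\<in>N. \<sigma> y = \<tau> (T y)"
    using assms(1) unfolding holo_germ_def by blast
  obtain N' T' where N': "open N'" "w \<in> N'" "N' \<subseteq> S'" "T' holomorphic_on N'" "T' w = v" "T' ` N' \<subseteq> S''"
      "\<forall>y\<in>N'. \<tau> y = \<rho> (T' y)"
    using assms(2) unfolding holo_germ_def by blast
  have "open (T -` N' \<inter> N)"
    using N N'(1) holomorphic_on_imp_continuous_on continuous_on_open_vimage by blast
  moreover have "(T' \<circ> T) holomorphic_on (T -` N' \<inter> N)"
    by (rule holomorphic_on_compose_gen[OF holomorphic_on_subset[OF N(4)] N'(4)]) auto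
  ultimately show ?thesis
    unfolding holo_germ_def using N N'
    by (intro exI[of _ "T -` N' \<inter> N"] exI[of _ "T' \<circ> T"]) auto
qed

text \<open>Charts enter through their inverses \<open>\<sigma> a\<close>, from open plane sets into
  points that exist beforehand. Compatibility is a condition at each common point, so it can be
  checked separately inside faces, on edges and at vertices.\<close>

locale glued_charts =
  fixes A :: "'a set" and S :: "'a \<Rightarrow> complex set" and \<sigma> :: "'a \<Rightarrow> complex \<Rightarrow> 'p"
  assumes open_dom: "a \<in> A \<Longrightarrow> open (S a)"
    and inj_param: "a \<in> A \<Longrightarrow> inj_on (\<sigma> a) (S a)"
    and compat: "\<lbrakk>a \<in> A; b \<in> A; z \<in> S a; w \<in> S b; \<sigma> a z = \<sigma> b w\<rbrakk>
                   \<Longrightarrow> holo_germ (S a) (\<sigma> a) z (S b) (\<sigma> b) w"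
begin

section \<open>The final topology of the parametrizations, and its charts\<close>

abbreviation open_in_charts :: "'p set \<Rightarrow> bool" where
  "open_in_charts U \<equiv> U \<subseteq> (\<Union>a\<in>A. \<sigma> a ` S a) \<and> (\<forall>a\<in>A. open {z \<in> S a. \<sigma> a z \<in> U})"

definition surf :: "'p topology" where
  "surf = topology open_in_charts"

lemma openin_space:
  "openin surf U \<longleftrightarrow> open_in_charts U"
proof -
  have "istopology open_in_charts"
    unfolding istopology_def
  proof (intro conjI allI impI ballI)
    fix U V a
    assume U: "open_in_charts U" and V: "open_in_charts V"
    show "U \<inter> V \<subseteq> (\<Union>a\<in>A. \<sigma> a ` S a)" using U by blast
    assume a: "a \<in> A"
    have "{z \<in> S a. \<sigma> a z \<in> U \<inter> V} = {z \<in> S a. \<sigma> a z \<in> U} \<inter> {z \<in> S a. \<sigma> a z \<in> V}" by blast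
    then show "open {z \<in> S a. \<sigma> a z \<in> U \<inter> V}" using U V a by (simp add: open_Int)
  next
    fix \<K> a
    assume *: "\<forall>U\<in>\<K>. open_in_charts U"
    show "\<Union>\<K> \<subseteq> (\<Union>a\<in>A. \<sigma> a ` S a)" using * by blast
    assume a: "a \<in> A"
    have "{z \<in> S a. \<sigma> a z \<in> \<Union>\<K>} = (\<Union>U\<in>\<K>. {z \<in> S a. \<sigma> a z \<in> U})" by blast
    then show "open {z \<in> S a. \<sigma> a z \<in> \<Union>\<K>}" using * a by (simp add: open_UN)
  qed
  then show ?thesis
    unfolding surf_def by (simp add: topology_inverse')
qed

text \<open>Compatibility makes the parametrizations open: a germ \<open>T\<close> from chart
  \<open>b\<close> to chart \<open>a\<close> pulls \<open>W\<close> back to a neighbourhood of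
  \<open>w\<close> that is mapped into the image.\<close>

lemma openin_chart_image:
  assumes a: "a \<in> A" and W: "open W" "W \<subseteq> S a"
  shows "openin surf (\<sigma> a ` W)"
  unfolding openin_space
proof (intro conjI ballI)
  show "\<sigma> a ` W \<subseteq> (\<Union>a\<in>A. \<sigma> a ` S a)" using a W by blast
  fix b assume b: "b \<in> A"
  show "open {w \<in> S b. \<sigma> b w \<in> \<sigma> a ` W}"
  proof (subst open_subopen, intro ballI)
    fix w assume "w \<in> {w \<in> S b. \<sigma> b w \<in> \<sigma> a ` W}"
    then obtain z where z: "z \<in> W" "\<sigma> b w = \<sigma> a z" "w \<in> S b" by blast
    then obtain N T where N: "open N" "w \<in> N" "N \<subseteq> S b" "T holomorphic_on N" "T w = z" "T ` N \<subseteq> S a"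
        "\<forall>y\<in>N. \<sigma> b y = \<sigma> a (T y)"
      using compat[OF b a, of w z] W unfolding holo_germ_def by blast
    have "open (T -` W \<inter> N)"
      using N W(1) holomorphic_on_imp_continuous_on continuous_on_open_vimage by blast
    then show "\<exists>U. open U \<and> w \<in> U \<and> U \<subseteq> {w \<in> S b. \<sigma> b w \<in> \<sigma> a ` W}"
      using N z by (intro exI[of _ "T -` W \<inter> N"]) auto
  qed
qed

lemma topspace_space: "topspace surf = (\<Union>a\<in>A. \<sigma> a ` S a)"
proof
  show "topspace surf \<subseteq> (\<Union>a\<in>A. \<sigma> a ` S a)"
    using openin_topspace[of surf] unfolding openin_space by blast
  show "(\<Union>a\<in>A. \<sigma> a ` S a) \<subseteq> topspace surf"
    by (intro UN_least openin_subset openin_chart_image open_dom order.refl)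
qed

lemma param_in_topspace: "a \<in> A \<Longrightarrow> z \<in> S a \<Longrightarrow> \<sigma> a z \<in> topspace surf"
  by (auto simp: topspace_space)

lemma continuous_map_param:
  assumes "a \<in> A" shows "continuous_map (top_of_set (S a)) surf (\<sigma> a)"
  unfolding continuous_map_def
proof (intro conjI allI impI)
  show "\<sigma> a \<in> topspace (top_of_set (S a)) \<rightarrow> topspace surf"
    using assms by (auto simp: topspace_space)
  fix U assume "openin surf U"
  then have "open {z \<in> S a. \<sigma> a z \<in> U}" using assms openin_space by blast
  then show "openin (top_of_set (S a)) {z \<in> topspace (top_of_set (S a)). \<sigma> a z \<in> U}"
    by (auto intro: open_subset)
qed

lemma continuous_map_param_compose:
  assumes "a \<in> A" and "continuous_on W g" and "g ` W \<subseteq> S a"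
  shows "continuous_map (top_of_set W) surf (\<lambda>t. \<sigma> a (g t))"
proof -
  have "continuous_map (top_of_set W) (top_of_set (S a)) g"
    using assms by (auto simp: image_subset_iff_funcset)
  from continuous_map_compose[OF this continuous_map_param[OF assms(1)]]
  show ?thesis by (simp add: o_def)
qed

lemma continuous_map_from_space:
  fixes f :: "'p \<Rightarrow> 'b::topological_space"
  assumes "\<And>a. a \<in> A \<Longrightarrow> continuous_on (S a) (\<lambda>z. f (\<sigma> a z))"
  shows "continuous_map surf euclidean f"
  unfolding continuous_map_def
proof (intro conjI allI impI)
  show "f \<in> topspace surf \<rightarrow> topspace euclidean" by simp
  fix U :: "'b set" assume "openin euclidean U"
  then have U: "open U" by simp
  have "open {z \<in> S a. \<sigma> a z \<in> {x \<in> topspace surf. f x \<in> U}}" if a: "a \<in> A" for a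
  proof -
    have "open ((\<lambda>z. f (\<sigma> a z)) -` U \<inter> S a)"
      using assms[OF a] U open_dom[OF a] continuous_on_open_vimage by blast
    moreover have "(\<lambda>z. f (\<sigma> a z)) -` U \<inter> S a = {z \<in> S a. \<sigma> a z \<in> {x \<in> topspace surf. f x \<in> U}}"
      using a param_in_topspace by blast
    ultimately show ?thesis by simp
  qed
  then show "openin surf {x \<in> topspace surf. f x \<in> U}"
    unfolding openin_space topspace_space by blast
qed

lemma compactin_param_image:
  assumes "a \<in> A" "compact K" "K \<subseteq> S a"
  shows "compactin surf (\<sigma> a ` K)"
  by (rule image_compactin[OF _ continuous_map_param[OF assms(1)]])
     (use assms in \<open>auto simp: compactin_subtopology\<close>)

lemma connectedin_param_image:
  assumes "a \<in> A" "connected K" "K \<subseteq> S a"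
  shows "connectedin surf (\<sigma> a ` K)"
  by (rule connectedin_continuous_map_image[OF continuous_map_param[OF assms(1)]])
     (use assms in \<open>auto simp: connectedin_subtopology\<close>)

text \<open>Since \<open>\<sigma> a\<close> is continuous and open, closures can be computed in any
  chart; this serves to determine the frontiers of faces.\<close>

lemma in_closure_iff:
  assumes a: "a \<in> A" and z: "z \<in> S a"
  shows "\<sigma> a z \<in> surf closure_of T \<longleftrightarrow> z \<in> closure {y \<in> S a. \<sigma> a y \<in> T}"
proof
  assume L: "\<sigma> a z \<in> surf closure_of T"
  show "z \<in> closure {y \<in> S a. \<sigma> a y \<in> T}"
  proof (rule ccontr)
    let ?V = "S a - closure {y \<in> S a. \<sigma> a y \<in> T}"
    assume "z \<notin> closure {y \<in> S a. \<sigma> a y \<in> T}"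
    then have "\<sigma> a z \<in> \<sigma> a ` ?V" using z by blast
    moreover have "openin surf (\<sigma> a ` ?V)"
      using a open_dom[OF a] by (intro openin_chart_image) (auto intro: open_Diff)
    ultimately have "\<exists>x. x \<in> T \<and> x \<in> \<sigma> a ` ?V"
      using L[unfolded in_closure_of, THEN conjunct2, THEN spec, of "\<sigma> a ` ?V"] by simp
    then obtain y where "y \<in> ?V" "\<sigma> a y \<in> T" by blast
    then show False using closure_subset[of "{y \<in> S a. \<sigma> a y \<in> T}"] by blast
  qed
next
  assume R: "z \<in> closure {y \<in> S a. \<sigma> a y \<in> T}"
  show "\<sigma> a z \<in> surf closure_of T"
    unfolding in_closure_of
  proof (intro conjI allI impI)
    show "\<sigma> a z \<in> topspace surf" using a z by (rule param_in_topspace)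
    fix U assume U: "\<sigma> a z \<in> U \<and> openin surf U"
    then have "open {y \<in> S a. \<sigma> a y \<in> U}" using a openin_space by blast
    then have "{y \<in> S a. \<sigma> a y \<in> U} \<inter> {y \<in> S a. \<sigma> a y \<in> T} \<noteq> {}"
      using R U z open_Int_closure_eq_empty[of "{y \<in> S a. \<sigma> a y \<in> U}"] by blast
    then show "\<exists>y. y \<in> T \<and> y \<in> U" by blast
  qed
qed

lemma param_inv: "a \<in> A \<Longrightarrow> z \<in> S a \<Longrightarrow> inv_into (S a) (\<sigma> a) (\<sigma> a z) = z"
  by (simp add: inj_param)

lemma chart_image: "a \<in> A \<Longrightarrow> inv_into (S a) (\<sigma> a) ` \<sigma> a ` W = W" if "W \<subseteq> S a" for W
  using that param_inv by force

lemma surface_chart_param: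
  assumes a: "a \<in> A"
  shows "surface_chart surf (\<sigma> a ` S a) (inv_into (S a) (\<sigma> a))"
proof -
  let ?U = "\<sigma> a ` S a" and ?\<phi> = "inv_into (S a) (\<sigma> a)"
  have U: "openin surf ?U" using a open_dom by (intro openin_chart_image) auto
  have im: "?\<phi> ` ?U = S a" using chart_image[OF order.refl a] .
  have top: "topspace (subtopology surf ?U) = ?U"
    using U by (simp add: openin_subset inf.absorb2)
  have "homeomorphic_map (subtopology surf ?U) (top_of_set (S a)) ?\<phi>"
  proof (rule bijective_open_imp_homeomorphic_map)
    show "continuous_map (subtopology surf ?U) (top_of_set (S a)) ?\<phi>"
      unfolding continuous_map_def
    proof (intro conjI allI impI)
      show "?\<phi> \<in> topspace (subtopology surf ?U) \<rightarrow> topspace (top_of_set (S a))"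
        unfolding top using im by (auto simp: image_subset_iff_funcset[symmetric])
      fix W assume "openin (top_of_set (S a)) W"
      then have W: "open W" "W \<subseteq> S a"
        using open_dom[OF a] by (auto simp: openin_open_eq)
      have "{x \<in> ?U. ?\<phi> x \<in> W} = \<sigma> a ` W"
        using W a by (auto simp: param_inv)
      then show "openin (subtopology surf ?U) {x \<in> topspace (subtopology surf ?U). ?\<phi> x \<in> W}"
        unfolding top using openin_chart_image[OF a W] U
        by (simp add: openin_open_subtopology) (use W in auto)
    qed
    show "open_map (subtopology surf ?U) (top_of_set (S a)) ?\<phi>"
      unfolding open_map_def
    proof (intro allI impI)
      fix V assume "openin (subtopology surf ?U) V"
      then have V: "openin surf V" "V \<subseteq> ?U" using U by (auto simp: openin_open_subtopology)
      have "?\<phi> ` V = {z \<in> S a. \<sigma> a z \<in> V}"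
      proof (intro equalityI subsetI)
        fix y assume "y \<in> ?\<phi> ` V"
        then show "y \<in> {z \<in> S a. \<sigma> a z \<in> V}" using V(2) a by (auto simp: param_inv)
      next
        fix y assume "y \<in> {z \<in> S a. \<sigma> a z \<in> V}"
        then show "y \<in> ?\<phi> ` V" using a by (auto simp: param_inv intro!: image_eqI[of _ _ "\<sigma> a y"])
      qed
      moreover have "open {z \<in> S a. \<sigma> a z \<in> V}" using V a openin_space by blast
      ultimately show "openin (top_of_set (S a)) (?\<phi> ` V)" by (auto intro: open_subset)
    qed
    show "?\<phi> ` topspace (subtopology surf ?U) = topspace (top_of_set (S a))"
      unfolding top using im by simp
    show "inj_on ?\<phi> (topspace (subtopology surf ?U))"
      unfolding top by (rule inj_on_inv_into) simp
  qed
  then show ?thesis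
    unfolding surface_chart_def using U open_dom[OF a] im by simp
qed

text \<open>The atlas consists of all charts. Near each point a transition map agrees with a germ
  \<open>T\<close>, which inherits injectivity from \<open>\<sigma> a\<close>, so the winding number
  lemma applies on a small disc.\<close>

lemma orientable_space: "orientable surf"
  unfolding orientable_def
proof (intro exI conjI)
  let ?\<A> = "(\<lambda>a. (\<sigma> a ` S a, inv_into (S a) (\<sigma> a))) ` A"
  show "\<forall>(U, \<phi>)\<in>?\<A>. surface_chart surf U \<phi>"
    using surface_chart_param by auto
  show "(\<Union>(U, \<phi>)\<in>?\<A>. U) = topspace surf"
    by (auto simp: topspace_space)
  have "orientation_preserving_on (inv_into (S a) (\<sigma> a) ` (\<sigma> a ` S a \<inter> \<sigma> b ` S b))
      (inv_into (S b) (\<sigma> b) \<circ> inv_into (\<sigma> a ` S a) (inv_into (S a) (\<sigma> a)))"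
    if a: "a \<in> A" and b: "b \<in> A" for a b
    unfolding orientation_preserving_on_def
  proof
    let ?f = "inv_into (S b) (\<sigma> b) \<circ> inv_into (\<sigma> a ` S a) (inv_into (S a) (\<sigma> a))"
    fix z assume "z \<in> inv_into (S a) (\<sigma> a) ` (\<sigma> a ` S a \<inter> \<sigma> b ` S b)"
    then obtain p where p: "p \<in> \<sigma> a ` S a" "p \<in> \<sigma> b ` S b" "z = inv_into (S a) (\<sigma> a) p" by blast
    then obtain w where w: "w \<in> S b" "p = \<sigma> b w" by blast
    have z: "z \<in> S a" "\<sigma> a z = p"
      using p inv_into_into[OF p(1)] f_inv_into_f[OF p(1)] by auto
    obtain N T where N: "open N" "z \<in> N" "N \<subseteq> S a" "T holomorphic_on N" "T z = w" "T ` N \<subseteq> S b"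
        "\<forall>y\<in>N. \<sigma> a y = \<sigma> b (T y)"
      using compat[OF a b z(1) w(1)] w z unfolding holo_germ_def by blast
    obtain R where R: "0 < R" "ball z R \<subseteq> N" using N open_contains_ball by blast
    have inv: "inv_into (\<sigma> a ` S a) (inv_into (S a) (\<sigma> a)) y = \<sigma> a y" if "y \<in> S a" for y
    proof (rule inv_into_f_eq)
      show "inj_on (inv_into (S a) (\<sigma> a)) (\<sigma> a ` S a)" by (rule inj_on_inv_into) simp
    qed (use that a in \<open>auto simp: param_inv\<close>)
    have fT: "?f y = T y" if "y \<in> N" for y
    proof -
      have "y \<in> S a" "T y \<in> S b" "\<sigma> a y = \<sigma> b (T y)" using N that by auto
      then show ?thesis using inv param_inv[OF b] by simp
    qed
    have "inj_on T N"
      using N inj_param[OF a] by (metis (no_types, lifting) inj_onI inj_on_subset inj_onD)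
    then have "inj_on T (ball z R)" using R(2) inj_on_subset by blast
    moreover have fT': "?f y = T y" if "y \<in> ball z R" for y using that R(2) fT by blast
    ultimately have injf: "inj_on ?f (ball z R)"
      using inj_on_cong[of "ball z R" ?f T] by blast
    have "?f holomorphic_on ball z R"
      using holomorphic_transform[OF holomorphic_on_subset[OF N(4) R(2)], of ?f] fT' by simp
    then have "winding_number (?f \<circ> circlepath z r) (?f z) = 1" if "0 < r" "r < R" for r
      using winding_number_injective_holomorphic[OF _ injf that] by blast
    then show "\<forall>\<^sub>F r in at_right 0. winding_number (?f \<circ> circlepath z r) (?f z) = 1"
      unfolding eventually_at_right_field using R(1) by blast
  qed
  then show "\<forall>(U, \<phi>)\<in>?\<A>. \<forall>(V, \<psi>)\<in>?\<A>.
             orientation_preserving_on (\<phi> ` (U \<inter> V)) (\<psi> \<circ> inv_into U \<phi>)"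
    by auto
qed

lemma second_countable_countable_charts:
  assumes B: "countable B" "B \<subseteq> A"
  shows "second_countable (subtopology surf (\<Union>b\<in>B. \<sigma> b ` S b))"
proof -
  obtain \<Q> :: "complex set set" where Q: "countable \<Q>" "\<And>C. C \<in> \<Q> \<Longrightarrow> open C"
      "\<And>U. open U \<Longrightarrow> \<exists>Q'. Q' \<subseteq> \<Q> \<and> U = \<Union>Q'"
    using Elementary_Topology.univ_second_countable by metis
  let ?M = "\<Union>b\<in>B. \<sigma> b ` S b"
  let ?\<B> = "\<Union>b\<in>B. (\<lambda>Q. \<sigma> b ` Q) ` {Q\<in>\<Q>. Q \<subseteq> S b}"
  have M: "openin surf ?M"
    using B open_dom by (intro openin_Union) (auto intro!: openin_chart_image)
  show ?thesis
    unfolding second_countable_def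
  proof (intro exI conjI ballI allI impI)
    show "countable ?\<B>" using B(1) Q(1) by auto
    fix V assume "V \<in> ?\<B>"
    then obtain b Q where bQ: "b \<in> B" "Q \<in> \<Q>" "Q \<subseteq> S b" "V = \<sigma> b ` Q" by blast
    have "openin surf V" using bQ Q(2) B by (auto intro!: openin_chart_image)
    then show "openin (subtopology surf ?M) V"
      using bQ M by (auto simp: openin_open_subtopology)
  next
    fix U x assume "openin (subtopology surf ?M) U \<and> x \<in> U"
    then have U: "openin surf U" "U \<subseteq> ?M" "x \<in> U" using M by (auto simp: openin_open_subtopology)
    then obtain b z where b: "b \<in> B" "z \<in> S b" "x = \<sigma> b z" by blast
    have "open {z \<in> S b. \<sigma> b z \<in> U}" using U b B openin_space by blast
    then obtain Q' where Q': "Q' \<subseteq> \<Q>" "{z \<in> S b. \<sigma> b z \<in> U} = \<Union>Q'" using Q(3) by blast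
    then obtain C where "C \<in> Q'" "z \<in> C" using b U by blast
    moreover have "C \<subseteq> {z \<in> S b. \<sigma> b z \<in> U}" using Q' calculation by blast
    ultimately show "\<exists>V\<in>?\<B>. x \<in> V \<and> V \<subseteq> U"
      using b Q'(1) by (intro bexI[of _ "\<sigma> b ` C"]) auto
  qed
qed

text \<open>A countable cluster that meets no chart outside itself covers a clopen set, and this set
  contains every component that meets it. The family of all charts may be uncountable.\<close>

lemma second_countable_component:
  assumes clusters: "\<And>a. a \<in> A \<Longrightarrow> \<exists>B\<subseteq>A. countable B \<and> a \<in> B \<and>
      (\<forall>b\<in>B. \<forall>c\<in>A - B. \<sigma> b ` S b \<inter> \<sigma> c ` S c = {})"
    and C: "C \<in> connected_components_of surf"
  shows "second_countable (subtopology surf C)"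
proof -
  obtain x where x: "x \<in> topspace surf" "C = connected_component_of_set surf x"
    using C unfolding connected_components_of_def by blast
  then obtain a where a: "a \<in> A" "x \<in> \<sigma> a ` S a" by (auto simp: topspace_space)
  obtain B where B: "B \<subseteq> A" "countable B" "a \<in> B"
      "\<forall>b\<in>B. \<forall>c\<in>A - B. \<sigma> b ` S b \<inter> \<sigma> c ` S c = {}"
    using clusters[OF a(1)] by blast
  let ?M = "\<Union>b\<in>B. \<sigma> b ` S b" and ?M' = "\<Union>b\<in>A - B. \<sigma> b ` S b"
  have "openin surf ?M" "openin surf ?M'"
    using B open_dom by (auto intro!: openin_Union openin_chart_image)
  moreover have "?M' = topspace surf - ?M"
    using B by (auto simp: topspace_space) blast+
  ultimately have "closedin surf ?M" "openin surf ?M"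
    by (auto simp: closedin_def dest: openin_subset)
  moreover have "connectedin surf C" using C by (rule connectedin_connected_components_of)
  moreover have "x \<in> C" "x \<in> ?M" using x a B(3) by (auto simp: connected_component_of_refl)
  then have "\<not> disjnt C ?M" by (meson disjnt_iff)
  ultimately have "C \<subseteq> ?M"
    using connectedin_clopen_cases by metis
  then have "subtopology surf C = subtopology (subtopology surf ?M) C"
    by (simp add: subtopology_subtopology inf.absorb2)
  then show ?thesis
    using second_countable_subtopology[OF second_countable_countable_charts[OF B(2,1)]] by simp
qed

lemma separate_in_chart:
  assumes "a \<in> A" "z \<in> S a" "w \<in> S a" "z \<noteq> w"
  shows "\<exists>U V. openin surf U \<and> openin surf V \<and> \<sigma> a z \<in> U \<and> \<sigma> a w \<in> V \<and> disjnt U V"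
proof -
  obtain U V where UV: "open U" "open V" "z \<in> U" "w \<in> V" "U \<inter> V = {}"
    using assms(4) hausdorff by metis
  have "openin surf (\<sigma> a ` (U \<inter> S a))" "openin surf (\<sigma> a ` (V \<inter> S a))"
    using UV assms(1) open_dom by (auto intro!: openin_chart_image)
  moreover have "disjnt (\<sigma> a ` (U \<inter> S a)) (\<sigma> a ` (V \<inter> S a))"
    using UV inj_param[OF assms(1)] by (fastforce simp: disjnt_def dest: inj_onD)
  ultimately show ?thesis using UV assms by blast
qed

end

section \<open>Systems of darts\<close>

text \<open>
  A dart \<open>(x, s)\<close> is the edge \<open>{x, x + s}\<close> directed from \<open>x\<close> to \<open>x + s\<close>. The list \<open>L f\<close> contains the
  steps of the boundary of a face in counterclockwise order, and \<open>rot\<close> runs counterclockwise through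
  the steps of the darts leaving a vertex; the last assumption says that \<open>rot j\<close> and \<open>rot (Suc j)\<close> are the
  two sides of a corner.
\<close>

locale dart_system =
  fixes N :: nat and L :: "nat \<Rightarrow> 'g::ab_group_add list" and E :: "'g set" and rot :: "nat \<Rightarrow> 'g"
  assumes finite_E: "finite E"
    and E_nonempty: "E \<noteq> {}"
    and E_asym: "s \<in> E \<Longrightarrow> - s \<notin> E"
    and step_ex: "s \<in> plus_minus E \<Longrightarrow> \<exists>f<N. \<exists>k<length (L f). L f ! k = s"
    and step_in: "\<lbrakk>f < N; k < length (L f)\<rbrakk> \<Longrightarrow> L f ! k \<in> plus_minus E"
    and step_unique: "\<lbrakk>f < N; k < length (L f); f' < N; k' < length (L f'); L f ! k = L f' ! k'\<rbrakk>
                        \<Longrightarrow> f = f' \<and> k = k'"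
    and sum_steps: "f < N \<Longrightarrow> sum_list (L f) = 0"
    and rot_bij: "bij_betw rot {..<2 * card E} (plus_minus E)"
    and rot_periodic: "rot (j + 2 * card E) = rot j"
    and rot_step: "\<lbrakk>f < N; k < length (L f); L f ! k = - rot (Suc j)\<rbrakk>
                     \<Longrightarrow> L f ! (Suc k mod length (L f)) = rot j"
begin

abbreviation "\<Lambda> \<equiv> plus_minus E"
abbreviation "deg \<equiv> card E"
abbreviation "corner j w \<equiv> \<i> * (- 1) ^ j * w ^ deg"

text \<open>The face to the left of the dart \<open>(x, s)\<close> is the disc \<open>(face_idx s, x - offset s)\<close>.\<close>

definition face_idx :: "'g \<Rightarrow> nat" where "face_idx s = (THE f. f < N \<and> s \<in> set (L f))"
definition step_pos :: "'g \<Rightarrow> nat" where "step_pos s = (THE k. k < length (L (face_idx s)) \<and> L (face_idx s) ! k = s)"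
definition face_len :: "'g \<Rightarrow> nat" where "face_len s = length (L (face_idx s))"
definition offset :: "'g \<Rightarrow> 'g" where "offset s = sum_list (take (step_pos s) (L (face_idx s)))"
definition next_step :: "'g \<Rightarrow> 'g" where "next_step s = L (face_idx s) ! (Suc (step_pos s) mod face_len s)"

lemma face_idx_step_pos:
  assumes "f < N" "k < length (L f)"
  shows "face_idx (L f ! k) = f" "step_pos (L f ! k) = k"
proof -
  show face_idx: "face_idx (L f ! k) = f"
    unfolding face_idx_def
  proof (rule the_equality)
    fix f' assume "f' < N \<and> L f ! k \<in> set (L f')"
    then show "f' = f" using assms step_unique by (metis in_set_conv_nth)
  qed (use assms in auto)
  show "step_pos (L f ! k) = k"
    unfolding step_pos_def face_idx by (rule the_equality) (use assms step_unique in blast)+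
qed

lemma step_of_dart:
  assumes "s \<in> \<Lambda>"
  shows "face_idx s < N" "step_pos s < face_len s" "L (face_idx s) ! step_pos s = s"
proof -
  obtain f k where "f < N" "k < length (L f)" "L f ! k = s" using step_ex assms by blast
  then show "face_idx s < N" "step_pos s < face_len s" "L (face_idx s) ! step_pos s = s"
    using face_idx_step_pos[of f k] by (auto simp: face_len_def)
qed

lemma minus_in: "s \<in> \<Lambda> \<Longrightarrow> - s \<in> \<Lambda>"
  by (auto simp: plus_minus_def)

lemma dart_cases: "s \<in> \<Lambda> \<longleftrightarrow> s \<in> E \<or> - s \<in> E"
  by (auto simp: plus_minus_def) (metis add.inverse_inverse imageI)

lemma E_subset: "s \<in> E \<Longrightarrow> s \<in> \<Lambda>"
  by (auto simp: plus_minus_def)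

lemma deg_pos: "0 < deg"
  using finite_E E_nonempty by (simp add: card_gt_0_iff)

lemma face_len_pos: "s \<in> \<Lambda> \<Longrightarrow> 0 < face_len s"
  using step_of_dart(2) by fastforce

lemma rot_in: "rot j \<in> \<Lambda>"
proof (induction j rule: less_induct)
  case (less j)
  show ?case
  proof (cases "j < 2 * deg")
    case True
    then show ?thesis using rot_bij by (auto simp: bij_betw_def)
  next
    case False
    then show ?thesis using less[of "j - 2 * deg"] rot_periodic[of "j - 2 * deg"] deg_pos by simp
  qed
qed

lemma rot_ex:
  assumes "s \<in> \<Lambda>"
  obtains j where "rot j = s" "j < 2 * deg"
proof -
  have "s \<in> rot ` {..<2 * deg}" using assms rot_bij by (simp add: bij_betw_def)
  then show thesis using that by blast
qed

lemma rot_mult: "rot (j + 2 * deg * n) = rot j"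
proof (induction n)
  case (Suc n)
  then show ?case using rot_periodic[of "j + 2 * deg * n"] by (simp add: algebra_simps)
qed simp

lemma next_step_minus_rot: "next_step (- rot (Suc j)) = rot j"
  using rot_step[of "face_idx (- rot (Suc j))" "step_pos (- rot (Suc j))" j]
    step_of_dart[OF minus_in[OF rot_in]]
  by (simp add: next_step_def face_len_def)

lemma next_step_in: "s \<in> \<Lambda> \<Longrightarrow> next_step s \<in> \<Lambda>"
  unfolding next_step_def using step_in step_of_dart[of s] face_len_pos[of s] by (simp add: face_len_def)

lemma face_idx_next_step: "s \<in> \<Lambda> \<Longrightarrow> face_idx (next_step s) = face_idx s"
  and step_pos_next_step: "s \<in> \<Lambda> \<Longrightarrow> step_pos (next_step s) = Suc (step_pos s) mod face_len s"
  unfolding next_step_def using face_idx_step_pos[of "face_idx s" "Suc (step_pos s) mod face_len s"] step_of_dart[of s] face_len_pos[of s]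
  by (simp_all add: face_len_def)

text \<open>The dart after \<open>(x, s)\<close> starts at \<open>x + s\<close> and has the same
  disc on its left. At the last step the offset returns to 0, which is consistent because the steps
  of a face sum to 0.\<close>

lemma offset_next_step:
  assumes s: "s \<in> \<Lambda>"
  shows "offset (next_step s) = offset s + s"
proof -
  note st = step_of_dart[OF s]
  have take: "sum_list (take (Suc (step_pos s)) (L (face_idx s))) = offset s + s"
    using st by (simp add: offset_def take_Suc_conv_app_nth face_len_def)
  show ?thesis
  proof (cases "Suc (step_pos s) = face_len s")
    case True
    then have "offset s + s = 0"
      using take sum_steps[OF st(1)] by (simp add: face_len_def)
    then show ?thesis
      using True s by (simp add: offset_def step_pos_next_step face_idx_next_step)
  next
    case False
    then have "Suc (step_pos s) < face_len s" using st(2) by simp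
    then show ?thesis
      using take s unfolding offset_def step_pos_next_step[OF s] face_idx_next_step[OF s] by simp
  qed
qed

text \<open>
  The logarithmic coordinate \<open>\<xi>\<close> of the face left of the dart \<open>(x, s)\<close>: the face is \<open>Re \<xi> < 0\<close>, the dart
  is the segment from \<open>0\<close> to \<open>2 \<pi> \<i>\<close>.
\<close>

definition face_pt :: "'g \<Rightarrow> 'g \<Rightarrow> complex \<Rightarrow> nat \<times> 'g \<times> complex" where
  "face_pt x s \<xi> = (face_idx s, x - offset s, exp ((\<xi> + 2 * pi * \<i> * step_pos s) / face_len s))"

text \<open>One arc further on the same disc. After the last arc the exponent has grown by a full
  period of \<open>exp\<close>. This describes a corner from both of its sides.\<close>

lemma face_pt_shift:
  assumes s: "s \<in> \<Lambda>"
  shows "face_pt x s (\<xi> + 2 * pi * \<i>) = face_pt (x + s) (next_step s) \<xi>"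
proof -
  note st = step_of_dart[OF s]
  have len: "face_len (next_step s) = face_len s" using s by (simp add: face_len_def face_idx_next_step)
  have "exp ((\<xi> + 2 * pi * \<i> + 2 * pi * \<i> * step_pos s) / face_len s) =
        exp ((\<xi> + 2 * pi * \<i> * (Suc (step_pos s) mod face_len s)) / face_len s)"
  proof (cases "Suc (step_pos s) = face_len s")
    case True
    have "(\<xi> + 2 * pi * \<i> + 2 * pi * \<i> * step_pos s) / face_len s = (\<xi> + 2 * pi * \<i> * of_nat (Suc (step_pos s))) / face_len s"
      by (simp add: algebra_simps)
    also have "\<dots> = \<xi> / face_len s + 2 * pi * \<i>"
      unfolding True using face_len_pos[OF s] by (simp add: field_simps)
    finally show ?thesis using True by (simp add: exp_add)
  next
    case False
    then have "Suc (step_pos s) < face_len s" using st(2) by simp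
    then show ?thesis by (simp add: algebra_simps)
  qed
  then show ?thesis
    using s by (simp add: face_pt_def face_idx_next_step step_pos_next_step offset_next_step len algebra_simps)
qed

text \<open>In this window the exponents have imaginary part in \<open>[0, 2 * pi)\<close>, where
  \<open>exp\<close> is injective. Equal exponents with different positions would force the
  imaginary parts of \<open>\<xi>\<close> and \<open>\<eta>\<close> at least \<open>2 * pi\<close>
  apart.\<close>

lemma face_pt_unique_aux:
  assumes s: "s \<in> \<Lambda>" and t: "t \<in> \<Lambda>" and eq: "face_pt x s \<xi> = face_pt y t \<eta>"
    and Im: "0 \<le> Im \<xi>" "Im \<xi> < 2 * pi" "0 \<le> Im \<eta>" "Im \<eta> < 2 * pi"
  shows "x = y \<and> s = t \<and> \<xi> = \<eta>"
proof -
  note st = step_of_dart[OF s] step_of_dart[OF t]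
  have face_idx: "face_idx s = face_idx t" and b: "x - offset s = y - offset t" using eq by (auto simp: face_pt_def)
  then have len: "face_len s = face_len t" by (simp add: face_len_def)
  let ?a = "(\<xi> + 2 * pi * \<i> * step_pos s) / face_len s" and ?b = "(\<eta> + 2 * pi * \<i> * step_pos t) / face_len s"
  have e: "exp ?a = exp ?b" using eq len by (simp add: face_pt_def)
  have rng: "0 \<le> Im ((\<zeta> + 2 * pi * \<i> * real k) / face_len s) \<and> Im ((\<zeta> + 2 * pi * \<i> * real k) / face_len s) < 2 * pi"
    if "0 \<le> Im \<zeta>" "Im \<zeta> < 2 * pi" "k < face_len s" for \<zeta> k
  proof -
    have "Im \<zeta> + 2 * pi * real k < 2 * pi * (real k + 1)" using that by (simp add: algebra_simps)
    also have "\<dots> \<le> 2 * pi * face_len s" using that by simp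
    finally show ?thesis using that by (simp add: field_simps)
  qed
  have r1: "0 \<le> Im ?a" "Im ?a < 2 * pi" "0 \<le> Im ?b" "Im ?b < 2 * pi"
    using rng[OF Im(1,2)] rng[OF Im(3,4)] st len by (auto simp: of_real_of_nat_eq)
  have "?a = ?b"
  proof (rule complex_eqI)
    have "norm (exp ?a) = norm (exp ?b)" using e by simp
    then show "Re ?a = Re ?b" by (simp only: norm_exp_eq_Re exp_inj_iff)
    show "Im ?a = Im ?b"
      using Arg2pi_exp[OF r1(1,2)] Arg2pi_exp[OF r1(3,4)] e by metis
  qed
  then have eq2: "\<xi> + 2 * pi * \<i> * step_pos s = \<eta> + 2 * pi * \<i> * step_pos t"
    using face_len_pos[OF s] by (simp add: field_simps)
  then have "Im \<xi> - Im \<eta> = 2 * pi * (real (step_pos t) - real (step_pos s))"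
    by (auto simp: complex_eq_iff algebra_simps)
  moreover have "\<bar>Im \<xi> - Im \<eta>\<bar> < 2 * pi * 1" using Im by auto
  ultimately have "2 * pi * \<bar>real (step_pos t) - real (step_pos s)\<bar> < 2 * pi * 1"
    by (simp only: abs_mult) auto
  then have "\<bar>real (step_pos t) - real (step_pos s)\<bar> < 1"
    using mult_less_cancel_left_pos[of "2 * pi"] by simp
  then have "step_pos t = step_pos s" by linarith
  then have "s = t" using st face_idx by metis
  then show ?thesis using b eq2 by simp
qed

lemma next_step_inj: "s \<in> \<Lambda> \<Longrightarrow> t \<in> \<Lambda> \<Longrightarrow> next_step s = next_step t \<Longrightarrow> s = t"
proof -
  assume a: "s \<in> \<Lambda>" "t \<in> \<Lambda>" "next_step s = next_step t"
  \<comment> \<open>Both darts are placed so as to end at 0; \<open>face_pt_shift\<close> then turns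
    both sides into the same corner of the common next step.\<close>
  have "face_pt (0 - s) s (2 * pi * \<i>) = face_pt (0 - t) t (2 * pi * \<i>)"
    using face_pt_shift[OF a(1), of "0 - s" 0] face_pt_shift[OF a(2), of "0 - t" 0] a(3) by simp
  then have face_idx: "face_idx s = face_idx t" and "Suc (step_pos s) mod face_len s = Suc (step_pos t) mod face_len s"
    using a step_pos_next_step[OF a(1)] step_pos_next_step[OF a(2)] by (auto simp: face_pt_def face_len_def)
  moreover have "Suc (step_pos s) \<le> face_len s" "Suc (step_pos t) \<le> face_len s"
    using step_of_dart[OF a(1)] step_of_dart[OF a(2)] face_idx by (auto simp: face_len_def)
  ultimately have "step_pos s = step_pos t"
    by (metis Suc_inject le_neq_implies_less mod_less mod_self nat.simps(3))
  then show "s = t" using face_idx step_of_dart[OF a(1)] step_of_dart[OF a(2)] by metis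
qed

lemma next_step_surj: "s \<in> \<Lambda> \<Longrightarrow> \<exists>t\<in>\<Lambda>. next_step t = s"
proof -
  assume s: "s \<in> \<Lambda>"
  have "finite \<Lambda>" using finite_E by (simp add: plus_minus_def)
  moreover have "inj_on next_step \<Lambda>" using next_step_inj by (auto intro!: inj_onI)
  ultimately have "next_step ` \<Lambda> = \<Lambda>"
    using next_step_in by (intro endo_inj_surj) auto
  then show ?thesis using s by (metis imageE)
qed

text \<open>Around a corner the imaginary part takes both signs, so the window has to be movable.
  Points below the real axis are rewritten on the preceding dart, which brings them into the
  standard window.\<close>

lemma face_pt_unique:
  assumes s: "s \<in> \<Lambda>" and t: "t \<in> \<Lambda>" and eq: "face_pt x s \<xi> = face_pt y t \<eta>"
    and Im: "c \<le> Im \<xi>" "Im \<xi> < c + 2 * pi" "c \<le> Im \<eta>" "Im \<eta> < c + 2 * pi"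
    and c: "- 2 * pi \<le> c" "c \<le> 0"
  shows "x = y \<and> s = t \<and> \<xi> = \<eta>"
proof -
  define norm_form where "norm_form x s \<xi> x' s' \<xi>' \<longleftrightarrow> s' \<in> \<Lambda> \<and> face_pt x s \<xi> = face_pt x' s' \<xi>' \<and>
     0 \<le> Im \<xi>' \<and> Im \<xi>' < 2 * pi \<and>
     (if Im \<xi> \<ge> 0 then x' = x \<and> s' = s \<and> \<xi>' = \<xi> else s = next_step s' \<and> x = x' + s' \<and> \<xi>' = \<xi> + 2 * pi * \<i>)"
    for x s \<xi> x' s' \<xi>'
  have ex: "\<exists>x' s' \<xi>'. norm_form x s \<xi> x' s' \<xi>'"
    if in_\<Lambda>: "s \<in> \<Lambda>" "c \<le> Im \<xi>" "Im \<xi> < c + 2 * pi" for x s \<xi>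
  proof (cases "Im \<xi> \<ge> 0")
    case True
    then show ?thesis using that c unfolding norm_form_def by (intro exI[of _ x] exI[of _ s] exI[of _ \<xi>]) auto
  next
    case False
    obtain t where t: "t \<in> \<Lambda>" "next_step t = s" using next_step_surj[OF in_\<Lambda>(1)] by blast
    then have "face_pt (x - t) t (\<xi> + 2 * pi * \<i>) = face_pt x s \<xi>"
      using face_pt_shift[OF t(1), of "x - t" \<xi>] by simp
    then show ?thesis
      using False that t c unfolding norm_form_def
      by (intro exI[of _ "x - t"] exI[of _ t] exI[of _ "\<xi> + 2 * pi * \<i>"]) auto
  qed
  obtain x' s' \<xi>' where 1: "norm_form x s \<xi> x' s' \<xi>'" using ex[OF s Im(1,2)] by blast
  obtain y' t' \<eta>' where 2: "norm_form y t \<eta> y' t' \<eta>'" using ex[OF t Im(3,4)] by blast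
  have e: "x' = y' \<and> s' = t' \<and> \<xi>' = \<eta>'"
    using face_pt_unique_aux[of s' t' x' \<xi>' y' \<eta>'] 1 2 eq unfolding norm_form_def by argo
  \<comment> \<open>If just one of the two points had been shifted, their imaginary parts would
    differ by exactly \<open>2 * pi\<close>, more than the half-open window allows.\<close>
  have "Im \<xi> < 0 \<longleftrightarrow> Im \<eta> < 0"
  proof (rule ccontr)
    assume "\<not> (Im \<xi> < 0 \<longleftrightarrow> Im \<eta> < 0)"
    then have "\<bar>Im \<xi> - Im \<eta>\<bar> = 2 * pi"
      using e 1 2 by (auto simp: norm_form_def complex_eq_iff split: if_splits)
    then show False using Im by auto
  qed
  then show ?thesis using e 1 2 unfolding norm_form_def by (auto split: if_splits)
qed

text \<open>Converse reading of the logarithmic coordinate on a punctured disc. The value of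
  \<open>Re \<xi>\<close> measures the depth below the boundary, as the compactness proof
  requires.\<close>

lemma face_pt_surj:
  assumes f: "f < N" "L f \<noteq> []" and z: "z \<noteq> 0" "norm z < 1"
  obtains x s \<xi> where "s \<in> \<Lambda>" "(f, g, z) = face_pt x s \<xi>" "Re \<xi> < 0" "0 \<le> Im \<xi>" "Im \<xi> < 2 * pi"
    "Re \<xi> = length (L f) * ln (norm z)"
proof -
  define l where "l = length (L f)"
  have l: "0 < l" using f by (simp add: l_def)
  \<comment> \<open>The imaginary part of \<open>l\<close> times a logarithm of \<open>z\<close>;
    \<open>k\<close> is the number of complete arcs of length \<open>2 * pi\<close> below
    it.\<close>
  define \<phi> where "\<phi> = l * Arg2pi z"
  define k where "k = nat \<lfloor>\<phi> / (2 * pi)\<rfloor>"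
  have \<phi>: "0 \<le> \<phi>" "\<phi> < 2 * pi * l"
    using Arg2pi_ge_0[of z] Arg2pi_lt_2pi[of z] l by (auto simp: \<phi>_def)
  have k: "real k \<le> \<phi> / (2 * pi)" "\<phi> / (2 * pi) < real k + 1"
    using \<phi>(1) unfolding k_def by (auto simp: of_nat_nat)
  have "2 * pi * real k \<le> \<phi>" using k(1) by (simp add: field_simps)
  then have "2 * pi * real k < 2 * pi * real l" using \<phi>(2) by linarith
  then have "k < l" by simp
  then have kl: "k < length (L f)" by (simp add: l_def)
  define \<xi> where "\<xi> = Complex (l * ln (norm z)) (\<phi> - 2 * pi * k)"
  define s where "s = L f ! k"
  have s: "s \<in> \<Lambda>" "face_idx s = f" "step_pos s = k" "face_len s = l"
    using step_in face_idx_step_pos f(1) kl by (auto simp: s_def face_len_def l_def)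
  have "(\<xi> + 2 * pi * \<i> * k) / l = Complex (ln (norm z)) (Arg2pi z)"
    using l by (simp add: \<xi>_def complex_eq_iff \<phi>_def)
  then have "exp ((\<xi> + 2 * pi * \<i> * k) / l) = of_real (norm z) * cis (Arg2pi z)"
    using z(1) by (simp only: exp_eq_polar) simp
  also have "\<dots> = z" unfolding cis_conv_exp by (rule Arg2pi_eq[symmetric])
  finally have "exp ((\<xi> + 2 * pi * \<i> * k) / l) = z" .
  then have "(f, g, z) = face_pt (g + offset s) s \<xi>"
    using s by (simp add: face_pt_def of_real_of_nat_eq)
  moreover have "Re \<xi> < 0" using z l by (simp add: \<xi>_def mult_less_0_iff)
  moreover have "0 \<le> Im \<xi>" "Im \<xi> < 2 * pi"
    using k by (simp_all add: \<xi>_def field_simps)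
  moreover have "Re \<xi> = length (L f) * ln (norm z)" by (simp add: \<xi>_def l_def)
  ultimately show thesis using that s by blast
qed

end

abbreviation strip :: "complex set" where
  "strip \<equiv> {\<zeta>. 0 < Im \<zeta> \<and> Im \<zeta> < 2 * pi}"

section \<open>Coordinates at edges and vertices\<close>

datatype 'g cell = Face nat 'g | Edge 'g 'g | Vert 'g

lemma power_minus_one_cis: "cis (- (real j * pi)) = (- 1) ^ j"
proof -
  have "cis (- (real j * pi)) = cis (- pi) ^ j" by (simp only: Complex.DeMoivre mult_minus_right)
  then show ?thesis by (simp add: cis.ctr complex_eq_iff flip: one_complex.ctr)
qed

text \<open>Subtracting \<open>j * pi\<close> from the multiplied angle only multiplies by a sign.
  Hence the sectorwise polar formula of \<open>vert_param\<close> is the polynomial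
  \<open>corner j w\<close>, in particular holomorphic.\<close>

lemma rcis_power_shift:
  fixes \<alpha> :: real and d j :: nat
  shows "\<i> * rcis (r ^ d) (d * \<alpha> - j * pi) = \<i> * (- 1) ^ j * rcis r \<alpha> ^ d"
proof -
  have "rcis (r ^ d) (d * \<alpha> - j * pi) = rcis (r ^ d) (d * \<alpha>) * cis (- (real j * pi))"
    by (simp add: rcis_def cis_mult)
  also have "\<dots> = rcis r \<alpha> ^ d * cis (- (real j * pi))" by (simp only: DeMoivre2)
  finally show ?thesis unfolding power_minus_one_cis by (simp add: mult_ac)
qed

text \<open>The argument is continued from \<open>\<alpha>0\<close> by \<open>Ln (w / w0)\<close>,
  which is continuous near \<open>w0\<close> wherever \<open>w0\<close> lies relative to the branch
  cut of \<open>Arg2pi\<close>.\<close>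

lemma nearby_argument:
  assumes w0: "w0 \<noteq> 0" "w0 = rcis (norm w0) \<alpha>0" and \<delta>: "0 < \<delta>"
  obtains e where "0 < e" "\<And>w. w \<in> ball w0 e \<Longrightarrow> w \<noteq> 0 \<and> (\<exists>\<alpha>. w = rcis (norm w) \<alpha> \<and> \<bar>\<alpha> - \<alpha>0\<bar> < \<delta>)"
proof -
  have "isCont (\<lambda>w. Im (Ln (w / w0))) w0"
  proof (intro isCont_Im isCont_o2[of w0 "\<lambda>w. w / w0" Ln])
    show "isCont (\<lambda>w. w / w0) w0" using w0(1) by (intro continuous_intros)
    show "isCont Ln (w0 / w0)" using w0(1) by (intro continuous_at_Ln) simp
  qed
  then obtain e where e: "0 < e" "\<And>w. dist w w0 < e \<Longrightarrow> dist (Im (Ln (w / w0))) 0 < \<delta>"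
    using \<delta> w0(1) unfolding continuous_at_eps_delta by (metis Ln_1 divide_self zero_complex.sel(2))
  have "w \<noteq> 0 \<and> (\<exists>\<alpha>. w = rcis (norm w) \<alpha> \<and> \<bar>\<alpha> - \<alpha>0\<bar> < \<delta>)" if "w \<in> ball w0 (min e (norm w0))" for w
  proof -
    have "w \<noteq> 0" using that by (auto simp: dist_norm)
    moreover have "\<bar>Im (Ln (w / w0))\<bar> < \<delta>" using e(2)[of w] that by (auto simp: dist_commute)
    moreover have "w = rcis (norm w) (\<alpha>0 + Im (Ln (w / w0)))"
    proof -
      have "w / w0 = rcis (norm (w / w0)) (Im (Ln (w / w0)))"
        using calculation(1) w0(1) by (metis Arg_eq_Im_Ln divide_eq_0_iff rcis_cmod_Arg)
      then have "w = rcis (norm w0) \<alpha>0 * rcis (norm (w / w0)) (Im (Ln (w / w0)))"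
        using w0 by (metis nonzero_eq_divide_eq mult.commute)
      then show ?thesis using w0(1) by (simp add: rcis_mult norm_divide)
    qed
    ultimately show ?thesis by (intro conjI exI[of _ "\<alpha>0 + Im (Ln (w / w0))"]) auto
  qed
  then show thesis using that[of "min e (norm w0)"] e(1) w0(1) by simp
qed

lemma holo_germ_mono: "holo_germ S \<sigma> z S' \<tau> w \<Longrightarrow> S \<subseteq> R \<Longrightarrow> S' \<subseteq> R' \<Longrightarrow> holo_germ R \<sigma> z R' \<tau> w"
  unfolding holo_germ_def by (metis subset_trans)

context dart_system
begin

text \<open>
  Points of the surface are triples whose first component is the index \<open>f < N\<close> of a face, \<open>N\<close> for a
  vertex, and larger for a point of an edge. A point of an edge is represented on the dart whose step
  is in \<open>E\<close>; \<open>y\<close> ranges over the open interval from \<open>0\<close> to \<open>2 \<pi>\<close>.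
\<close>

definition edge_pt :: "'g \<Rightarrow> 'g \<Rightarrow> real \<Rightarrow> nat \<times> 'g \<times> complex" where
  "edge_pt x s y = (if s \<in> E then (N + 1 + to_nat_on E s, x, of_real y)
                    else (N + 1 + to_nat_on E (- s), x + s, of_real (2 * pi - y)))"

definition vert_pt :: "'g \<Rightarrow> nat \<times> 'g \<times> complex" where
  "vert_pt x = (N, x, 0)"

text \<open>To the right of the dart lies the disc to the left of the reverse dart. The coordinate
  there is \<open>2 * pi * \<i> - \<zeta>\<close>, a half turn about the middle of the edge, hence
  holomorphic.\<close>

definition edge_param :: "'g \<Rightarrow> 'g \<Rightarrow> complex \<Rightarrow> nat \<times> 'g \<times> complex" where
  "edge_param x s \<zeta> = (if Re \<zeta> < 0 then face_pt x s \<zeta>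
     else if 0 < Re \<zeta> then face_pt (x + s) (- s) (2 * pi * \<i> - \<zeta>) else edge_pt x s (Im \<zeta>))"

text \<open>
  The sector of the angles between \<open>j \<pi> / deg\<close> and \<open>(j + 1) \<pi> / deg\<close> of the disc around a vertex is mapped
  to the corner between the darts \<open>rot j\<close> and \<open>rot (Suc j)\<close>, its first side to the dart \<open>rot j\<close>.
\<close>

definition sector :: "complex \<Rightarrow> nat" where
  "sector w = nat \<lfloor>deg * Arg2pi w / pi\<rfloor>"

definition vert_param :: "'g \<Rightarrow> complex \<Rightarrow> nat \<times> 'g \<times> complex" where
  "vert_param x w = (if w = 0 then vert_pt x
     else edge_param x (rot (sector w)) (\<i> * rcis (norm w ^ deg) (deg * Arg2pi w - sector w * pi)))"

section \<open>Coincidences between edge coordinates\<close>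

lemma edge_pt_flip: "s \<in> \<Lambda> \<Longrightarrow> edge_pt (x + s) (- s) (2 * pi - y) = edge_pt x s y"
  using E_asym[of s] E_asym[of "- s"] by (auto simp: edge_pt_def dart_cases)

lemma edge_param_flip: "s \<in> \<Lambda> \<Longrightarrow> edge_param (x + s) (- s) (2 * pi * \<i> - \<zeta>) = edge_param x s \<zeta>"
  by (auto simp: edge_param_def edge_pt_flip)

lemma to_nat_on_E: "s \<in> E \<Longrightarrow> t \<in> E \<Longrightarrow> to_nat_on E s = to_nat_on E t \<longleftrightarrow> s = t"
  using finite_E by (simp add: countable_finite)

lemma edge_pt_unique:
  assumes "s \<in> \<Lambda>" "t \<in> \<Lambda>" "edge_pt x s y = edge_pt x' t y'"
  shows "(x = x' \<and> s = t \<and> y = y') \<or> (x' = x + s \<and> t = - s \<and> y' = 2 * pi - y)"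
proof -
  have "complex_of_real a = of_real b \<longleftrightarrow> a = b" for a b by simp
  then show ?thesis
    using assms to_nat_on_E unfolding edge_pt_def dart_cases
    by (auto split: if_splits simp del: of_real_diff)
qed

lemma fst_face_pt: "s \<in> \<Lambda> \<Longrightarrow> fst (face_pt x s \<xi>) < N"
  by (simp add: face_pt_def step_of_dart)

lemma fst_edge_pt: "fst (edge_pt x s y) > N"
  by (simp add: edge_pt_def)

lemma edge_param_eq_face_iff: "s \<in> \<Lambda> \<Longrightarrow> fst (edge_param x s \<zeta>) < N \<longleftrightarrow> Re \<zeta> \<noteq> 0"
  using fst_face_pt[of s] fst_face_pt[OF minus_in, of s] fst_edge_pt[of x s "Im \<zeta>"]
  by (auto simp: edge_param_def)

lemma fst_edge_param: "s \<in> \<Lambda> \<Longrightarrow> fst (edge_param x s \<zeta>) \<noteq> N"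
  using fst_face_pt[of s x \<zeta>] fst_face_pt[OF minus_in, of s "x + s"  "2 * pi * \<i> - \<zeta>"] fst_edge_pt[of x s "Im \<zeta>"]
  by (auto simp: edge_param_def)

lemma edge_param_unique:
  assumes s: "s \<in> \<Lambda>" and t: "t \<in> \<Lambda>" and eq: "edge_param x s \<zeta> = edge_param y t \<eta>"
    and Im: "0 < Im \<zeta>" "Im \<zeta> < 2 * pi" "0 < Im \<eta>" "Im \<eta> < 2 * pi"
  shows "(x = y \<and> s = t \<and> \<zeta> = \<eta>) \<or> (y = x + s \<and> t = - s \<and> \<eta> = 2 * pi * \<i> - \<zeta>)"
proof -
  have neg: "(x = y \<and> s = t \<and> \<zeta> = \<eta>) \<or> (y = x + s \<and> t = - s \<and> \<eta> = 2 * pi * \<i> - \<zeta>)"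
    if "Re \<zeta> < 0" "s \<in> \<Lambda>" "t \<in> \<Lambda>" "edge_param x s \<zeta> = edge_param y t \<eta>"
      "0 < Im \<zeta>" "Im \<zeta> < 2 * pi" "0 < Im \<eta>" "Im \<eta> < 2 * pi" for x s \<zeta> y t \<eta>
  proof -
    have "fst (edge_param x s \<zeta>) < N" using that(1) edge_param_eq_face_iff[OF that(2)] by auto
    then have "fst (edge_param y t \<eta>) < N" by (simp only: that(4))
    then have "Re \<eta> \<noteq> 0" using edge_param_eq_face_iff[OF that(3)] by blast
    then consider "Re \<eta> < 0" | "Re \<eta> > 0" by linarith
    then show ?thesis
    proof cases
      case 1
      then have "face_pt x s \<zeta> = face_pt y t \<eta>" using that(1,4) by (simp add: edge_param_def)
      then show ?thesis using face_pt_unique_aux[of s t x \<zeta> y \<eta>] that by simp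
    next
      case 2
      then have "face_pt x s \<zeta> = face_pt (y + t) (- t) (2 * pi * \<i> - \<eta>)"
        using that(1,4) by (simp add: edge_param_def)
      then have "x = y + t \<and> s = - t \<and> \<zeta> = 2 * pi * \<i> - \<eta>"
        using face_pt_unique_aux[of s "- t" x \<zeta> "y + t" "2 * pi * \<i> - \<eta>"] that minus_in[of t] by simp
      then show ?thesis by auto
    qed
  qed
  consider "Re \<zeta> < 0" | "Re \<zeta> > 0" | "Re \<zeta> = 0" by linarith
  then show ?thesis
  proof cases
    case 1
    then show ?thesis using neg[OF _ s t eq Im] by simp
  next
    case 2
    have "(x + s = y \<and> - s = t \<and> 2 * pi * \<i> - \<zeta> = \<eta>) \<or>
       (y = x + s + - s \<and> t = - (- s) \<and> \<eta> = 2 * pi * \<i> - (2 * pi * \<i> - \<zeta>))"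
      by (rule neg) (use 2 Im eq s t minus_in[OF s] edge_param_flip[OF s, of x \<zeta>] in auto)
    then show ?thesis by auto
  next
    case 3
    then have "\<not> fst (edge_param x s \<zeta>) < N" using s edge_param_eq_face_iff by blast
    then have "Re \<eta> = 0" using t eq edge_param_eq_face_iff by metis
    then show ?thesis
      using 3 edge_pt_unique[OF s t, of x "Im \<zeta>" y "Im \<eta>"] eq
      by (auto simp: edge_param_def complex_eq_iff)
  qed
qed

text \<open>The region is a corner together with its first side: of the imaginary axis only the
  positive part remains, so each dart belongs to one corner. The bound 1 keeps \<open>Im\<close>
  inside the window from -1 to \<open>2 * pi - 1\<close> and prevents confusion with the far end of
  the edge.\<close>

lemma corner_unique:
  assumes s: "s \<in> \<Lambda>" and t: "t \<in> \<Lambda>" and eq: "edge_param x s \<xi> = edge_param y t \<eta>"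
    and xi: "Re \<xi> \<le> 0" "\<bar>Im \<xi>\<bar> < 1" "Re \<xi> = 0 \<Longrightarrow> 0 < Im \<xi>"
    and eta: "Re \<eta> \<le> 0" "\<bar>Im \<eta>\<bar> < 1" "Re \<eta> = 0 \<Longrightarrow> 0 < Im \<eta>"
  shows "x = y \<and> s = t \<and> \<xi> = \<eta>"
proof (cases "Re \<xi> = 0")
  case True
  then have "Re \<eta> = 0" using s t eq edge_param_eq_face_iff by metis
  then have "edge_pt x s (Im \<xi>) = edge_pt y t (Im \<eta>)" using eq True by (simp add: edge_param_def)
  moreover have "Im \<eta> \<noteq> 2 * pi - Im \<xi>" using xi eta pi_gt3 by linarith
  ultimately show ?thesis
    using edge_pt_unique[OF s t] True \<open>Re \<eta> = 0\<close> by (auto simp: complex_eq_iff)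
next
  case False
  then have "Re \<eta> \<noteq> 0" using s t eq edge_param_eq_face_iff by metis
  then have "face_pt x s \<xi> = face_pt y t \<eta>" using eq False xi eta by (simp add: edge_param_def)
  then show ?thesis
    using face_pt_unique[OF s t, of x \<xi> y \<eta> "- 1"] xi eta pi_gt3 by (auto simp: abs_less_iff)
qed

text \<open>To the right of \<open>rot (Suc j)\<close> lies the disc of the reverse dart, near the
  end of that arc; the next arc is \<open>rot j\<close>, and shifting by
  \<open>2 * pi * \<i>\<close> leaves \<open>- \<xi>\<close>. Here the assumption on
  \<open>rot\<close> becomes the gluing of consecutive sectors.\<close>

lemma edge_param_rot:
  assumes "0 < Re \<xi>"
  shows "edge_param x (rot (Suc j)) \<xi> = edge_param x (rot j) (- \<xi>)"
  using face_pt_shift[OF minus_in[OF rot_in[of "Suc j"]], of "x + rot (Suc j)" "- \<xi>"] assms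
  by (simp add: edge_param_def next_step_minus_rot add.commute)

section \<open>Sectors and coordinates at a vertex\<close>

lemma sector_bounds: "0 \<le> deg * Arg2pi w - sector w * pi" "deg * Arg2pi w - sector w * pi < pi"
proof -
  have "0 \<le> deg * Arg2pi w / pi" using Arg2pi_ge_0[of w] by simp
  then have "real (sector w) \<le> deg * Arg2pi w / pi" "deg * Arg2pi w / pi < real (sector w) + 1"
    unfolding sector_def by (auto simp: of_nat_nat)
  then show "0 \<le> deg * Arg2pi w - sector w * pi" "deg * Arg2pi w - sector w * pi < pi"
    by (auto simp: field_simps)
qed

lemma sector_less: "sector w < 2 * deg"
proof -
  have "real (sector w) * pi \<le> deg * Arg2pi w" using sector_bounds(1)[of w] by simp
  also have "\<dots> < deg * (2 * pi)" using Arg2pi_lt_2pi[of w] deg_pos by simp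
  finally have "real (sector w) * pi < real (2 * deg) * pi" by (simp add: mult_ac)
  then show ?thesis by (simp only: mult_less_cancel_right_pos[OF pi_gt_zero] of_nat_less_iff)
qed

text \<open>One index \<open>j\<close> covers the two sectors on both sides of the ray at angle
  \<open>j * pi / deg\<close>, so the formula holds in a neighbourhood of that ray. Angles beyond
  the ray use the sector formula directly, angles before it use the preceding index and
  \<open>edge_param_rot\<close>.\<close>

lemma vert_param_rcis:
  fixes \<alpha> :: real
  assumes r: "0 < r" and bd: "\<bar>deg * \<alpha> - j * pi\<bar> < pi"
  shows "vert_param x (rcis r \<alpha>) = edge_param x (rot j) (\<i> * rcis (r ^ deg) (deg * \<alpha> - j * pi))"
proof -
  have nonneg: "vert_param x (rcis r \<alpha>) = edge_param x (rot j) (\<i> * rcis (r ^ deg) (deg * \<alpha> - j * pi))"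
    if bd: "0 \<le> deg * \<alpha> - j * pi" "deg * \<alpha> - j * pi < pi" for \<alpha> :: real and j :: nat
  proof -
    define w where "w = rcis r \<alpha>"
    have w0: "w \<noteq> 0" using r by (simp add: w_def)
    have nw: "norm w = r" using r by (simp add: w_def)
    have "w = rcis r (Arg2pi w)"
      using Arg2pi_eq[of w] nw by (simp add: rcis_def cis_conv_exp)
    then have "cis \<alpha> = cis (Arg2pi w)" using r unfolding w_def by (simp add: rcis_def)
    then have "sin \<alpha> = sin (Arg2pi w) \<and> cos \<alpha> = cos (Arg2pi w)" by (metis cis.sel)
    then obtain n :: int where n: "\<alpha> = Arg2pi w + 2 * pi * n"
      unfolding sin_cos_eq_iff by blast
    have "0 \<le> j * pi" by simp
    then have "0 \<le> deg * \<alpha>" using bd(1) by linarith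
    then have "0 \<le> \<alpha>" using deg_pos by (simp add: zero_le_mult_iff)
    then have "0 < 2 * pi * (real_of_int n + 1)"
      using n Arg2pi_lt_2pi[of w] by (simp add: algebra_simps)
    then have "0 < real_of_int n + 1" by (simp add: zero_less_mult_iff)
    then have "0 \<le> n" by linarith
    then obtain k :: nat where k: "n = int k" using nonneg_int_cases by blast
    have \<alpha>: "deg * \<alpha> = deg * Arg2pi w + 2 * deg * k * pi" unfolding n k by (simp add: algebra_simps)
    \<comment> \<open>Both reduced angles lie in \<open>[0, pi)\<close>; their difference is an
      integral multiple of \<open>pi\<close> and so vanishes.\<close>
    have "(real j - real (sector w + 2 * deg * k)) * pi =
        (deg * Arg2pi w - sector w * pi) - (deg * \<alpha> - j * pi)"
      unfolding \<alpha> by (simp add: algebra_simps)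
    also have "\<bar>\<dots>\<bar> < pi" using bd sector_bounds[of w] by linarith
    finally have "\<bar>real j - real (sector w + 2 * deg * k)\<bar> * pi < 1 * pi"
      by (simp only: abs_mult abs_of_pos[OF pi_gt_zero] mult_1)
    then have "\<bar>real j - real (sector w + 2 * deg * k)\<bar> < 1"
      by (simp only: mult_less_cancel_right_pos[OF pi_gt_zero])
    then have j: "j = sector w + 2 * deg * k" by linarith
    have "deg * \<alpha> - j * pi = deg * Arg2pi w - sector w * pi"
      unfolding \<alpha> j by (simp add: algebra_simps)
    then have "vert_param x w = edge_param x (rot j) (\<i> * rcis (r ^ deg) (deg * \<alpha> - j * pi))"
      using w0 nw rot_mult[of "sector w" k] unfolding vert_param_def j by simp
    then show ?thesis by (simp add: w_def)
  qed
  have pos: "vert_param x (rcis r \<alpha>) = edge_param x (rot j) (\<i> * rcis (r ^ deg) (deg * \<alpha> - j * pi))"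
    if bd: "\<bar>deg * \<alpha> - j * pi\<bar> < pi" and j: "0 < j" for \<alpha> :: real and j :: nat
  proof (cases "0 \<le> deg * \<alpha> - j * pi")
    case True
    then show ?thesis using nonneg bd by simp
  next
    case False
    define i where "i = j - 1"
    have ji: "j = Suc i" using j by (simp add: i_def)
    let ?\<theta> = "deg * \<alpha> - j * pi"
    have i: "deg * \<alpha> - i * pi = ?\<theta> + pi" by (simp add: ji algebra_simps)
    have "vert_param x (rcis r \<alpha>) = edge_param x (rot i) (\<i> * rcis (r ^ deg) (?\<theta> + pi))"
      using nonneg[where j = i and \<alpha> = \<alpha>] False bd unfolding i by simp
    also have "\<i> * rcis (r ^ deg) (?\<theta> + pi) = - (\<i> * rcis (r ^ deg) ?\<theta>)"
      by (simp add: rcis_def complex_eq_iff)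
    also have "edge_param x (rot i) \<dots> = edge_param x (rot (Suc i)) (\<i> * rcis (r ^ deg) ?\<theta>)"
    proof (rule edge_param_rot[symmetric])
      have "0 < sin (- ?\<theta>)" by (rule sin_gt_zero) (use False bd in auto)
      then have "sin ?\<theta> < 0" by (simp only: sin_minus)
      then show "0 < Re (\<i> * rcis (r ^ deg) ?\<theta>)"
        using r by (simp add: mult_pos_neg)
    qed
    finally show ?thesis by (simp add: ji)
  qed
  show ?thesis
  proof (cases "j = 0")
    case False
    then show ?thesis using pos[OF bd] by simp
  next
    case True
    \<comment> \<open>Index 0 has no predecessor. A full turn of the angle together with
      \<open>2 * deg\<close> more sectors leaves the point, the reduced angle and the dart
      unchanged.\<close>
    have shift: "deg * (\<alpha> + 2 * pi) - real (j + 2 * deg) * pi = deg * \<alpha> - j * pi"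
      by (simp add: algebra_simps)
    have "rcis r (\<alpha> + 2 * pi) = rcis r \<alpha>" by (simp add: rcis_def complex_eq_iff)
    then show ?thesis
      using pos[where \<alpha> = "\<alpha> + 2 * pi" and j = "j + 2 * deg"] bd deg_pos unfolding shift by (simp add: rot_periodic)
  qed
qed

text \<open>Away from the centre a vertex chart is locally an edge parametrization after the
  holomorphic map \<open>corner j\<close>. The last two conclusions record that \<open>w0\<close>
  lies in the sector or on its first side.\<close>

lemma vert_param_local:
  assumes w0: "w0 \<noteq> 0"
  obtains j e where "0 < e"
    "\<And>x w. w \<in> ball w0 e \<Longrightarrow> w \<noteq> 0 \<and> vert_param x w = edge_param x (rot j) (corner j w)"
    "Re (corner j w0) \<le> 0"
    "Re (corner j w0) = 0 \<Longrightarrow> 0 < Im (corner j w0)"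
proof -
  define j where "j = sector w0"
  define \<theta> where "\<theta> = deg * Arg2pi w0 - j * pi"
  have \<theta>: "0 \<le> \<theta>" "\<theta> < pi" using sector_bounds[of w0] by (auto simp: \<theta>_def j_def)
  have w0_eq: "w0 = rcis (norm w0) (Arg2pi w0)"
    using Arg2pi_eq[of w0] by (simp add: rcis_def cis_conv_exp)
  \<comment> \<open>The angle from \<open>w0\<close> to the far side of its sector; a change of
    argument below it keeps the reduced angle strictly between \<open>- pi\<close> and
    \<open>pi\<close>.\<close>
  define \<delta> where "\<delta> = (pi - \<theta>) / deg"
  have \<delta>: "0 < \<delta>" using \<theta> deg_pos by (simp add: \<delta>_def)
  obtain e where e: "0 < e"
      "\<And>w. w \<in> ball w0 e \<Longrightarrow> w \<noteq> 0 \<and> (\<exists>\<alpha>. w = rcis (norm w) \<alpha> \<and> \<bar>\<alpha> - Arg2pi w0\<bar> < \<delta>)"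
    using nearby_argument[OF w0 w0_eq \<delta>] by blast
  have "w \<noteq> 0 \<and> vert_param x w = edge_param x (rot j) (corner j w)"
    if w: "w \<in> ball w0 e" for x w
  proof -
    obtain \<alpha> where a: "w \<noteq> 0" "w = rcis (norm w) \<alpha>" "\<bar>\<alpha> - Arg2pi w0\<bar> < \<delta>"
      using e(2)[OF w] by blast
    have "\<bar>deg * (\<alpha> - Arg2pi w0)\<bar> < pi - \<theta>"
      using a(3) deg_pos unfolding abs_mult \<delta>_def by (simp add: pos_less_divide_eq mult.commute)
    moreover have "deg * \<alpha> - j * pi = \<theta> + deg * (\<alpha> - Arg2pi w0)" by (simp add: \<theta>_def algebra_simps)
    ultimately have "\<bar>deg * \<alpha> - j * pi\<bar> < pi" using \<theta> by linarith
    then have "vert_param x (rcis (norm w) \<alpha>) =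
        edge_param x (rot j) (\<i> * rcis (norm w ^ deg) (deg * \<alpha> - j * pi))"
      using a(1) by (intro vert_param_rcis) auto
    then show ?thesis using a(1) unfolding rcis_power_shift a(2)[symmetric] by simp
  qed
  moreover have ex: "corner j w0 = \<i> * rcis (norm w0 ^ deg) \<theta>"
    unfolding \<theta>_def rcis_power_shift w0_eq[symmetric] ..
  have "Re (corner j w0) \<le> 0"
    unfolding ex using sin_ge_zero[of \<theta>] \<theta> by simp
  moreover have "0 < Im (corner j w0)" if "Re (corner j w0) = 0"
  proof -
    have "sin \<theta> = 0" using that w0 unfolding ex by simp
    then have "\<theta> = 0" using \<theta> sin_gt_zero[of \<theta>] by fastforce
    then show ?thesis using w0 unfolding ex by simp
  qed
  ultimately show thesis using that[of e j] e(1) by blast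
qed

text \<open>The corner coordinates agree by \<open>corner_unique\<close>, available since the radius
  is below 1. The dart determines the sector because \<open>rot\<close> is injective on one period;
  modulus and reduced angle then determine \<open>w\<close>, as \<open>cos\<close> is injective on
  \<open>[0, pi]\<close>.\<close>

lemma vert_param_unique:
  assumes eq: "vert_param x w = vert_param y v" and w: "norm w < 1" and v: "norm v < 1"
  shows "x = y \<and> w = v"
proof -
  have nv: "fst (vert_param x w) = N \<longleftrightarrow> w = 0" for x w
    using fst_edge_param[OF rot_in] by (auto simp: vert_param_def vert_pt_def)
  show ?thesis
  proof (cases "w = 0")
    case True
    then have "v = 0" using nv eq by metis
    then show ?thesis using eq True by (simp add: vert_param_def vert_pt_def)
  next
    case False
    then have v0: "v \<noteq> 0" using nv eq by metis
    define a where "a u = deg * Arg2pi u - sector u * pi" for u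
    define \<xi> where "\<xi> u = \<i> * rcis (norm u ^ deg) (a u)" for u
    have \<xi>: "Re (\<xi> u) \<le> 0 \<and> \<bar>Im (\<xi> u)\<bar> < 1 \<and> (Re (\<xi> u) = 0 \<longrightarrow> 0 < Im (\<xi> u))" if "u \<noteq> 0" "norm u < 1" for u
    proof (intro conjI impI)
      have au: "0 \<le> a u" "a u < pi" using sector_bounds[of u] by (auto simp: a_def)
      then show "Re (\<xi> u) \<le> 0" using sin_ge_zero[of "a u"] by (simp add: \<xi>_def)
      have "\<bar>Im (\<xi> u)\<bar> \<le> norm (\<xi> u)" by (rule abs_Im_le_cmod)
      also have "\<dots> = norm u ^ deg" by (simp add: \<xi>_def norm_mult)
      also have "\<dots> < 1" using that deg_pos by (simp add: power_less_one_iff)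
      finally show "\<bar>Im (\<xi> u)\<bar> < 1" .
      assume "Re (\<xi> u) = 0"
      then have "sin (a u) = 0" using that by (simp add: \<xi>_def)
      then have "a u = 0" using au sin_gt_zero[of "a u"] by fastforce
      then show "0 < Im (\<xi> u)" using that by (simp add: \<xi>_def)
    qed
    have "edge_param x (rot (sector w)) (\<xi> w) = edge_param y (rot (sector v)) (\<xi> v)"
      using eq False v0 by (simp add: vert_param_def \<xi>_def a_def)
    then have *: "x = y" "rot (sector w) = rot (sector v)" "\<xi> w = \<xi> v"
      using corner_unique[OF rot_in rot_in] \<xi>[OF False w] \<xi>[OF v0 v] by blast+
    have sec: "sector w = sector v"
      using *(2) rot_bij sector_less unfolding bij_betw_def by (meson inj_onD lessThan_iff)
    have nn: "norm w ^ deg = norm v ^ deg"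
      using arg_cong[OF *(3), of norm] by (simp add: \<xi>_def norm_mult)
    then have n: "norm w = norm v" using deg_pos by (simp add: power_eq_iff_eq_base)
    have "cis (a w) = cis (a v)" using *(3) nn False v0 by (simp add: \<xi>_def rcis_def)
    then have "cos (a w) = cos (a v)" by (metis cis.sel(1))
    then have "a w = a v"
      using sector_bounds[of w] sector_bounds[of v] cos_inj_pi[of "a w" "a v"] by (simp add: a_def)
    then have "Arg2pi w = Arg2pi v" using sec deg_pos by (simp add: a_def)
    then have "w = v" using n Arg2pi_eq[of w] Arg2pi_eq[of v] by metis
    then show ?thesis using *(1) by simp
  qed
qed

section \<open>The surface of a system of darts\<close>

text \<open>Edge charts use steps in \<open>E\<close> only, so every undirected edge has exactly one
  chart.\<close>

definition cells :: "'g cell set" where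
  "cells = {Face f g | f g. f < N \<and> L f \<noteq> []} \<union> {Edge x s | x s. s \<in> E} \<union> range Vert"

primrec cdom :: "'g cell \<Rightarrow> complex set" where
  "cdom (Face f g) = ball 0 1"
| "cdom (Edge x s) = strip"
| "cdom (Vert x) = ball 0 1"

primrec cparam :: "'g cell \<Rightarrow> complex \<Rightarrow> nat \<times> 'g \<times> complex" where
  "cparam (Face f g) = (\<lambda>z. (f, g, z))"
| "cparam (Edge x s) = edge_param x s"
| "cparam (Vert x) = vert_param x"

lemma cells_iff [simp]:
  "Face f g \<in> cells \<longleftrightarrow> f < N \<and> L f \<noteq> []" "Edge x s \<in> cells \<longleftrightarrow> s \<in> E" "Vert x \<in> cells"
  by (auto simp: cells_def)

lemma Face_of_dart: "s \<in> \<Lambda> \<Longrightarrow> Face (face_idx s) g \<in> cells"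
  using step_of_dart[of s] by (auto simp: face_len_def)

section \<open>Compatibility of face, edge and vertex charts\<close>

lemma open_cdom: "open (cdom a)"
  by (cases a) (auto intro!: open_Collect_conj open_Collect_less continuous_intros)

lemma face_pt_in_ball:
  assumes "s \<in> \<Lambda>" "Re \<xi> < 0"
  shows "snd (snd (face_pt x s \<xi>)) \<in> ball 0 1"
  using assms face_len_pos[of s] by (simp add: face_pt_def divide_neg_pos)

text \<open>Stated for an arbitrary logarithmic coordinate \<open>h\<close>, so as to serve both
  sides of an edge (the identity and \<open>2 * pi * \<i> - y\<close>) and the corners at a vertex
  (\<open>corner j\<close>).\<close>

lemma holo_germ_face:
  assumes S: "open S" "z \<in> S" and h: "h holomorphic_on S" and s: "s \<in> \<Lambda>" and neg: "Re (h z) < 0"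
    and eq: "\<And>y. y \<in> S \<Longrightarrow> Re (h y) < 0 \<Longrightarrow> \<sigma> y = face_pt x s (h y)"
  shows "holo_germ S \<sigma> z (ball 0 1) (cparam (Face (face_idx s) (x - offset s))) (snd (snd (face_pt x s (h z))))"
  unfolding holo_germ_def
proof (intro exI conjI ballI)
  let ?N = "{y \<in> S. Re (h y) < 0}" and ?T = "\<lambda>y. exp ((h y + 2 * pi * \<i> * step_pos s) / face_len s)"
  have "continuous_on S h" using h by (rule holomorphic_on_imp_continuous_on)
  then have "open (h -` {w. Re w < 0} \<inter> S)"
    using S(1) open_halfspace_Re_lt continuous_on_open_vimage by blast
  moreover have "h -` {w. Re w < 0} \<inter> S = ?N" by auto
  ultimately show "open ?N" by simp
  show "z \<in> ?N" "?N \<subseteq> S" using S neg by auto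
  have "h holomorphic_on ?N" by (rule holomorphic_on_subset[OF h]) auto
  then show "?T holomorphic_on ?N" using face_len_pos[OF s] by (intro holomorphic_intros) auto
  show "?T z = snd (snd (face_pt x s (h z)))" by (simp add: face_pt_def)
  show "?T ` ?N \<subseteq> ball 0 1" using face_pt_in_ball[OF s] by (auto simp: face_pt_def)
  fix y assume "y \<in> ?N"
  then show "\<sigma> y = cparam (Face (face_idx s) (x - offset s)) (?T y)"
    using eq[of y] by (simp add: face_pt_def)
qed

text \<open>At a point inside a face every chart is compared with the disc of that face. Any two
  charts meeting there are then compatible through the disc.\<close>

lemma holo_germ_to_face:
  assumes a: "a \<in> cells" and z: "z \<in> cdom a" and face: "fst (cparam a z) < N"
  shows "\<exists>f g v. Face f g \<in> cells \<and> v \<in> ball 0 1 \<and> cparam a z = (f, g, v) \<and>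
           holo_germ (cdom a) (cparam a) z (ball 0 1) (cparam (Face f g)) v"
proof -
  have *: ?thesis if "open S" "z \<in> S" "S \<subseteq> cdom a" "h holomorphic_on S" "s \<in> \<Lambda>" "Re (h z) < 0"
      "\<And>y. y \<in> S \<Longrightarrow> Re (h y) < 0 \<Longrightarrow> cparam a y = face_pt x s (h y)" for S h x s
  proof -
    have "holo_germ S (cparam a) z (ball 0 1) (cparam (Face (face_idx s) (x - offset s))) (snd (snd (face_pt x s (h z))))"
      by (rule holo_germ_face) (use that in auto)
    then have "holo_germ (cdom a) (cparam a) z (ball 0 1) (cparam (Face (face_idx s) (x - offset s))) (snd (snd (face_pt x s (h z))))"
      by (rule holo_germ_mono) (use that in auto)
    moreover have "cparam a z = (face_idx s, x - offset s, snd (snd (face_pt x s (h z))))"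
      using that by (simp add: face_pt_def)
    ultimately show ?thesis
      using Face_of_dart[of s "x - offset s"] face_pt_in_ball[of s "h z" x] that by blast
  qed
  show ?thesis
  proof (cases a)
    case (Face f g)
    then show ?thesis using a z holo_germ_refl[OF open_cdom, of z a "cparam a"] by auto
  next
    case (Edge x s)
    then have s: "s \<in> \<Lambda>" using a E_subset by simp
    have "Re z \<noteq> 0" using face edge_param_eq_face_iff[OF s] Edge by auto
    then consider "Re z < 0" | "Re z > 0" by linarith
    then show ?thesis
    proof cases
      case 1
      show ?thesis
        by (rule *[of "cdom a" "\<lambda>y. y" s x])
           (use 1 s z open_cdom[of a] Edge in \<open>auto simp: edge_param_def intro!: holomorphic_intros\<close>)
    next
      case 2
      show ?thesis
        by (rule *[of "cdom a" "\<lambda>y. 2 * pi * \<i> - y" "- s" "x + s"])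
           (use 2 minus_in[OF s] z open_cdom[of a] Edge in \<open>auto simp: edge_param_def intro!: holomorphic_intros\<close>)
    qed
  next
    case (Vert x)
    have "z \<noteq> 0" using face Vert by (auto simp: vert_param_def vert_pt_def)
    then obtain j e where e: "0 < e"
      "\<And>x w. w \<in> ball z e \<Longrightarrow> w \<noteq> 0 \<and> vert_param x w = edge_param x (rot j) (corner j w)"
      "Re (corner j z) \<le> 0"
      using vert_param_local[of z] by metis
    have "vert_param x z = edge_param x (rot j) (corner j z)" using e by simp
    then have "Re (corner j z) \<noteq> 0"
      using face edge_param_eq_face_iff[OF rot_in, of x j "corner j z"] Vert by simp
    then have neg: "Re (corner j z) < 0" using e(3) by linarith
    show ?thesis
    proof (rule *[of "ball z e \<inter> cdom a" "\<lambda>w. corner j w" "rot j" x])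
      show "(\<lambda>w. corner j w) holomorphic_on (ball z e \<inter> cdom a)"
        by (intro holomorphic_intros)
      show "cparam a y = face_pt x (rot j) (corner j y)"
        if "y \<in> ball z e \<inter> cdom a" "Re (corner j y) < 0" for y
        using e(2)[of y x] that unfolding Vert edge_param_def by simp
    qed (use e z neg rot_in open_cdom[of a] in auto)
  qed
qed

text \<open>On an edge no disc can mediate, so the two charts are compared directly: the corner
  coordinate is either the edge coordinate or its half turn, according to the direction of the
  dart.\<close>

lemma holo_germ_vert_edge:
  assumes w: "norm w < 1" and t: "t \<in> \<Lambda>" and \<zeta>: "Re \<zeta> = 0" "0 < Im \<zeta>" "Im \<zeta> < 2 * pi"
    and eq: "vert_param x w = edge_param y t \<zeta>"
  shows "holo_germ (ball 0 1) (vert_param x) w strip (edge_param y t) \<zeta>"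
proof -
  have "w \<noteq> 0" using arg_cong[OF eq, of fst] fst_edge_param[OF t, of y \<zeta>] by (auto simp: vert_param_def vert_pt_def)
  then obtain j e where e: "0 < e"
      "\<And>x v. v \<in> ball w e \<Longrightarrow> v \<noteq> 0 \<and> vert_param x v = edge_param x (rot j) (corner j v)"
      "Re (corner j w) \<le> 0"
      "Re (corner j w) = 0 \<Longrightarrow> 0 < Im (corner j w)"
    using vert_param_local[of w] by metis
  define h where "h v = corner j v" for v :: complex
  note e = e[folded h_def]
  have holh: "h holomorphic_on B" for B unfolding h_def by (intro holomorphic_intros)
  have eq': "edge_param x (rot j) (h w) = edge_param y t \<zeta>" using e eq by simp
  then have re: "Re (h w) = 0"
    using \<zeta>(1) edge_param_eq_face_iff[OF rot_in, of x j "h w"] edge_param_eq_face_iff[OF t, of y \<zeta>] by metis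
  \<comment> \<open>The radius bound of the vertex chart keeps the corner coordinate below height
    \<open>2 * pi\<close>, inside the strip.\<close>
  have "norm (h w) < 1" using w deg_pos by (simp add: h_def norm_mult norm_power power_less_one_iff)
  then have "Im (h w) < 1" using abs_Im_le_cmod[of "h w"] by linarith
  then have im: "0 < Im (h w)" "Im (h w) < 2 * pi" using e(4)[OF re] pi_gt3 by auto
  let ?N = "ball w e \<inter> ball 0 1 \<inter> h -` strip"
  have "open ?N"
    using holomorphic_on_imp_continuous_on[OF holh[of UNIV]] open_cdom[of "Edge x t"]
    by (intro open_Int open_ball continuous_open_vimage) (auto simp: continuous_on_eq_continuous_at)
  have N: "w \<in> ?N" using e(1) w im by auto
  from edge_param_unique[OF rot_in t eq' im \<zeta>(2,3)]
  consider "x = y" "rot j = t" "h w = \<zeta>" | "y = x + rot j" "t = - rot j" "\<zeta> = 2 * pi * \<i> - h w" by blast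
  then show ?thesis
  proof cases
    case 1
    then show ?thesis
      unfolding holo_germ_def using \<open>open ?N\<close> N holh e(2)
      by (intro exI[of _ ?N] exI[of _ h]) auto
  next
    case 2
    have "vert_param x v = edge_param y t (2 * pi * \<i> - h v)" if "v \<in> ball w e" for v
      using e(2)[OF that, of x] edge_param_flip[OF rot_in, of x j "h v"] 2 by simp
    moreover have "(\<lambda>v. 2 * pi * \<i> - h v) holomorphic_on ?N" by (intro holomorphic_intros holh)
    ultimately show ?thesis
      unfolding holo_germ_def using \<open>open ?N\<close> N 2
      by (intro exI[of _ ?N] exI[of _ "\<lambda>v. 2 * pi * \<i> - h v"]) auto
  qed
qed

lemma edge_unique:
  assumes "s \<in> E" "t \<in> E" "edge_param x s \<zeta> = edge_param y t \<eta>"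
    "0 < Im \<zeta>" "Im \<zeta> < 2 * pi" "0 < Im \<eta>" "Im \<eta> < 2 * pi"
  shows "x = y \<and> s = t \<and> \<zeta> = \<eta>"
  using edge_param_unique[of s t x \<zeta> y \<eta>] assms E_subset E_asym[of s] by auto

lemma inj_cparam: "a \<in> cells \<Longrightarrow> inj_on (cparam a) (cdom a)"
  using edge_unique vert_param_unique by (cases a) (fastforce intro!: inj_onI)+

text \<open>Points in faces are handled through the disc. Outside the faces, two edge charts or two
  vertex charts with a common point coincide, parameters included, which leaves a vertex chart
  against an edge chart.\<close>

lemma cparam_compat:
  assumes a: "a \<in> cells" and b: "b \<in> cells" and z: "z \<in> cdom a" and w: "w \<in> cdom b"
    and eq: "cparam a z = cparam b w"
  shows "holo_germ (cdom a) (cparam a) z (cdom b) (cparam b) w"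
proof (cases "fst (cparam a z) < N")
  case True
  obtain f g v where 1: "cparam a z = (f, g, v)"
      "holo_germ (cdom a) (cparam a) z (ball 0 1) (cparam (Face f g)) v"
    using holo_germ_to_face[OF a z True] by blast
  obtain f' g' v' where 2: "cparam b w = (f', g', v')"
      "holo_germ (cdom b) (cparam b) w (ball 0 1) (cparam (Face f' g')) v'"
    using holo_germ_to_face[OF b w] True eq by auto
  have "(f', g', v') = (f, g, v)" using 1 2 eq by simp
  then have "holo_germ (ball 0 1) (cparam (Face f g)) v (cdom b) (cparam b) w"
    using holo_germ_sym[OF 2(2) inj_cparam[OF b]] by simp
  then show ?thesis using holo_germ_trans[OF 1(2)] by blast
next
  case False
  have self: ?thesis if "a = b" "z = w"
    using that holo_germ_refl[OF open_cdom z] by simp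
  have notface: "c \<noteq> Face f g" if "c \<in> cells" "\<not> fst (cparam c u) < N" for c u f g
    using that by auto
  have edge0: "Re \<zeta> = 0" if "s \<in> E" "\<not> fst (edge_param x s \<zeta>) < N" for x s \<zeta>
    using that edge_param_eq_face_iff E_subset by blast
  have nfa: "a \<noteq> Face f g" and nfb: "b \<noteq> Face f g" for f g
    using notface[OF a False] notface[OF b, of w] False eq by auto
  have VE: "holo_germ (ball 0 1) (vert_param x) u strip (edge_param y t) \<zeta>"
    if "norm u < 1" "t \<in> E" "0 < Im \<zeta>" "Im \<zeta> < 2 * pi" "vert_param x u = edge_param y t \<zeta>"
      "\<not> fst (edge_param y t \<zeta>) < N" for x u y t \<zeta>
    using holo_germ_vert_edge[OF that(1) E_subset edge0] that by blast
  show ?thesis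
  proof (cases a)
    case (Face f g)
    then show ?thesis using nfa by blast
  next
    case aE: (Edge x s)
    show ?thesis
    proof (cases b)
      case (Face f g)
      then show ?thesis using nfb by blast
    next
      case (Edge y t)
      then have "x = y \<and> s = t \<and> z = w" using edge_unique[of s t x z y w] aE a b z w eq by simp
      then show ?thesis using self aE Edge by simp
    next
      case (Vert y)
      have "holo_germ (cdom b) (cparam b) w (cdom a) (cparam a) z"
        using VE[of w s z y x] aE Vert a b z w eq False by simp
      then show ?thesis by (rule holo_germ_sym[OF _ inj_cparam[OF b]])
    qed
  next
    case aV: (Vert x)
    show ?thesis
    proof (cases b)
      case (Face f g)
      then show ?thesis using nfb by blast
    next
      case (Edge y t)
      then show ?thesis using VE[of z t w x y] aV a b z w eq False by simp
    next
      case (Vert y)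
      then have "x = y \<and> z = w" using vert_param_unique[of x z y w] aV a b z w eq by simp
      then show ?thesis using self aV Vert by simp
    qed
  qed
qed

sublocale glued_charts cells cdom cparam
  by unfold_locales (use open_cdom inj_cparam cparam_compat in auto)

text \<open>
  These two continuous functions separate the points in faces from the other points, and the vertices
  from the points of edges. In coordinates they are \<open>|exp \<xi>|\<close> and \<open>Re (exp \<xi>)\<close>, extended symmetrically.
\<close>

definition height :: "nat \<times> 'g \<times> complex \<Rightarrow> real" where
  "height p = (if fst p < N then norm (snd (snd p)) ^ length (L (fst p)) else 1)"

definition level :: "nat \<times> 'g \<times> complex \<Rightarrow> real" where
  "level p = (if fst p < N then Re (snd (snd p) ^ length (L (fst p))) else cos (Re (snd (snd p))))"

text \<open>The power cancels the division by the number of arcs, and the arc number disappears in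
  the period of \<open>exp\<close>. Hence \<open>height\<close> and \<open>level\<close> look the
  same from every arc.\<close>

lemma face_pt_power:
  assumes "s \<in> \<Lambda>"
  shows "snd (snd (face_pt x s \<xi>)) ^ length (L (fst (face_pt x s \<xi>))) = exp \<xi>"
proof -
  have "exp ((\<xi> + 2 * pi * \<i> * step_pos s) / face_len s) ^ face_len s = exp (\<xi> + 2 * pi * \<i> * step_pos s)"
    using face_len_pos[OF assms] by (simp flip: exp_of_nat_mult)
  also have "\<dots> = exp \<xi>"
    by (simp add: exp_add mult.commute[of _ "of_nat (step_pos s)"] exp_of_nat_mult)
  finally show ?thesis by (simp add: face_pt_def face_len_def)
qed

lemma height_face_pt: "s \<in> \<Lambda> \<Longrightarrow> height (face_pt x s \<xi>) = exp (Re \<xi>)"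
  using face_pt_power[of s x \<xi>] fst_face_pt[of s x \<xi>]
  by (simp add: height_def flip: norm_power)

lemma level_face_pt: "s \<in> \<Lambda> \<Longrightarrow> level (face_pt x s \<xi>) = exp (Re \<xi>) * cos (Im \<xi>)"
  using face_pt_power[of s x \<xi>] fst_face_pt[of s x \<xi>] by (simp add: level_def Re_exp)

lemma height_edge_param: "s \<in> \<Lambda> \<Longrightarrow> height (edge_param x s \<zeta>) = exp (- \<bar>Re \<zeta>\<bar>)"
  using fst_edge_pt[of x s "Im \<zeta>"] minus_in[of s]
  by (simp add: edge_param_def height_face_pt) (simp add: height_def)

lemma level_edge_param: "s \<in> \<Lambda> \<Longrightarrow> level (edge_param x s \<zeta>) = exp (- \<bar>Re \<zeta>\<bar>) * cos (Im \<zeta>)"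
  using minus_in[of s]
  by (auto simp: edge_param_def level_face_pt cos_diff) (auto simp: level_def edge_pt_def cos_diff)

text \<open>In the corner coordinate, real and imaginary parts are those of \<open>w ^ deg\<close>,
  exchanged and up to sign. The absolute value and the evenness of \<open>cos\<close> absorb the
  sign, so one formula serves all sectors and is continuous at the centre.\<close>

lemma vert_param_heights:
  "height (vert_param x w) = exp (- \<bar>Im (w ^ deg)\<bar>)"
  "level (vert_param x w) = exp (- \<bar>Im (w ^ deg)\<bar>) * cos (Re (w ^ deg))"
proof -
  have "height (vert_param x w) = exp (- \<bar>Im (w ^ deg)\<bar>) \<and>
        level (vert_param x w) = exp (- \<bar>Im (w ^ deg)\<bar>) * cos (Re (w ^ deg))"
  proof (cases "w = 0")
    case True
    then show ?thesis using deg_pos by (simp add: vert_param_def vert_pt_def height_def level_def zero_power)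
  next
    case False
    then obtain j e where "0 < e"
      "\<And>x v. v \<in> ball w e \<Longrightarrow> v \<noteq> 0 \<and> vert_param x v = edge_param x (rot j) (corner j v)"
      using vert_param_local[of w] by metis
    then have v: "vert_param x w = edge_param x (rot j) (corner j w)" by simp
    show ?thesis
      unfolding v height_edge_param[OF rot_in] level_edge_param[OF rot_in] by (cases "even j") auto
  qed
  then show "height (vert_param x w) = exp (- \<bar>Im (w ^ deg)\<bar>)"
    "level (vert_param x w) = exp (- \<bar>Im (w ^ deg)\<bar>) * cos (Re (w ^ deg))" by auto
qed

lemma continuous_height: "continuous_map surf euclidean height"
proof (rule continuous_map_from_space)
  fix a assume a: "a \<in> cells"
  show "continuous_on (cdom a) (\<lambda>z. height (cparam a z))"
    using a E_subset
    by (cases a) (auto simp: height_def[of "(_, _, _)"] height_edge_param vert_param_heights intro!: continuous_intros)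
qed

lemma continuous_level: "continuous_map surf euclidean level"
proof (rule continuous_map_from_space)
  fix a assume a: "a \<in> cells"
  show "continuous_on (cdom a) (\<lambda>z. level (cparam a z))"
    using a E_subset
    by (cases a) (auto simp: level_def[of "(_, _, _)"] level_edge_param vert_param_heights intro!: continuous_intros)
qed

lemma topspace_cases:
  assumes "p \<in> topspace surf"
  obtains (face) f g z where "Face f g \<in> cells" "norm z < 1" "p = (f, g, z)"
  | (edge) x s y where "s \<in> E" "0 < y" "y < 2 * pi" "p = edge_pt x s y"
  | (vert) x where "p = vert_pt x"
proof -
  obtain a z where a: "a \<in> cells" "z \<in> cdom a" "p = cparam a z"
    using assms by (auto simp: topspace_space)
  have edge_case: thesis
    if "s \<in> \<Lambda>" "0 < y" "y < 2 * pi" "p = edge_pt x s y" for x s y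
  proof (cases "s \<in> E")
    case True
    then show thesis using edge that by blast
  next
    case False
    then have "- s \<in> E" using that(1) dart_cases by blast
    then show thesis
      using edge[of "- s" "2 * pi - y" "x + s"] edge_pt_flip[OF that(1), of x y] that by simp
  qed
  show thesis
  proof (cases "fst p < N")
    case True
    then show thesis using holo_germ_to_face[OF a(1,2)] a(3) face by auto
  next
    case False
    show thesis
    proof (cases a)
      case (Face f g)
      then show thesis using a face[of f g z] by simp
    next
      case (Edge x s)
      then have "Re z = 0" using False a edge_param_eq_face_iff[of s x z] E_subset by auto
      then show thesis using edge[of s "Im z" x] a Edge by (simp add: edge_param_def)
    next
      case (Vert x)
      show thesis
      proof (cases "z = 0")
        case True
        then show thesis using vert a Vert by (simp add: vert_param_def)
      next
        case nz: False
        then obtain j e where e: "0 < e"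
          "\<And>x v. v \<in> ball z e \<Longrightarrow> v \<noteq> 0 \<and> vert_param x v = edge_param x (rot j) (corner j v)"
          "Re (corner j z) = 0 \<Longrightarrow> 0 < Im (corner j z)"
          using vert_param_local[of z] by metis
        define \<xi> where "\<xi> = corner j z"
        have p: "p = edge_param x (rot j) \<xi>" using e a Vert by (simp add: \<xi>_def)
        have re: "Re \<xi> = 0" using False p edge_param_eq_face_iff[OF rot_in] by metis
        have "norm \<xi> < 1"
          using a(2) Vert deg_pos by (simp add: \<xi>_def norm_mult norm_power power_less_one_iff)
        then have "0 < Im \<xi>" "Im \<xi> < 2 * pi"
          using e(3) re abs_Im_le_cmod[of \<xi>] pi_gt3 unfolding \<xi>_def by auto
        then show thesis using edge_case[OF rot_in, of "Im \<xi>" x j] p re by (simp add: edge_param_def)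
      qed
    qed
  qed
qed

lemma heights_of_points:
  "Face f g \<in> cells \<Longrightarrow> norm z < 1 \<Longrightarrow> height (f, g, z) < 1"
  "height (edge_pt x s y) = 1" "height (vert_pt x) = 1"
  "level (edge_pt x s y) = cos y" "level (vert_pt x) = 1"
  by (auto simp: height_def level_def edge_pt_def vert_pt_def cos_diff power_less_one_iff)

lemma cos_less_one: "0 < y \<Longrightarrow> y < 2 * pi \<Longrightarrow> cos y < (1::real)"
proof -
  assume y: "0 < y" "y < 2 * pi"
  have "cos y \<noteq> 1"
  proof
    assume "cos y = 1"
    then obtain n :: int where n: "y = 2 * pi * n" using cos_one_2pi_int[of y] by (auto simp: mult_ac)
    then have "0 < n" "n < 1" using y by (simp_all add: zero_less_mult_iff)
    then show False by simp
  qed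
  then show ?thesis using cos_le_one[of y] by linarith
qed

text \<open>Points of different kinds are separated by \<open>height\<close> or
  \<open>level\<close>; points of the same kind lie in a common chart or in two disjoint
  charts.\<close>

lemma Hausdorff_surf: "Hausdorff_space surf"
  unfolding Hausdorff_space_def
proof (intro allI impI, elim conjE)
  fix p q assume p: "p \<in> topspace surf" and q: "q \<in> topspace surf" and pq: "p \<noteq> q"
  let ?goal = "\<exists>U V. openin surf U \<and> openin surf V \<and> p \<in> U \<and> q \<in> V \<and> disjnt U V"
  have sep: ?goal if f: "continuous_map surf euclidean f" "f p \<noteq> f q" for f :: "_ \<Rightarrow> real"
  proof -
    obtain U V where UV: "open U" "open V" "f p \<in> U" "f q \<in> V" "U \<inter> V = {}"
      using f(2) hausdorff by metis
    have "openin surf {x \<in> topspace surf. f x \<in> U}" "openin surf {x \<in> topspace surf. f x \<in> V}"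
      using f(1) UV by (auto simp: continuous_map_def)
    then show ?thesis
      using UV p q
      by (intro exI[of _ "{x \<in> topspace surf. f x \<in> U}"] exI[of _ "{x \<in> topspace surf. f x \<in> V}"])
         (auto simp: disjnt_iff disjoint_iff)
  qed
  have same: ?goal if "a \<in> cells" "b \<in> cells" "z \<in> cdom a" "w \<in> cdom b" "p = cparam a z" "q = cparam b w"
      "a \<noteq> b \<Longrightarrow> cparam a ` cdom a \<inter> cparam b ` cdom b = {}" for a b z w
  proof (cases "a = b")
    case True
    then show ?thesis using separate_in_chart[of a z w] that pq by auto
  next
    case False
    then show ?thesis
      using that openin_chart_image[of a "cdom a"] openin_chart_image[of b "cdom b"] open_cdom
      by (intro exI[of _ "cparam a ` cdom a"] exI[of _ "cparam b ` cdom b"]) (auto simp: disjnt_def)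
  qed
  have height: ?goal if "height p \<noteq> height q" using sep[OF continuous_height that] .
  have level: ?goal if "level p \<noteq> level q" using sep[OF continuous_level that] .
  show ?goal
    using p
  proof (cases rule: topspace_cases)
    case p: (face f g z)
    show ?thesis
      using q
    proof (cases rule: topspace_cases)
      case (face f' g' z')
      show ?thesis
        by (rule same[of "Face f g" "Face f' g'" z z']) (use p face in auto)
    qed (use height p heights_of_points(1)[of f g z] heights_of_points(2-) in auto)
  next
    case p: (edge x s y)
    show ?thesis
      using q
    proof (cases rule: topspace_cases)
      case (face f' g' z')
      then show ?thesis using height p heights_of_points(1)[of f' g' z'] heights_of_points(2-) by auto
    next
      case q: (edge x' s' y')
      show ?thesis
      proof (rule same[of "Edge x s" "Edge x' s'" "\<i> * y" "\<i> * y'"])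
        assume ne: "Edge x s \<noteq> Edge x' s'"
        show "cparam (Edge x s) ` cdom (Edge x s) \<inter> cparam (Edge x' s') ` cdom (Edge x' s') = {}"
        proof (rule ccontr)
          assume "\<not> ?thesis"
          then obtain \<zeta> \<eta> where "\<zeta> \<in> cdom (Edge x s)" "\<eta> \<in> cdom (Edge x' s')"
              "edge_param x s \<zeta> = edge_param x' s' \<eta>" unfolding cparam.simps by blast
          then show False using edge_unique[of s s' x \<zeta> x' \<eta>] p q ne by simp
        qed
      qed (use p q in \<open>auto simp: edge_param_def\<close>)
    next
      case (vert x')
      then show ?thesis using level p heights_of_points cos_less_one[of y] by auto
    qed
  next
    case p: (vert x)
    show ?thesis
      using q
    proof (cases rule: topspace_cases)
      case (face f' g' z')
      then show ?thesis using height p heights_of_points(1)[of f' g' z'] heights_of_points(2-) by auto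
    next
      case (edge x' s' y')
      then show ?thesis using level p heights_of_points cos_less_one[of y'] by auto
    next
      case q: (vert x')
      show ?thesis
      proof (rule same[of "Vert x" "Vert x'" 0 0])
        assume ne: "Vert x \<noteq> Vert x'"
        show "cparam (Vert x) ` cdom (Vert x) \<inter> cparam (Vert x') ` cdom (Vert x') = {}"
        proof (rule ccontr)
          assume "\<not> ?thesis"
          then obtain w v where "w \<in> ball 0 1" "v \<in> ball 0 1" "vert_param x w = vert_param x' v"
            unfolding cparam.simps cdom.simps by blast
          then show False using vert_param_unique[of x w x' v] ne by simp
        qed
      qed (use p q in \<open>auto simp: vert_param_def\<close>)
    qed
  qed
qed

text \<open>
  Charts that meet have anchors in the same coset of this countable subgroup, so each component of the
  surface is covered by countably many charts.
\<close>

definition step_group :: "'g set" where "step_group = sum_list ` lists \<Lambda>"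

lemma step_group_sum_list: "set l \<subseteq> \<Lambda> \<Longrightarrow> sum_list l \<in> step_group"
  by (auto simp: step_group_def in_lists_conv_set)

lemma step_group_closed: "a \<in> step_group \<Longrightarrow> b \<in> step_group \<Longrightarrow> a + b \<in> step_group" "a \<in> step_group \<Longrightarrow> - a \<in> step_group"
proof -
  show "a + b \<in> step_group" if ab: "a \<in> step_group" "b \<in> step_group"
  proof -
    obtain l l' where "l \<in> lists \<Lambda>" "l' \<in> lists \<Lambda>" "a = sum_list l" "b = sum_list l'"
      using ab by (auto simp: step_group_def)
    then show ?thesis using step_group_sum_list[of "l @ l'"] by auto
  qed
  show "- a \<in> step_group" if "a \<in> step_group"
  proof -
    obtain l where "l \<in> lists \<Lambda>" "a = sum_list l" using \<open>a \<in> step_group\<close> by (auto simp: step_group_def)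
    moreover have "sum_list (map uminus l) = - sum_list l" for l :: "'g list" by (induction l) auto
    ultimately show ?thesis using step_group_sum_list[of "map uminus l"] minus_in by auto
  qed
qed

lemma step_group_diff: "a \<in> step_group \<Longrightarrow> b \<in> step_group \<Longrightarrow> a - b \<in> step_group"
  using step_group_closed(1)[of a "- b"] step_group_closed(2)[of b] by simp

lemma step_group_dart: "s \<in> \<Lambda> \<Longrightarrow> s \<in> step_group" and step_group_zero: "0 \<in> step_group"
  using step_group_sum_list[of "[s]"] step_group_sum_list[of "[]"] by auto

lemma step_group_offset: "s \<in> \<Lambda> \<Longrightarrow> offset s \<in> step_group"
  unfolding offset_def using step_in step_of_dart(1)[of s]
  by (intro step_group_sum_list) (auto simp: in_set_conv_nth)

primrec anchor :: "'g cell \<Rightarrow> 'g" where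
  "anchor (Face f g) = g" | "anchor (Edge x s) = x" | "anchor (Vert x) = x"

lemma edge_param_coset:
  assumes s: "s \<in> \<Lambda>" shows "fst (snd (edge_param x s \<zeta>)) - x \<in> step_group"
proof -
  have "x - offset s - x \<in> step_group" using step_group_closed(2)[OF step_group_offset[OF s]] by simp
  moreover have "x + s - offset (- s) - x \<in> step_group"
    using step_group_diff[OF step_group_dart[OF s] step_group_offset[OF minus_in[OF s]]] by (simp add: algebra_simps)
  ultimately show ?thesis
    using step_group_dart[OF s] step_group_zero by (auto simp: edge_param_def face_pt_def edge_pt_def)
qed

lemma cparam_coset:
  assumes "a \<in> cells" shows "fst (snd (cparam a z)) - anchor a \<in> step_group"
  using assms step_group_zero edge_param_coset E_subset edge_param_coset[OF rot_in]
  by (cases a) (auto simp: vert_param_def vert_pt_def)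

lemma countable_cluster:
  assumes a: "a \<in> cells"
  shows "\<exists>B\<subseteq>cells. countable B \<and> a \<in> B \<and>
      (\<forall>b\<in>B. \<forall>c\<in>cells - B. cparam b ` cdom b \<inter> cparam c ` cdom c = {})"
proof (intro exI conjI ballI)
  let ?B = "{b \<in> cells. anchor b - anchor a \<in> step_group}"
  let ?U = "\<Union>h\<in>step_group. (\<lambda>f. Face f (anchor a + h)) ` UNIV \<union> Edge (anchor a + h) ` E \<union> {Vert (anchor a + h)}"
  show "?B \<subseteq> cells" by blast
  show "a \<in> ?B" using a step_group_zero by simp
  have "countable step_group"
    unfolding step_group_def using finite_E by (intro countable_image countable_lists countable_finite) (simp add: plus_minus_def)
  then have "countable ?U"
    using finite_E by (intro countable_UN countable_Un countable_image countable_finite[of E]) auto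
  moreover have "?B \<subseteq> ?U"
  proof
    fix b assume b: "b \<in> ?B"
    have "anchor b = anchor a + (anchor b - anchor a)" by simp
    then show "b \<in> ?U"
      using b by (intro UN_I[of "anchor b - anchor a"]) (cases b; auto)+
  qed
  ultimately show "countable ?B"
    by (rule_tac countable_subset)
  fix b c assume b: "b \<in> ?B" and c: "c \<in> cells - ?B"
  show "cparam b ` cdom b \<inter> cparam c ` cdom c = {}"
  proof (rule ccontr)
    assume "\<not> ?thesis"
    then obtain z w where "cparam b z = cparam c w" by blast
    then have "fst (snd (cparam b z)) - anchor b \<in> step_group" "fst (snd (cparam b z)) - anchor c \<in> step_group"
      using b c cparam_coset[of b z] cparam_coset[of c w] by auto
    then have "(fst (snd (cparam b z)) - anchor c) - (fst (snd (cparam b z)) - anchor b) \<in> step_group"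
      using step_group_diff by blast
    then have "anchor b - anchor c \<in> step_group" by (simp add: algebra_simps)
    moreover have "anchor b - anchor a \<in> step_group" using b by simp
    ultimately have "(anchor b - anchor a) - (anchor b - anchor c) \<in> step_group" using step_group_diff by blast
    then show False using c by (simp add: algebra_simps)
  qed
qed

theorem surface_surf: "surface surf"
  unfolding surface_def
proof (intro conjI ballI)
  show "Hausdorff_space surf" by (rule Hausdorff_surf)
  show "\<exists>U \<phi>. x \<in> U \<and> surface_chart surf U \<phi>" if "x \<in> topspace surf" for x
    using that surface_chart_param by (auto simp: topspace_space)
  show "second_countable (subtopology surf C)" if "C \<in> connected_components_of surf" for C
    using countable_cluster that by (rule second_countable_component)
qed

text \<open>Inverts the corner coordinate by taking a root of order \<open>deg\<close>, and controls
  the radius. It shows how far vertex charts reach into discs and edges, as the compactness proof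
  requires.\<close>

lemma corner_in_vert:
  assumes s: "s \<in> \<Lambda>" and \<xi>: "Re \<xi> \<le> 0" "\<xi> \<noteq> 0" "Re \<xi> = 0 \<Longrightarrow> 0 < Im \<xi>"
  obtains w where "vert_param x w = edge_param x s \<xi>" "norm w = root deg (norm \<xi>)"
proof -
  obtain j where j: "rot j = s" using s rot_ex by blast
  \<comment> \<open>The angle within the sector. The excluded negative imaginary axis corresponds to
    \<theta> = \<open>pi\<close>, which is the first side of the next sector.\<close>
  define \<theta> where "\<theta> = Arg2pi (- \<i> * \<xi>)"
  have "0 \<le> \<theta>" by (simp add: \<theta>_def Arg2pi_ge_0)
  moreover have "\<theta> \<le> pi" using \<xi>(1) by (simp add: \<theta>_def Arg2pi_le_pi)
  moreover have "\<theta> \<noteq> pi" using \<xi>(3) by (auto simp: \<theta>_def Arg2pi_eq_pi complex_is_Real_iff)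
  ultimately have \<theta>: "\<bar>\<theta>\<bar> < pi" by simp
  have "- \<i> * \<xi> = rcis (norm \<xi>) \<theta>"
    using Arg2pi_eq[of "- \<i> * \<xi>"] by (simp add: \<theta>_def rcis_def cis_conv_exp norm_mult)
  then have "\<i> * (- \<i> * \<xi>) = \<i> * rcis (norm \<xi>) \<theta>" by (rule arg_cong)
  then have \<xi>_eq: "\<xi> = \<i> * rcis (norm \<xi>) \<theta>" by simp
  define \<alpha> where "\<alpha> = (\<theta> + j * pi) / deg"
  define r where "r = root deg (norm \<xi>)"
  have d\<alpha>: "deg * \<alpha> - j * pi = \<theta>" using deg_pos by (simp add: \<alpha>_def)
  have r: "0 < r" "r ^ deg = norm \<xi>" using deg_pos \<xi>(2) by (simp_all add: r_def)
  have "vert_param x (rcis r \<alpha>) = edge_param x (rot j) (\<i> * rcis (r ^ deg) (deg * \<alpha> - j * pi))"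
    using r(1) \<theta> by (intro vert_param_rcis) (simp_all only: d\<alpha>)
  also have "\<dots> = edge_param x s \<xi>" unfolding d\<alpha> r(2) j \<xi>_eq[symmetric] ..
  finally show thesis using that[of "rcis r \<alpha>"] r(1) by (simp add: r_def)
qed

text \<open>There are finitely many charts, and each is shrunk to a compact piece: depth at least
  1/2 in a disc, a rectangle of half-width 1/2 along an edge, and corner radius at most 3/4 at a
  vertex. They still cover, since a square of half-side 1/2 lies in the disc of radius 3/4.\<close>

lemma compact_surf:
  assumes fin: "finite (UNIV :: 'g set)"
  shows "compact_space surf"
proof -
  define \<rho> where "\<rho> = root deg (3 / 4)"
  have \<rho>: "\<rho> < 1" using deg_pos by (simp add: \<rho>_def)
  define R :: "complex set" where "R = cbox (Complex (- 1 / 2) (1 / 2)) (Complex (1 / 2) (2 * pi - 1 / 2))"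
  have R_iff: "\<zeta> \<in> R \<longleftrightarrow> \<bar>Re \<zeta>\<bar> \<le> 1 / 2 \<and> 1 / 2 \<le> Im \<zeta> \<and> Im \<zeta> \<le> 2 * pi - 1 / 2" for \<zeta>
    by (auto simp: R_def in_cbox_complex_iff abs_le_iff)
  define K where "K a = (case a of Face f g \<Rightarrow> cball 0 (exp (- 1 / 2 / length (L f)))
      | Edge x s \<Rightarrow> R | Vert x \<Rightarrow> cball 0 \<rho>)" for a :: "'g cell"
  have K: "compact (K a) \<and> K a \<subseteq> cdom a" if "a \<in> cells" for a
  proof (cases a)
    case (Face f g)
    then have "exp (- 1 / 2 / real (length (L f))) < 1" using that by simp
    then show ?thesis unfolding Face K_def by (auto simp del: exp_less_one_iff)
  qed (use that \<rho> pi_gt3 in \<open>auto simp: K_def R_def in_cbox_complex_iff\<close>)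
  have "finite cells"
  proof -
    have "cells \<subseteq> case_prod Face ` ({..<N} \<times> UNIV) \<union> case_prod Edge ` (UNIV \<times> E) \<union> range Vert"
      by (auto simp: cells_def)
    then show ?thesis using fin finite_E by (rule_tac finite_subset) auto
  qed
  then have "compactin surf (\<Union>a\<in>cells. cparam a ` K a)"
    using K by (intro compactin_Union) (auto intro: compactin_param_image)
  moreover have "topspace surf \<subseteq> (\<Union>a\<in>cells. cparam a ` K a)" (is "_ \<subseteq> ?M")
  proof
    have vert: "edge_param x s \<xi> \<in> ?M"
      if v: "s \<in> \<Lambda>" "Re \<xi> \<le> 0" "\<xi> \<noteq> 0" "Re \<xi> = 0 \<Longrightarrow> 0 < Im \<xi>" "norm \<xi> \<le> 3 / 4" for x s \<xi>
    proof -
      obtain w where w: "vert_param x w = edge_param x s \<xi>" "norm w = root deg (norm \<xi>)"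
        using corner_in_vert[of s \<xi> x] v by metis
      have "norm w \<le> \<rho>" using v(5) deg_pos unfolding w(2) \<rho>_def by simp
      then show ?thesis using w(1) by (intro UN_I[of "Vert x"]) (auto simp: K_def intro!: image_eqI[of _ _ w])
    qed
    have half: "norm \<xi> \<le> 3 / 4" if "\<bar>Re \<xi>\<bar> \<le> 1 / 2" "\<bar>Im \<xi>\<bar> \<le> 1 / 2" for \<xi> :: complex
    proof -
      have "(Re \<xi>)\<^sup>2 \<le> (1 / 2)\<^sup>2" "(Im \<xi>)\<^sup>2 \<le> (1 / 2)\<^sup>2"
        using that by (simp_all only: abs_le_square_iff[symmetric])
      then have "(norm \<xi>)\<^sup>2 \<le> (3 / 4)\<^sup>2" unfolding cmod_power2 by (simp add: power2_eq_square)
      then show ?thesis by (rule power2_le_imp_le) simp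
    qed
    have rect: "edge_param x s \<zeta> \<in> ?M" if "s \<in> \<Lambda>" "\<zeta> \<in> R" for x s \<zeta>
    proof (cases "s \<in> E")
      case True
      then show ?thesis using that by (intro UN_I[of "Edge x s"]) (auto simp: K_def)
    next
      case False
      then have "- s \<in> E" using that(1) dart_cases by blast
      moreover have "2 * pi * \<i> - \<zeta> \<in> R" using that(2) by (auto simp: R_iff)
      ultimately show ?thesis
        using edge_param_flip[OF that(1), of x \<zeta>]
        by (intro UN_I[of "Edge (x + s) (- s)"]) (auto simp: K_def intro!: image_eqI[of _ _ "2 * pi * \<i> - \<zeta>"])
    qed
    \<comment> \<open>The collar of depth 1/2 along a dart splits into the corner at its start, the
      rectangle, and the corner at its end.\<close>
    have near: "edge_param x s \<zeta> \<in> ?M"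
      if s: "s \<in> \<Lambda>" and \<zeta>: "- 1 / 2 < Re \<zeta>" "Re \<zeta> \<le> 0" "0 \<le> Im \<zeta>" "Im \<zeta> < 2 * pi" "Re \<zeta> = 0 \<Longrightarrow> 0 < Im \<zeta>" for x s \<zeta>
    proof -
      consider "Im \<zeta> < 1 / 2" | "\<zeta> \<in> R" | "2 * pi - 1 / 2 < Im \<zeta>" using \<zeta> by (auto simp: R_iff) linarith
      then show ?thesis
      proof cases
        case 1
        moreover have "\<zeta> \<noteq> 0" using \<zeta>(5) by auto
        ultimately show ?thesis using \<zeta> by (intro vert[OF s] half) auto
      next
        case 2
        then show ?thesis using rect s by blast
      next
        case 3
        have hf: "norm (\<zeta> - 2 * pi * \<i>) \<le> 3 / 4" using half[of "\<zeta> - 2 * pi * \<i>"] 3 \<zeta> by auto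
        \<comment> \<open>The vertex is now \<open>x + s\<close>. A point on the edge is reached
          along the reverse dart, a point inside the disc along the next dart of its
          boundary.\<close>
        show ?thesis
        proof (cases "Re \<zeta> = 0")
          case True
          have "edge_param (x + s) (- s) (2 * pi * \<i> - \<zeta>) \<in> ?M"
            using vert[OF minus_in[OF s], of "2 * pi * \<i> - \<zeta>" "x + s"] hf \<zeta> True
            by (auto simp: norm_minus_commute complex_eq_iff)
          then show ?thesis using edge_param_flip[OF s] by simp
        next
          case False
          have "edge_param (x + s) (next_step s) (\<zeta> - 2 * pi * \<i>) \<in> ?M"
            using vert[OF next_step_in[OF s], of "\<zeta> - 2 * pi * \<i>" "x + s"] hf \<zeta> False by (auto simp: complex_eq_iff)
          moreover have "edge_param (x + s) (next_step s) (\<zeta> - 2 * pi * \<i>) = edge_param x s \<zeta>"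
            using face_pt_shift[OF s, of x "\<zeta> - 2 * pi * \<i>"] \<zeta>(2) False by (simp add: edge_param_def)
          ultimately show ?thesis by simp
        qed
      qed
    qed
    fix p assume "p \<in> topspace surf"
    then show "p \<in> ?M"
    proof (cases rule: topspace_cases)
      case (face f g z)
      show ?thesis
      proof (cases "z \<in> K (Face f g)")
        case True
        then show ?thesis using face by (intro UN_I[of "Face f g"]) auto
      next
        case False
        then have nz: "exp (- 1 / 2 / length (L f)) < norm z" by (simp add: K_def)
        then have z0: "z \<noteq> 0" by (metis exp_gt_zero norm_zero order_less_asym)
        obtain x s \<xi> where \<xi>: "s \<in> \<Lambda>" "(f, g, z) = face_pt x s \<xi>" "Re \<xi> < 0" "0 \<le> Im \<xi>" "Im \<xi> < 2 * pi"
            "Re \<xi> = length (L f) * ln (norm z)"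
          using face_pt_surj[of f z g] face z0 by (metis cells_iff(1))
        have "exp (- 1 / 2 / length (L f)) < exp (ln (norm z))" using nz z0 by simp
        then have "- 1 / 2 / length (L f) < ln (norm z)" by (simp only: exp_less_cancel_iff)
        then have "- 1 / 2 < Re \<xi>" using face \<xi>(6) by (simp add: field_simps)
        then have "edge_param x s \<xi> \<in> ?M" by (intro near) (use \<xi>(1,3-5) in auto)
        then show ?thesis using \<xi>(2,3) face by (simp add: edge_param_def)
      qed
    next
      case (edge x s y)
      then show ?thesis using near[of s "\<i> * y" x] E_subset by (simp add: edge_param_def)
    next
      case (vert x)
      have "0 \<in> K (Vert x)" using deg_pos by (simp add: K_def \<rho>_def)
      then show ?thesis using vert by (intro UN_I[of "Vert x"]) (auto simp: vert_param_def intro!: image_eqI[of _ _ 0])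
    qed
  qed
  ultimately show ?thesis
    unfolding compact_space_def using compactin_subset_topspace by (metis subset_antisym)
qed

end

section \<open>The embedded graph and its faces\<close>

text \<open>The complement of a member is the union of the other members, so each member is clopen
  and contains every connected set meeting it.\<close>

lemma connected_components_of_open_partition:
  assumes conn: "\<And>F. F \<in> \<F> \<Longrightarrow> connectedin X F" and op: "\<And>F. F \<in> \<F> \<Longrightarrow> openin X F"
    and ne: "{} \<notin> \<F>" and disj: "pairwise disjnt \<F>" and cover: "\<Union>\<F> = topspace X"
  shows "connected_components_of X = \<F>"
proof -
  have comp: "connected_component_of_set X x = F" if F: "F \<in> \<F>" "x \<in> F" for x F
  proof (rule connected_component_of_unique[OF F(2) conn[OF F(1)]])
    fix C assume C: "x \<in> C \<and> connectedin X C"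
    have "topspace X - F = \<Union>(\<F> - {F})"
      using F(1) disj unfolding cover[symmetric] by (auto simp: pairwise_def disjnt_iff)
    moreover have "openin X (\<Union>(\<F> - {F}))" using op by (intro openin_Union) auto
    ultimately have "openin X (topspace X - F)" by simp
    then have "closedin X F" using op[OF F(1)] by (simp add: closedin_def openin_subset)
    moreover have "\<not> disjnt C F" using C F(2) by (auto simp: disjnt_iff)
    ultimately show "C \<subseteq> F" using connectedin_clopen_cases[of X C F] C op[OF F(1)] by blast
  qed
  show ?thesis
  proof (intro equalityI subsetI)
    fix C assume "C \<in> connected_components_of X"
    then obtain x where "x \<in> topspace X" "C = connected_component_of_set X x"
      unfolding connected_components_of_def by blast
    then show "C \<in> \<F>" using comp cover by (metis UnionE)
  next
    fix F assume F: "F \<in> \<F>"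
    then obtain x where "x \<in> F" using ne by (metis all_not_in_conv)
    then show "F \<in> connected_components_of X"
      using comp[OF F] F cover unfolding connected_components_of_def by (metis UnionI imageI)
  qed
qed

lemma continuous_map_realization:
  assumes "\<And>\<sigma>. \<sigma> \<in> K \<Longrightarrow> continuous_map (top_of_set (geom_simplex \<sigma>)) X f"
  shows "continuous_map (realization K) X f"
  unfolding continuous_map_def topspace_realization
proof (intro conjI allI impI)
  show "f \<in> polyhedron_of K \<rightarrow> topspace X"
    using assms unfolding polyhedron_of_def continuous_map_def by fastforce
  fix U assume U: "openin X U"
  show "openin (realization K) {x \<in> polyhedron_of K. f x \<in> U}"
    unfolding openin_realization
  proof (intro conjI ballI)
    fix \<sigma> assume \<sigma>: "\<sigma> \<in> K"
    have "{x \<in> polyhedron_of K. f x \<in> U} \<inter> geom_simplex \<sigma> = {x \<in> geom_simplex \<sigma>. f x \<in> U}"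
      using \<sigma> by (auto simp: polyhedron_of_def)
    moreover have "openin (top_of_set (geom_simplex \<sigma>)) {x \<in> geom_simplex \<sigma>. f x \<in> U}"
      using assms[OF \<sigma>] U unfolding continuous_map_def by auto
    ultimately show "openin (top_of_set (geom_simplex \<sigma>)) ({x \<in> polyhedron_of K. f x \<in> U} \<inter> geom_simplex \<sigma>)"
      by simp
  qed auto
qed

definition segment_pt :: "'v \<Rightarrow> 'v \<Rightarrow> real \<Rightarrow> 'v \<Rightarrow> real" where
  "segment_pt x y \<tau> = (\<lambda>u. if u = x then 1 - \<tau> else if u = y then \<tau> else 0)"

lemma geom_simplex_singleton: "geom_simplex {v} = {\<lambda>u. if u = v then 1 else 0}"
  by (auto simp: geom_simplex_def fun_eq_iff)

lemma geom_simplex_pair: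
  assumes "x \<noteq> y" shows "geom_simplex {x, y} = segment_pt x y ` {0..1}"
proof (intro equalityI subsetI)
  fix f assume f: "f \<in> geom_simplex {x, y}"
  then have s: "f x + f y = 1" using assms by (simp add: geom_simplex_def)
  moreover have "0 \<le> f x" "0 \<le> f y" using f by (auto simp: geom_simplex_def)
  moreover have "f = segment_pt x y (f y)"
    using f s assms by (auto simp: segment_pt_def geom_simplex_def fun_eq_iff)
  ultimately show "f \<in> segment_pt x y ` {0..1}" by (intro image_eqI[of _ _ "f y"]) auto
qed (use assms in \<open>auto simp: geom_simplex_def segment_pt_def\<close>)

lemma midpoint_in_simplex:
  assumes "x \<noteq> y" and "segment_pt x y (1 / 2) \<in> geom_simplex e"
  shows "{x, y} \<subseteq> e"
  using assms by (auto simp: geom_simplex_def segment_pt_def split: if_splits)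

context dart_system
begin

section \<open>The embedding of the Cayley graph\<close>

lemma dart_nonzero: "s \<in> \<Lambda> \<Longrightarrow> s \<noteq> 0"
  using E_asym[of 0] by (auto simp: dart_cases)

lemma cayley_edge_iff: "e \<in> cayley_edges \<Lambda> \<longleftrightarrow> (\<exists>x s. s \<in> \<Lambda> \<and> e = {x, x + s})"
proof
  assume "e \<in> cayley_edges \<Lambda>"
  then obtain x y where "e = {x, y}" "x - y \<in> \<Lambda>" by (auto simp: cayley_edges_def)
  moreover have "{x, y} = {y, y + (x - y)}" by auto
  ultimately show "\<exists>x s. s \<in> \<Lambda> \<and> e = {x, x + s}" by metis
next
  assume "\<exists>x s. s \<in> \<Lambda> \<and> e = {x, x + s}"
  then obtain x s where "s \<in> \<Lambda>" "e = {x, x + s}" by blast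
  then have "e = {x + s, x}" "(x + s) - x \<in> \<Lambda>" by auto
  then show "e \<in> cayley_edges \<Lambda>" unfolding cayley_edges_def by blast
qed

lemma dart_edge_eq:
  fixes x y s t :: 'g
  assumes "{x, x + s} = {y, y + t}"
  shows "(x = y \<and> s = t) \<or> (y = x + s \<and> t = - s)"
proof -
  have "t = - s" if "x = y + t" "x + s = y"
  proof -
    have "y + (t + s) = y" using that by (metis add.assoc)
    then have "t + s = 0" by (simp only: add_cancel_left_right)
    then show ?thesis by (simp add: eq_neg_iff_add_eq_0)
  qed
  moreover have "(x = y \<and> x + s = y + t) \<or> (x = y + t \<and> x + s = y)"
    using assms by (simp only: doubleton_eq_iff)
  moreover have "s = t" if "x = y" "x + s = y + t"
    using that(2) unfolding that(1) by (simp only: add_left_cancel)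
  ultimately show ?thesis by metis
qed

definition edge_path :: "'g \<Rightarrow> 'g \<Rightarrow> real \<Rightarrow> nat \<times> 'g \<times> complex" where
  "edge_path x s \<tau> = (if \<tau> = 0 then vert_pt x else if \<tau> = 1 then vert_pt (x + s) else edge_pt x s (2 * pi * \<tau>))"

lemma edge_path_flip: "s \<in> \<Lambda> \<Longrightarrow> edge_path (x + s) (- s) (1 - \<tau>) = edge_path x s \<tau>"
  using edge_pt_flip[of s x "2 * pi * \<tau>"] by (auto simp: edge_path_def algebra_simps)

lemma continuous_map_edge_param:
  assumes s: "s \<in> \<Lambda>"
  shows "continuous_map (top_of_set strip) surf (edge_param x s)"
proof (cases "s \<in> E")
  case True
  then show ?thesis using continuous_map_param[of "Edge x s"] by simp
next
  case False
  then have "- s \<in> E" using s dart_cases by blast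
  then have "continuous_map (top_of_set strip) surf
      (\<lambda>\<zeta>. cparam (Edge (x + s) (- s)) (2 * pi * \<i> - \<zeta>))"
    by (intro continuous_map_param_compose) (auto intro!: continuous_intros)
  moreover have "(\<lambda>\<zeta>. cparam (Edge (x + s) (- s)) (2 * pi * \<i> - \<zeta>)) = edge_param x s"
    using edge_param_flip[OF s] by (simp add: fun_eq_iff)
  ultimately show ?thesis by metis
qed

text \<open>In the vertex chart the edge is the ray of angle \<open>j * pi / deg\<close>, with
  radius the root of \<open>2 * pi * \<tau>\<close>. The bound 1/8 keeps
  \<open>2 * pi * \<tau>\<close> below 1.\<close>

lemma edge_path_near_start:
  assumes s: "s \<in> \<Lambda>"
  shows "continuous_map (top_of_set {0..<1 / 8}) surf (edge_path x s)"
proof -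
  obtain j where j: "rot j = s" using rot_ex s by blast
  define g where "g \<tau> = rcis (root deg (2 * pi * \<tau>)) (j * pi / deg)" for \<tau>
  have cont: "continuous_on {0..<1 / 8} g"
    unfolding g_def rcis_def by (intro continuous_intros)
  have root: "root deg (2 * pi * \<tau>) < 1" if "0 \<le> \<tau>" "\<tau> < 1 / 8" for \<tau>
  proof -
    have "2 * pi * \<tau> \<le> 2 * 4 * \<tau>" using that pi_less_4 by (intro mult_right_mono) auto
    then have "2 * pi * \<tau> < 1" using that by linarith
    then show ?thesis using deg_pos by simp
  qed
  have "g ` {0..<1 / 8} \<subseteq> cdom (Vert x)"
    using root deg_pos by (auto simp: g_def norm_mult)
  then have "continuous_map (top_of_set {0..<1 / 8}) surf (\<lambda>\<tau>. cparam (Vert x) (g \<tau>))"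
    by (intro continuous_map_param_compose cont) auto
  moreover have "edge_path x s \<tau> = cparam (Vert x) (g \<tau>)" if "\<tau> \<in> {0..<1 / 8}" for \<tau>
  proof (cases "\<tau> = 0")
    case True
    then show ?thesis by (simp add: edge_path_def g_def vert_param_def)
  next
    case False
    then have t: "0 < \<tau>" "\<tau> < 1 / 8" using that by auto
    define r where "r = root deg (2 * pi * \<tau>)"
    have r: "0 < r" "r ^ deg = 2 * pi * \<tau>" using t deg_pos by (simp_all add: r_def)
    have z: "deg * (j * pi / deg) - j * pi = 0" using deg_pos by simp
    have "vert_param x (g \<tau>) = edge_param x (rot j) (\<i> * rcis (r ^ deg) (deg * (j * pi / deg) - j * pi))"
      unfolding g_def r_def[symmetric] using r z by (intro vert_param_rcis) simp_all
    also have "\<dots> = edge_pt x s (2 * pi * \<tau>)"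
      unfolding z r(2) j by (simp add: edge_param_def)
    finally show ?thesis using t by (simp add: edge_path_def)
  qed
  ultimately show ?thesis
    by (metis (no_types, lifting) continuous_map_eq topspace_euclidean_subtopology)
qed

lemma continuous_map_edge_path:
  assumes s: "s \<in> \<Lambda>"
  shows "continuous_map (top_of_set {0..1}) surf (edge_path x s)"
proof -
  \<comment> \<open>Three open pieces: the start in a vertex chart, the interior in the edge chart,
    and the end as the start of the reverse dart.\<close>
  define T where "T = (\<lambda>i::nat. if i = 0 then {0..<1 / 8} else if i = 1 then {0<..<1} else {7 / 8<..1::real})"
  show ?thesis
  proof (rule pasting_lemma[where I = "{0, 1, 2}" and T = T and f = "\<lambda>_. edge_path x s"])
    fix i :: nat assume i: "i \<in> {0, 1, 2}"
    have eqs: "{0..<1 / 8} = {0..1} \<inter> {..<1 / 8::real}" "{0<..<1} = {0..1} \<inter> {0<..<1::real}"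
        "{7 / 8<..1} = {0..1} \<inter> {7 / 8::real<..}" by auto
    have "openin (top_of_set {0..1}) {0..<1 / 8::real}" "openin (top_of_set {0..1}) {0<..<1::real}"
        "openin (top_of_set {0..1}) {7 / 8<..1::real}"
      by (subst eqs; blast intro: openin_open_Int open_lessThan open_greaterThanLessThan open_greaterThan)+
    then show "openin (top_of_set {0..1}) (T i)" using i by (auto simp: T_def)
    have "continuous_map (top_of_set {0<..<1}) surf (edge_path x s)"
    proof -
      have "continuous_map (top_of_set {0<..<1::real}) (top_of_set strip) (\<lambda>\<tau>. \<i> * (2 * pi * \<tau>))"
        by (auto intro!: continuous_intros)
      from continuous_map_compose[OF this continuous_map_edge_param[OF s]]
      have "continuous_map (top_of_set {0<..<1}) surf (\<lambda>\<tau>. edge_param x s (\<i> * (2 * pi * \<tau>)))"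
        by (simp add: o_def)
      moreover have "edge_param x s (\<i> * (2 * pi * \<tau>)) = edge_path x s \<tau>" if "\<tau> \<in> {0<..<1}" for \<tau>
        using that by (simp add: edge_param_def edge_path_def)
      ultimately show ?thesis
        by (metis (no_types, lifting) continuous_map_eq topspace_euclidean_subtopology)
    qed
    moreover have "continuous_map (top_of_set {7 / 8<..1}) surf (edge_path x s)"
    proof -
      have "continuous_map (top_of_set {7 / 8<..1::real}) (top_of_set {0..<1 / 8}) (\<lambda>\<tau>. 1 - \<tau>)"
        by (auto intro!: continuous_intros)
      from continuous_map_compose[OF this edge_path_near_start[OF minus_in[OF s], of "x + s"]]
      show ?thesis using edge_path_flip[OF s, of x] by (simp add: o_def)
    qed
    ultimately have "continuous_map (top_of_set (T i)) surf (edge_path x s)"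
      using i edge_path_near_start[OF s] by (auto simp: T_def)
    moreover have "subtopology (top_of_set {0..1}) (T i) = top_of_set (T i)"
      using i by (auto simp: T_def subtopology_subtopology Int_absorb1 subset_iff)
    ultimately show "continuous_map (subtopology (top_of_set {0..1}) (T i)) surf (edge_path x s)" by simp
  next
    fix \<tau> :: real assume "\<tau> \<in> topspace (top_of_set {0..1})"
    then have "\<tau> \<in> T 0 \<or> \<tau> \<in> T 1 \<or> \<tau> \<in> T 2" by (auto simp: T_def)
    then show "\<exists>j. j \<in> {0, 1, 2} \<and> \<tau> \<in> T j \<and> edge_path x s \<tau> = edge_path x s \<tau>" by blast
  qed auto
qed

text \<open>
  On the edge \<open>{x, x + s}\<close> with \<open>s \<in> E\<close>, the pair \<open>(x, s)\<close> is the only one that satisfies the description.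
\<close>

definition graph_map :: "('g \<Rightarrow> real) \<Rightarrow> nat \<times> 'g \<times> complex" where
  "graph_map f = (if \<exists>v. f v = 1 then vert_pt (SOME v. f v = 1)
     else case SOME (x, s). s \<in> E \<and> 0 < f x \<and> 0 < f (x + s) of (x, s) \<Rightarrow> edge_path x s (f (x + s)))"

text \<open>The two points of positive weight determine the edge, and membership in \<open>E\<close>
  determines its direction. If \<open>s\<close> itself is outside \<open>E\<close>, the choice
  yields the reverse dart, reconciled by \<open>edge_path_flip\<close>.\<close>

lemma graph_map_segment:
  assumes s: "s \<in> \<Lambda>" and \<tau>: "0 \<le> \<tau>" "\<tau> \<le> 1"
  shows "graph_map (segment_pt x (x + s) \<tau>) = edge_path x s \<tau>"
proof -
  let ?f = "segment_pt x (x + s) \<tau>"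
  have xs: "x + s \<noteq> x" using dart_nonzero[OF s] by simp
  have fx: "?f x = 1 - \<tau>" "?f (x + s) = \<tau>" using xs by (auto simp: segment_pt_def)
  have other: "u = x \<or> u = x + s" if "?f u \<noteq> 0" for u using that by (auto simp: segment_pt_def split: if_splits)
  consider "\<tau> = 0" | "\<tau> = 1" | "0 < \<tau>" "\<tau> < 1" using \<tau> by linarith
  then show ?thesis
  proof cases
    case 1
    then have "?f v = 1 \<longleftrightarrow> v = x" for v using xs by (auto simp: segment_pt_def)
    then show ?thesis using 1 by (simp add: graph_map_def edge_path_def)
  next
    case 2
    then have "?f v = 1 \<longleftrightarrow> v = x + s" for v using xs by (auto simp: segment_pt_def)
    then show ?thesis using 2 by (simp add: graph_map_def edge_path_def)
  next
    case 3
    then have no: "\<nexists>v. ?f v = 1" using xs by (auto simp: segment_pt_def split: if_splits)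
    define P where "P = (\<lambda>(y, t). t \<in> E \<and> 0 < ?f y \<and> 0 < ?f (y + t))"
    have "P (x, s) \<or> P (x + s, - s)"
      using s fx 3 by (auto simp: P_def dart_cases)
    then have P: "P (Eps P)" by (metis someI)
    obtain y t where yt: "Eps P = (y, t)" by fastforce
    then have t: "t \<in> E" "?f y \<noteq> 0" "?f (y + t) \<noteq> 0" using P by (auto simp: P_def)
    have t0: "t \<noteq> 0" using t(1) E_subset dart_nonzero by blast
    have g: "graph_map ?f = edge_path y t (?f (y + t))"
      using no yt unfolding graph_map_def P_def by simp
    from other[OF t(2)] show ?thesis
    proof
      assume y: "y = x"
      then have "t = s" using other[OF t(3)] t0 by auto
      then show ?thesis using g fx y by simp
    next
      assume y: "y = x + s"
      then have "y + t = x" using other[OF t(3)] t0 by auto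
      then have "x + (s + t) = x" unfolding y by (simp only: add.assoc)
      then have "s + t = 0" by (simp only: add_cancel_left_right)
      then have "t = - s" by (metis minus_unique)
      then show ?thesis using g fx y edge_path_flip[OF s, of x \<tau>] by simp
    qed
  qed
qed

lemma graph_map_vertex: "graph_map (\<lambda>u. if u = v then 1 else 0) = vert_pt v"
  by (simp add: graph_map_def)

abbreviation "graph_pts \<equiv> polyhedron_of (graph_complex UNIV (cayley_edges \<Lambda>))"

lemma graph_pts_cases:
  assumes "f \<in> graph_pts"
  obtains (vert) v where "f = (\<lambda>u. if u = v then 1 else 0)" "graph_map f = vert_pt v"
  | (edge) x s \<tau> where "s \<in> E" "0 < \<tau>" "\<tau> < 1" "f = segment_pt x (x + s) \<tau>" "graph_map f = edge_pt x s (2 * pi * \<tau>)"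
proof -
  obtain \<sigma> where \<sigma>: "f \<in> geom_simplex \<sigma>" "\<sigma> \<in> (\<lambda>v. {v}) ` UNIV \<or> \<sigma> \<in> cayley_edges \<Lambda>"
    using assms by (auto simp: polyhedron_of_def graph_complex_def)
  from \<sigma>(2) show thesis
  proof
    assume "\<sigma> \<in> (\<lambda>v. {v}) ` UNIV"
    then obtain v where "\<sigma> = {v}" by blast
    then have "f = (\<lambda>u. if u = v then 1 else 0)" using \<sigma>(1) by (simp only: geom_simplex_singleton singleton_iff)
    then show thesis using vert[of v] graph_map_vertex[of v] by metis
  next
    assume "\<sigma> \<in> cayley_edges \<Lambda>"
    then obtain x' s' where xs': "s' \<in> \<Lambda>" "\<sigma> = {x', x' + s'}" unfolding cayley_edge_iff by blast
    have "\<sigma> = {x' + s', x' + s' + - s'}" using xs'(2) by auto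
    then obtain x s where xs: "s \<in> E" "\<sigma> = {x, x + s}"
      using xs' dart_cases[of s'] by blast
    have "x \<noteq> x + s" using dart_nonzero[OF E_subset[OF xs(1)]] by simp
    then obtain \<tau> where \<tau>: "0 \<le> \<tau>" "\<tau> \<le> 1" "f = segment_pt x (x + s) \<tau>"
      using \<sigma>(1) geom_simplex_pair[of x "x + s"] xs(2) by auto
    consider "\<tau> = 0" | "\<tau> = 1" | "0 < \<tau>" "\<tau> < 1" using \<tau> by linarith
    then show thesis
    proof cases
      case 1
      then have "f = (\<lambda>u. if u = x then 1 else 0)" using \<tau> by (auto simp: segment_pt_def)
      then show thesis using vert graph_map_vertex by metis
    next
      case 2
      then have "f = (\<lambda>u. if u = x + s then 1 else 0)" using \<tau> \<open>x \<noteq> x + s\<close> by (auto simp: segment_pt_def fun_eq_iff)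
      then show thesis using vert graph_map_vertex by metis
    next
      case 3
      then show thesis
        using edge[OF xs(1) 3 \<tau>(3)] graph_map_segment[OF E_subset[OF xs(1)] \<tau>(1,2)] \<tau>(3) by (simp add: edge_path_def)
    qed
  qed
qed

lemma fst_vert_pt: "fst (vert_pt x) = N"
  by (simp add: vert_pt_def)

lemma inj_on_graph_map: "inj_on graph_map graph_pts"
proof (rule inj_onI)
  fix f f' assume f: "f \<in> graph_pts" and f': "f' \<in> graph_pts" and eq: "graph_map f = graph_map f'"
  from f show "f = f'"
  proof (cases rule: graph_pts_cases)
    case v: (vert v)
    from f' show ?thesis
    proof (cases rule: graph_pts_cases)
      case (vert v')
      then have "vert_pt v = vert_pt v'" using v(2) eq by metis
      then have "v = v'" by (simp add: vert_pt_def)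
      then show ?thesis using v(1) vert(1) by metis
    next
      case (edge x s \<tau>)
      then have "vert_pt v = edge_pt x s (2 * pi * \<tau>)" using v(2) eq by metis
      then show ?thesis using fst_edge_pt[of x s "2 * pi * \<tau>"] fst_vert_pt[of v] by simp
    qed
  next
    case e: (edge x s \<tau>)
    from f' show ?thesis
    proof (cases rule: graph_pts_cases)
      case (vert v')
      then have "vert_pt v' = edge_pt x s (2 * pi * \<tau>)" using e(5) eq by metis
      then show ?thesis using fst_edge_pt[of x s "2 * pi * \<tau>"] fst_vert_pt[of v'] by simp
    next
      case (edge x' s' \<tau>')
      then have "x = x' \<and> s = s' \<and> 2 * pi * \<tau> = 2 * pi * \<tau>'"
        using edge_pt_unique[of s s' x "2 * pi * \<tau>" x' "2 * pi * \<tau>'"] e(1,5) eq E_subset E_asym by metis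
      then show ?thesis unfolding e(4) edge(4) by simp
    qed
  qed
qed

lemma graph_embedding_graph_map: "graph_embedding UNIV (cayley_edges \<Lambda>) surf graph_map"
  unfolding graph_embedding_def
proof (intro conjI inj_on_graph_map continuous_map_realization)
  fix \<sigma> assume "\<sigma> \<in> graph_complex UNIV (cayley_edges \<Lambda>)"
  then consider v where "\<sigma> = {v}" | x s where "s \<in> \<Lambda>" "\<sigma> = {x, x + s}"
    unfolding graph_complex_def cayley_edge_iff[symmetric] using cayley_edge_iff by blast
  then show "continuous_map (top_of_set (geom_simplex \<sigma>)) surf graph_map"
  proof cases
    case 1
    have "vert_pt v \<in> topspace surf"
      using param_in_topspace[of "Vert v" 0] by (simp add: vert_param_def)
    then have "continuous_map (top_of_set (geom_simplex \<sigma>)) surf (\<lambda>_. vert_pt v)" by simp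
    then show ?thesis
      by (rule continuous_map_eq) (simp add: 1 geom_simplex_singleton graph_map_vertex)
  next
    case 2
    have ne: "x \<noteq> x + s" using dart_nonzero[OF 2(1)] by simp
    have coord: "segment_pt x (x + s) \<tau> (x + s) = \<tau>" for \<tau> using ne by (auto simp: segment_pt_def)
    have "continuous_on (geom_simplex \<sigma>) (\<lambda>f. f (x + s))"
      by (rule continuous_on_subset[OF continuous_on_product_coordinates]) simp
    then have "continuous_map (top_of_set (geom_simplex \<sigma>)) (top_of_set {0..1}) (\<lambda>f. f (x + s))"
      using coord unfolding 2 geom_simplex_pair[OF ne] by auto
    from continuous_map_compose[OF this continuous_map_edge_path[OF 2(1), of x]]
    show ?thesis
      by (rule continuous_map_eq) (auto simp: 2 geom_simplex_pair[OF ne] graph_map_segment[OF 2(1)] coord)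
  qed
qed

lemma graph_map_image_simplex:
  assumes "s \<in> \<Lambda>"
  shows "graph_map ` geom_simplex {x, x + s} = edge_path x s ` {0..1}"
proof -
  have "x \<noteq> x + s" using dart_nonzero[OF assms] by simp
  then show ?thesis
    using graph_map_segment[OF assms] by (auto simp: geom_simplex_pair image_image)
qed

section \<open>The discs as faces, and their frontiers\<close>

definition face_set :: "nat \<Rightarrow> 'g \<Rightarrow> (nat \<times> 'g \<times> complex) set" where
  "face_set f g = (\<lambda>z. (f, g, z)) ` ball 0 1"

definition face_edges :: "nat \<Rightarrow> 'g \<Rightarrow> 'g set set" where
  "face_edges f g = {{x, x + s} | x s. s \<in> \<Lambda> \<and> face_idx s = f \<and> x - offset s = g}"

lemma face_set_disjoint: "p \<in> face_set f g \<Longrightarrow> p \<in> face_set f' g' \<Longrightarrow> f = f' \<and> g = g'"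
  by (auto simp: face_set_def)

lemma openin_face_set: "Face f g \<in> cells \<Longrightarrow> openin surf (face_set f g)"
  using openin_chart_image[of "Face f g" "ball 0 1"] by (simp add: face_set_def)

lemma face_pt_in_face_set_iff:
  assumes "s \<in> \<Lambda>" "Re \<xi> < 0"
  shows "face_pt x s \<xi> \<in> face_set f g \<longleftrightarrow> face_idx s = f \<and> x - offset s = g"
  using face_pt_in_ball[OF assms, of x] by (auto simp: face_pt_def face_set_def)

lemma graph_map_image: "graph_map ` graph_pts = {p \<in> topspace surf. N \<le> fst p}"
proof (intro equalityI subsetI)
  fix p assume "p \<in> graph_map ` graph_pts"
  then obtain f where f: "f \<in> graph_pts" "p = graph_map f" by blast
  have "graph_map f \<in> topspace surf"
    using graph_embedding_graph_map f(1) unfolding graph_embedding_def continuous_map_def topspace_realization by blast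
  moreover have "N \<le> fst (graph_map f)"
    using f(1)
  proof (cases rule: graph_pts_cases)
    case (vert v)
    then show ?thesis using fst_vert_pt[of v] by simp
  next
    case (edge x s \<tau>)
    then show ?thesis using fst_edge_pt[of x s "2 * pi * \<tau>"] by simp
  qed
  ultimately show "p \<in> {p \<in> topspace surf. N \<le> fst p}" using f(2) by simp
next
  fix p assume p: "p \<in> {p \<in> topspace surf. N \<le> fst p}"
  then have "p \<in> topspace surf" by blast
  then show "p \<in> graph_map ` graph_pts"
  proof (cases rule: topspace_cases)
    case (face f g z)
    then show ?thesis using p by simp
  next
    case (edge x s y)
    have s: "s \<in> \<Lambda>" using edge(1) by (rule E_subset)
    have \<tau>: "0 \<le> y / (2 * pi)" "y / (2 * pi) \<le> 1" "y / (2 * pi) \<noteq> 0" "y / (2 * pi) \<noteq> 1"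
      using edge by (auto simp: field_simps)
    have ne: "x \<noteq> x + s" using dart_nonzero[OF s] by simp
    have "{x, x + s} \<in> graph_complex UNIV (cayley_edges \<Lambda>)"
      unfolding graph_complex_def using cayley_edge_iff s by blast
    moreover have "segment_pt x (x + s) (y / (2 * pi)) \<in> geom_simplex {x, x + s}"
      unfolding geom_simplex_pair[OF ne] using \<tau>(1,2) by (intro imageI) simp
    ultimately have "segment_pt x (x + s) (y / (2 * pi)) \<in> graph_pts"
      unfolding polyhedron_of_def by (rule UN_I)
    moreover have "graph_map (segment_pt x (x + s) (y / (2 * pi))) = p"
      unfolding graph_map_segment[OF s \<tau>(1,2)] edge(4) edge_path_def using \<tau>(3,4) by simp
    ultimately show ?thesis by (metis imageI)
  next
    case (vert x)
    have "{x} \<in> graph_complex UNIV (cayley_edges \<Lambda>)" by (simp add: graph_complex_def)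
    moreover have "(\<lambda>u. if u = x then 1 else 0) \<in> geom_simplex {x}" by (simp add: geom_simplex_singleton)
    ultimately have "(\<lambda>u. if u = x then 1 else 0) \<in> graph_pts" unfolding polyhedron_of_def by (rule UN_I)
    then show ?thesis unfolding vert using graph_map_vertex by (metis imageI)
  qed
qed

definition faces :: "(nat \<times> 'g \<times> complex) set set" where
  "faces = {face_set f g | f g. Face f g \<in> cells}"

lemma Union_faces: "\<Union>faces = topspace surf - graph_map ` graph_pts"
proof (intro equalityI subsetI)
  fix p assume "p \<in> \<Union>faces"
  then obtain f g where "p \<in> face_set f g" "Face f g \<in> cells" by (auto simp: faces_def)
  then show "p \<in> topspace surf - graph_map ` graph_pts"
    using openin_face_set[of f g] openin_subset unfolding graph_map_image by (auto simp: face_set_def)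
next
  fix p assume "p \<in> topspace surf - graph_map ` graph_pts"
  then have p: "p \<in> topspace surf" "fst p < N" unfolding graph_map_image by auto
  from p(1) show "p \<in> \<Union>faces"
  proof (cases rule: topspace_cases)
    case (face f g z)
    then have "p \<in> face_set f g" by (simp add: face_set_def)
    then show ?thesis using face(1) unfolding faces_def by blast
  next
    case (edge x s y)
    then show ?thesis using p fst_edge_pt[of x s y] by simp
  next
    case (vert x)
    then show ?thesis using p by (simp add: fst_vert_pt)
  qed
qed

lemma embedding_faces_eq: "embedding_faces UNIV (cayley_edges \<Lambda>) surf graph_map = faces"
  unfolding embedding_faces_def
proof (rule connected_components_of_open_partition)
  let ?Y = "topspace surf - graph_map ` graph_pts"
  fix F assume F: "F \<in> faces"
  then obtain f g where fg: "F = face_set f g" "Face f g \<in> cells" by (auto simp: faces_def)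
  have sub: "F \<subseteq> ?Y" using F Union_faces by blast
  have "connectedin surf F"
    using connectedin_param_image[OF fg(2), of "ball 0 1"] by (simp add: fg face_set_def)
  then show "connectedin (subtopology surf ?Y) F" using sub by (simp add: connectedin_subtopology)
  show "openin (subtopology surf ?Y) F"
    using openin_face_set[OF fg(2)] sub unfolding fg(1) openin_subtopology by blast
next
  show "{} \<notin> faces" by (auto simp: faces_def face_set_def)
  show "pairwise disjnt faces"
    unfolding pairwise_def disjnt_iff faces_def using face_set_disjoint by blast
  show "\<Union>faces = topspace (subtopology surf (topspace surf - graph_map ` graph_pts))"
    unfolding Union_faces by auto
qed

lemma graph_map_image_face_edges:
  "p \<in> graph_map ` polyhedron_of (face_edges f g) \<longleftrightarrow>
     (\<exists>x s. s \<in> \<Lambda> \<and> face_idx s = f \<and> x - offset s = g \<and> p \<in> edge_path x s ` {0..1})"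
proof -
  have "p \<in> graph_map ` polyhedron_of (face_edges f g) \<longleftrightarrow> (\<exists>e\<in>face_edges f g. p \<in> graph_map ` geom_simplex e)"
    unfolding polyhedron_of_def image_UN by (rule UN_iff)
  also have "\<dots> \<longleftrightarrow> (\<exists>x s. (s \<in> \<Lambda> \<and> face_idx s = f \<and> x - offset s = g) \<and> p \<in> graph_map ` geom_simplex {x, x + s})"
    unfolding face_edges_def by blast
  also have "\<dots> \<longleftrightarrow> (\<exists>x s. s \<in> \<Lambda> \<and> face_idx s = f \<and> x - offset s = g \<and> p \<in> edge_path x s ` {0..1})"
    by (metis (no_types) graph_map_image_simplex)
  finally show ?thesis .
qed

text \<open>An inner point of the edge is a limit of points slightly to its left, which lie in the
  disc. The end points follow by continuity of the path.\<close>

lemma edge_path_in_closure: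
  assumes s: "s \<in> \<Lambda>" and fg: "face_idx s = f" "x - offset s = g"
  shows "edge_path x s ` {0..1} \<subseteq> surf closure_of face_set f g"
proof -
  let ?S = "strip" and ?T = "{\<zeta>. 0 < Im \<zeta> \<and> Im \<zeta> < 2 * pi \<and> Re \<zeta> < 0}"
  have mid: "edge_path x s \<tau> \<in> surf closure_of face_set f g" if \<tau>: "\<tau> \<in> {0<..<1}" for \<tau>
  proof -
    have "\<i> * (2 * pi * \<tau>) \<in> closure ?T"
      unfolding closure_approachable
    proof (intro allI impI)
      fix e :: real assume "0 < e"
      then show "\<exists>y\<in>?T. dist y (\<i> * (2 * pi * \<tau>)) < e"
        using \<tau> by (intro bexI[of _ "\<i> * (2 * pi * \<tau>) - of_real (e / 2)"]) (auto simp: dist_norm)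
    qed
    then have "\<i> * (2 * pi * \<tau>) \<in> top_of_set ?S closure_of ?T"
      using \<tau> by (auto simp: closure_of_subtopology Int_absorb1 subset_iff)
    then have "edge_param x s (\<i> * (2 * pi * \<tau>)) \<in> surf closure_of edge_param x s ` ?T"
      using continuous_map_image_closure_subset[OF continuous_map_edge_param[OF s, of x], of ?T] by blast
    moreover have "edge_param x s ` ?T \<subseteq> face_set f g"
      using face_pt_in_face_set_iff[OF s, of _ x f g] fg by (auto simp: edge_param_def)
    moreover have "edge_param x s (\<i> * (2 * pi * \<tau>)) = edge_path x s \<tau>"
      using \<tau> by (simp add: edge_param_def edge_path_def)
    ultimately show ?thesis
      using closure_of_mono[of "edge_param x s ` ?T" "face_set f g" surf] by auto
  qed
  have "top_of_set {0..1} closure_of {0<..<1} = {0..1::real}"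
    by (simp add: closure_of_subtopology Int_absorb1 greaterThanLessThan_subseteq_atLeastAtMost_iff)
  then have "edge_path x s ` {0..1} \<subseteq> surf closure_of (edge_path x s ` {0<..<1})"
    using continuous_map_image_closure_subset[OF continuous_map_edge_path[OF s, of x], of "{0<..<1}"] by simp
  also have "\<dots> \<subseteq> surf closure_of (surf closure_of face_set f g)"
    using mid by (intro closure_of_mono) blast
  finally show ?thesis by simp
qed

text \<open>For the inclusion into the graph: a chart around a frontier point must meet the disc. In
  an edge chart the side that is met tells which of the two darts bounds the disc; in a vertex chart
  the sector that is met gives a dart bounding it and starting at the vertex.\<close>

lemma frontier_face_set:
  assumes cell: "Face f g \<in> cells"
  shows "surf frontier_of face_set f g = graph_map ` polyhedron_of (face_edges f g)"
proof -
  have fr: "surf frontier_of face_set f g = surf closure_of face_set f g - face_set f g"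
    using openin_face_set[OF cell] by (simp add: frontier_of_def interior_of_openin)
  show ?thesis
    unfolding fr
  proof (intro equalityI subsetI)
    fix p assume "p \<in> graph_map ` polyhedron_of (face_edges f g)"
    then obtain x s \<tau> where p: "s \<in> \<Lambda>" "face_idx s = f" "x - offset s = g" "p = edge_path x s \<tau>" "\<tau> \<in> {0..1}"
      unfolding graph_map_image_face_edges by blast
    have "N \<le> fst p"
      using fst_vert_pt[of x] fst_vert_pt[of "x + s"] fst_edge_pt[of x s "2 * pi * \<tau>"]
      unfolding p(4) edge_path_def by simp
    then have "p \<notin> face_set f g" using cell by (auto simp: face_set_def)
    then show "p \<in> surf closure_of face_set f g - face_set f g"
      using edge_path_in_closure[OF p(1-3)] p(4,5) by blast
  next
    fix p assume p: "p \<in> surf closure_of face_set f g - face_set f g"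
    then have top: "p \<in> topspace surf" by (meson DiffD1 in_closure_of)
    have dart: "edge_path x s \<tau> \<in> graph_map ` polyhedron_of (face_edges f g)"
      if "s \<in> \<Lambda>" "face_idx s = f" "x - offset s = g" "\<tau> \<in> {0..1}" for x s \<tau>
      unfolding graph_map_image_face_edges using that by blast
    have meets: "\<exists>y\<in>cdom a. cparam a y \<in> face_set f g" if "a \<in> cells" "z \<in> cdom a" "p = cparam a z" for a z
    proof -
      have "z \<in> closure {y \<in> cdom a. cparam a y \<in> face_set f g}"
        using in_closure_iff[OF that(1,2)] p that(3) by blast
      then have "{y \<in> cdom a. cparam a y \<in> face_set f g} \<noteq> {}" by (metis closure_empty empty_iff)
      then show ?thesis by blast
    qed
    have face_N: "fst q < N" if "q \<in> face_set f g" for q using that cell by (auto simp: face_set_def)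
    from top show "p \<in> graph_map ` polyhedron_of (face_edges f g)"
    proof (cases rule: topspace_cases)
      case (face f' g' z)
      have "openin surf (face_set f' g')" "p \<in> face_set f' g'"
        using openin_face_set[OF face(1)] face by (auto simp: face_set_def)
      then have "\<exists>q. q \<in> face_set f g \<and> q \<in> face_set f' g'"
        using p[THEN DiffD1, unfolded in_closure_of, THEN conjunct2, THEN spec, of "face_set f' g'"] by simp
      then show ?thesis using face_set_disjoint p \<open>p \<in> face_set f' g'\<close> by blast
    next
      case (edge x s y)
      have s: "s \<in> \<Lambda>" using edge(1) by (rule E_subset)
      have \<tau>: "y / (2 * pi) \<in> {0..1}" "1 - y / (2 * pi) \<in> {0..1}" "y / (2 * pi) \<noteq> 0" "y / (2 * pi) \<noteq> 1"
        using edge by (auto simp: field_simps)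
      have p1: "p = edge_path x s (y / (2 * pi))" using \<tau>(3,4) unfolding edge(4) edge_path_def by simp
      have "p = cparam (Edge x s) (\<i> * y)" using edge by (simp add: edge_param_def)
      then have "\<exists>\<zeta>\<in>cdom (Edge x s). cparam (Edge x s) \<zeta> \<in> face_set f g"
        by (rule meets[rotated 2]) (use edge(1-3) in auto)
      then obtain \<zeta> where \<zeta>: "edge_param x s \<zeta> \<in> face_set f g" unfolding cparam.simps by blast
      then have "Re \<zeta> \<noteq> 0" using edge_param_eq_face_iff[OF s] face_N by blast
      then consider "Re \<zeta> < 0" | "Re \<zeta> > 0" by linarith
      then show ?thesis
      proof cases
        case 1
        then have "face_idx s = f \<and> x - offset s = g"
          using \<zeta> face_pt_in_face_set_iff[OF s 1] by (simp add: edge_param_def)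
        then show ?thesis unfolding p1 using dart[OF s _ _ \<tau>(1)] by blast
      next
        case 2
        then have "face_idx (- s) = f \<and> x + s - offset (- s) = g"
          using \<zeta> face_pt_in_face_set_iff[OF minus_in[OF s], of "2 * pi * \<i> - \<zeta>"] by (simp add: edge_param_def)
        then have "edge_path (x + s) (- s) (1 - y / (2 * pi)) \<in> graph_map ` polyhedron_of (face_edges f g)"
          using dart[OF minus_in[OF s] _ _ \<tau>(2)] by blast
        then show ?thesis unfolding p1 edge_path_flip[OF s] .
      qed
    next
      case (vert x)
      have "p = cparam (Vert x) 0" using vert by (simp add: vert_param_def)
      then have "\<exists>w\<in>cdom (Vert x). cparam (Vert x) w \<in> face_set f g"
        by (rule meets[rotated 2]) auto
      then obtain w where w: "vert_param x w \<in> face_set f g" unfolding cparam.simps by blast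
      then have "w \<noteq> 0" using face_N[OF w] by (auto simp: vert_param_def vert_pt_def)
      then obtain j e where e: "0 < e"
        "\<And>x v. v \<in> ball w e \<Longrightarrow> v \<noteq> 0 \<and> vert_param x v = edge_param x (rot j) (corner j v)"
        "Re (corner j w) \<le> 0"
        using vert_param_local[of w] by metis
      define \<xi> where "\<xi> = corner j w"
      have \<xi>: "edge_param x (rot j) \<xi> \<in> face_set f g" using w e(1) e(2)[of w x] by (simp add: \<xi>_def)
      then have "Re \<xi> \<noteq> 0" using edge_param_eq_face_iff[OF rot_in] face_N by blast
      then have neg: "Re \<xi> < 0" using e(3) unfolding \<xi>_def by linarith
      then have "face_idx (rot j) = f \<and> x - offset (rot j) = g"
        using \<xi> face_pt_in_face_set_iff[OF rot_in neg] by (simp add: edge_param_def)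
      then have "edge_path x (rot j) 0 \<in> graph_map ` polyhedron_of (face_edges f g)"
        using dart[OF rot_in] by simp
      then show ?thesis unfolding vert by (simp add: edge_path_def)
    qed
  qed
qed

lemma face_edges_eq:
  assumes f: "f < N"
  shows "face_edges f g =
    {{g + sum_list (take k (L f)), g + sum_list (take (Suc k) (L f))} | k. k < length (L f)}"
proof -
  have step: "offset (L f ! k) = sum_list (take k (L f))"
      "sum_list (take (Suc k) (L f)) = sum_list (take k (L f)) + L f ! k" if "k < length (L f)" for k
    using face_idx_step_pos[OF f that] that by (simp_all add: offset_def take_Suc_conv_app_nth)
  show ?thesis
  proof (intro equalityI subsetI)
    fix e assume "e \<in> face_edges f g"
    then obtain x s where e: "e = {x, x + s}" "s \<in> \<Lambda>" "face_idx s = f" "x - offset s = g"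
      by (auto simp: face_edges_def)
    define k where "k = step_pos s"
    have k: "k < length (L f)" "L f ! k = s" using step_of_dart[OF e(2)] e(3) by (auto simp: k_def face_len_def)
    have "x = g + sum_list (take k (L f))" using step(1)[OF k(1)] k(2) e(4) by (auto simp: algebra_simps)
    then have "e = {g + sum_list (take k (L f)), g + sum_list (take (Suc k) (L f))}"
      using step(2)[OF k(1)] e(1) k(2) by (simp add: add.assoc)
    then show "e \<in> {{g + sum_list (take k (L f)), g + sum_list (take (Suc k) (L f))} | k. k < length (L f)}"
      using k(1) by blast
  next
    fix e assume "e \<in> {{g + sum_list (take k (L f)), g + sum_list (take (Suc k) (L f))} | k. k < length (L f)}"
    then obtain k where k: "k < length (L f)" "e = {g + sum_list (take k (L f)), g + sum_list (take (Suc k) (L f))}"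
      by blast
    have "e = {g + offset (L f ! k), g + offset (L f ! k) + L f ! k}"
      using step[OF k(1)] k(2) by (simp add: add.assoc)
    moreover have "L f ! k \<in> \<Lambda>" "face_idx (L f ! k) = f" using step_in[OF f k(1)] face_idx_step_pos[OF f k(1)] by auto
    ultimately show "e \<in> face_edges f g" unfolding face_edges_def by force
  qed
qed

text \<open>The midpoint of an edge has positive weight at both ends, so it lies on no other
  edge.\<close>

lemma polyhedron_of_inj:
  assumes "C \<subseteq> cayley_edges \<Lambda>" "C' \<subseteq> cayley_edges \<Lambda>" "polyhedron_of C \<subseteq> polyhedron_of C'"
  shows "C \<subseteq> C'"
proof
  fix e assume e: "e \<in> C"
  then obtain x s where xs: "s \<in> \<Lambda>" "e = {x, x + s}" using assms(1) cayley_edge_iff by blast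
  have ne: "x \<noteq> x + s" using dart_nonzero[OF xs(1)] by simp
  have "segment_pt x (x + s) (1 / 2) \<in> geom_simplex e"
    unfolding xs(2) geom_simplex_pair[OF ne] by (intro imageI) simp
  then have "segment_pt x (x + s) (1 / 2) \<in> polyhedron_of C'"
    using assms(3) e by (auto simp: polyhedron_of_def)
  then obtain e' where e': "e' \<in> C'" "segment_pt x (x + s) (1 / 2) \<in> geom_simplex e'"
    by (auto simp: polyhedron_of_def)
  then obtain y t where yt: "e' = {y, y + t}" using assms(2) cayley_edge_iff by blast
  have "{x, x + s} \<subseteq> {y, y + t}" using midpoint_in_simplex[OF ne e'(2)] yt by simp
  then have "e' = e" unfolding xs(2) yt using ne by auto
  then show "e \<in> C'" using e'(1) by simp
qed

lemma face_edges_subset: "face_edges f g \<subseteq> cayley_edges \<Lambda>"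
  unfolding face_edges_def using cayley_edge_iff by blast

end

section \<open>Two-coloured systems of darts\<close>

text \<open>Faces below \<open>M\<close> have all steps in \<open>E\<close>, the others have all
  steps in its negative. As the two discs at an edge see opposite steps, they get different
  colours.\<close>

locale two_coloured_darts = dart_system +
  fixes M :: nat
  assumes colour: "\<lbrakk>f < N; k < length (L f)\<rbrakk> \<Longrightarrow> L f ! k \<in> E \<longleftrightarrow> f < M"
begin

lemma colour_dart: "s \<in> \<Lambda> \<Longrightarrow> s \<in> E \<longleftrightarrow> face_idx s < M"
  using colour[of "face_idx s" "step_pos s"] step_of_dart[of s] by (simp add: face_len_def)

definition colour_faces :: "bool \<Rightarrow> (nat \<times> 'a) set" where
  "colour_faces c = {(f, g). Face f g \<in> cells \<and> (f < M) = c}"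

definition cycles :: "bool \<Rightarrow> 'a set set set" where
  "cycles c = (\<lambda>(f, g). face_edges f g) ` colour_faces c"

text \<open>Faces of the same colour represent the common edge by darts whose steps have the same
  sign, hence by the same dart, which has only one disc on its left.\<close>

lemma face_edges_disjoint:
  assumes fg: "(f, g) \<in> colour_faces c" "(f', g') \<in> colour_faces c"
    and e: "e \<in> face_edges f g" "e \<in> face_edges f' g'"
  shows "f = f' \<and> g = g'"
proof -
  obtain x s where xs: "e = {x, x + s}" "s \<in> \<Lambda>" "face_idx s = f" "x - offset s = g"
    using e(1) unfolding face_edges_def by blast
  obtain y t where yt: "e = {y, y + t}" "t \<in> \<Lambda>" "face_idx t = f'" "y - offset t = g'"
    using e(2) unfolding face_edges_def by blast
  have "s \<in> E \<longleftrightarrow> t \<in> E"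
    using colour_dart[OF xs(2)] colour_dart[OF yt(2)] fg xs(3) yt(3) by (auto simp: colour_faces_def)
  moreover have "- s \<in> E \<longleftrightarrow> s \<notin> E" using xs(2) E_asym[of s] dart_cases by blast
  ultimately have "x = y \<and> s = t" using dart_edge_eq[of x s y t] xs(1) yt(1) by auto
  then show ?thesis using xs yt by blast
qed

lemma face_edges_nonempty:
  assumes "(f, g) \<in> colour_faces c" shows "face_edges f g \<noteq> {}"
proof -
  have "f < N" "0 < length (L f)" using assms by (auto simp: colour_faces_def)
  then show ?thesis unfolding face_edges_eq[OF \<open>f < N\<close>] by blast
qed

lemma inj_on_face_edges: "inj_on (\<lambda>(f, g). face_edges f g) (colour_faces c)"
proof (rule inj_onI, clarify)
  fix f g f' g'
  assume a: "(f, g) \<in> colour_faces c" "(f', g') \<in> colour_faces c" "face_edges f g = face_edges f' g'"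
  obtain e where "e \<in> face_edges f g" using face_edges_nonempty[OF a(1)] by blast
  then show "f = f' \<and> g = g'" using face_edges_disjoint[OF a(1,2)] a(3) by simp
qed

text \<open>Of the two darts of an edge exactly one has its step in \<open>E\<close>, so each colour
  covers the edge, and by \<open>face_edges_disjoint\<close> only once.\<close>

lemma cycles_partition: "partition_on (cayley_edges \<Lambda>) (cycles c)"
proof (rule partition_onI)
  show "\<Union>(cycles c) = cayley_edges \<Lambda>"
  proof (intro equalityI subsetI)
    fix e assume "e \<in> \<Union>(cycles c)"
    then show "e \<in> cayley_edges \<Lambda>" using face_edges_subset by (auto simp: cycles_def)
  next
    fix e assume "e \<in> cayley_edges \<Lambda>"
    then obtain x s where xs: "s \<in> \<Lambda>" "e = {x, x + s}" using cayley_edge_iff by blast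
    have *: "e \<in> \<Union>(cycles c)" if "t \<in> \<Lambda>" "e = {y, y + t}" "(t \<in> E) = c" for y t
    proof -
      have "(face_idx t, y - offset t) \<in> colour_faces c"
        using that Face_of_dart[OF that(1)] colour_dart[OF that(1)] by (simp add: colour_faces_def)
      moreover have "e \<in> face_edges (face_idx t) (y - offset t)" using that unfolding face_edges_def by blast
      ultimately show ?thesis unfolding cycles_def by blast
    qed
    have "e = {x + s, x + s + - s}" using xs(2) by auto
    moreover have "(- s \<in> E) = (s \<notin> E)" using xs(1) E_asym[of s] dart_cases by blast
    ultimately show "e \<in> \<Union>(cycles c)"
      using *[of s x] *[of "- s" "x + s"] xs minus_in[OF xs(1)] by blast
  qed
next
  show "{} \<notin> cycles c" using face_edges_nonempty by (auto simp: cycles_def)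
next
  fix C C' assume "C \<in> cycles c" "C' \<in> cycles c" "C \<noteq> C'"
  then show "disjnt C C'" using face_edges_disjoint unfolding cycles_def disjnt_iff by blast
qed

text \<open>Frontiers are images of face cycles under the injective \<open>graph_map\<close>, and
  polyhedra determine their edge sets. Both the bijections and the proper colouring thus reduce to
  statements about edge sets.\<close>

theorem biembedding_surf:
  assumes "\<And>c C. C \<in> cycles c \<Longrightarrow> is_graph_cycle C"
  shows "biembedding UNIV (cayley_edges \<Lambda>) (cycles True) (cycles False) surf graph_map"
proof -
  define \<F> where "\<F> c = (\<lambda>(f, g). face_set f g) ` colour_faces c" for c
  have fr: "surf frontier_of face_set f g = graph_map ` polyhedron_of (face_edges f g)"
    if "(f, g) \<in> colour_faces c" for f g c
    using that frontier_face_set by (simp add: colour_faces_def)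
  have sub: "polyhedron_of C \<subseteq> graph_pts" if "C \<subseteq> cayley_edges \<Lambda>" for C
    using that by (auto simp: polyhedron_of_def graph_complex_def)
  have poly: "C = C'" if "graph_map ` polyhedron_of C = graph_map ` polyhedron_of C'"
      "C \<subseteq> cayley_edges \<Lambda>" "C' \<subseteq> cayley_edges \<Lambda>" for C C'
  proof -
    have "polyhedron_of C = polyhedron_of C'"
      using inj_on_image_eq_iff[OF inj_on_graph_map sub[OF that(2)] sub[OF that(3)]] that(1) by blast
    then show ?thesis using polyhedron_of_inj that by (metis order_refl subset_antisym)
  qed
  have bij: "bij_betw (\<lambda>F. surf frontier_of F) (\<F> c) ((\<lambda>C. graph_map ` polyhedron_of C) ` cycles c)" for c
    unfolding bij_betw_def
  proof
    show "inj_on (\<lambda>F. surf frontier_of F) (\<F> c)"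
    proof (rule inj_onI)
      fix F F' assume "F \<in> \<F> c" "F' \<in> \<F> c" and eq: "surf frontier_of F = surf frontier_of F'"
      then obtain f g f' g' where fg: "(f, g) \<in> colour_faces c" "F = face_set f g"
          "(f', g') \<in> colour_faces c" "F' = face_set f' g'" by (auto simp: \<F>_def)
      have "graph_map ` polyhedron_of (face_edges f g) = graph_map ` polyhedron_of (face_edges f' g')"
        using eq unfolding fg(2,4) fr[OF fg(1)] fr[OF fg(3)] .
      then have "face_edges f g = face_edges f' g'"
        by (rule poly[OF _ face_edges_subset face_edges_subset])
      then show "F = F'" using inj_onD[OF inj_on_face_edges, of "(f, g)" "(f', g')"] fg by auto
    qed
    show "(\<lambda>F. surf frontier_of F) ` \<F> c = (\<lambda>C. graph_map ` polyhedron_of C) ` cycles c"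
      unfolding \<F>_def cycles_def image_image
      by (rule image_cong[OF refl]) (use fr in auto)
  qed
  have proper: "properly_coloured (cayley_edges \<Lambda>) surf graph_map (\<F> c)" for c
    unfolding properly_coloured_def
  proof (intro ballI impI notI)
    fix F F' assume F: "F \<in> \<F> c" "F' \<in> \<F> c" "F \<noteq> F'"
      and "\<exists>e\<in>cayley_edges \<Lambda>. graph_map ` geom_simplex e \<subseteq> surf frontier_of F \<inter> surf frontier_of F'"
    then obtain e where e: "e \<in> cayley_edges \<Lambda>"
        "graph_map ` geom_simplex e \<subseteq> surf frontier_of F" "graph_map ` geom_simplex e \<subseteq> surf frontier_of F'" by blast
    obtain f g f' g' where fg: "(f, g) \<in> colour_faces c" "F = face_set f g"
        "(f', g') \<in> colour_faces c" "F' = face_set f' g'" using F by (auto simp: \<F>_def)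
    have "polyhedron_of {e} = geom_simplex e" by (simp add: polyhedron_of_def)
    have in_face: "e \<in> face_edges f'' g''"
      if "(f'', g'') \<in> colour_faces c" "graph_map ` geom_simplex e \<subseteq> surf frontier_of face_set f'' g''" for f'' g''
    proof -
      have "graph_map ` polyhedron_of {e} \<subseteq> graph_map ` polyhedron_of (face_edges f'' g'')"
        using that(2) unfolding fr[OF that(1)] \<open>polyhedron_of {e} = geom_simplex e\<close> .
      moreover have "{e} \<subseteq> cayley_edges \<Lambda>" using e(1) by simp
      ultimately have "polyhedron_of {e} \<subseteq> polyhedron_of (face_edges f'' g'')"
        using inj_on_image_mem_iff[OF inj_on_graph_map _ sub[OF face_edges_subset]] sub[of "{e}"] by blast
      then have "{e} \<subseteq> face_edges f'' g''"
        by (rule polyhedron_of_inj[OF \<open>{e} \<subseteq> cayley_edges \<Lambda>\<close> face_edges_subset])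
      then show ?thesis by simp
    qed
    have "e \<in> face_edges f g" "e \<in> face_edges f' g'"
      using in_face[OF fg(1)] in_face[OF fg(3)] e(2,3) unfolding fg(2,4) by blast+
    then have "f = f' \<and> g = g'" using face_edges_disjoint[OF fg(1,3)] by blast
    then show False using F(3) fg by simp
  qed
  have "\<F> True \<union> \<F> False = faces"
    unfolding \<F>_def faces_def colour_faces_def by (auto simp: image_iff)
  moreover have "\<F> True \<inter> \<F> False = {}"
  proof (rule ccontr)
    assume "\<F> True \<inter> \<F> False \<noteq> {}"
    then obtain f g f' g' where fg: "face_set f g = face_set f' g'"
        "(f, g) \<in> colour_faces True" "(f', g') \<in> colour_faces False" by (auto simp: \<F>_def)
    have "(f, g, 0) \<in> face_set f g" by (simp add: face_set_def)
    then have "f = f'" using fg(1) face_set_disjoint by metis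
    then show False using fg by (simp add: colour_faces_def)
  qed
  ultimately show ?thesis
    unfolding biembedding_def cycle_decomposition_def embedding_faces_eq
    using assms cycles_partition graph_embedding_graph_map bij proper
    by (intro conjI ballI exI[of _ "\<F> True"] exI[of _ "\<F> False"]) auto
qed

end

section \<open>Row and column orderings\<close>

text \<open>The properties shared by rows and columns, stated without the array so that both are
  treated by the same lemmas.\<close>

definition ordering_system :: "nat \<Rightarrow> (nat \<Rightarrow> 'g::ab_group_add list) \<Rightarrow> 'g set \<Rightarrow> bool" where
  "ordering_system k \<omega> E \<longleftrightarrow>
     (\<forall>i<k. distinct (\<omega> i) \<and> sum_list (\<omega> i) = 0 \<and> simple_ordering (\<omega> i)) \<and>
     (\<forall>i<k. \<forall>j<k. i \<noteq> j \<longrightarrow> set (\<omega> i) \<inter> set (\<omega> j) = {}) \<and> (\<Union>i<k. set (\<omega> i)) = E"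

section \<open>From arrays to systems of orderings\<close>

lemma set_map_filter: "set (List.map_filter f xs) = {y. \<exists>x\<in>set xs. f x = Some y}"
  by (auto simp: List.map_filter_def image_iff) force

lemma distinct_map_filter_iff:
  assumes "distinct xs"
  shows "distinct (List.map_filter f xs) \<longleftrightarrow> inj_on f {x \<in> set xs. f x \<noteq> None}"
proof -
  have "inj_on (\<lambda>x. the (f x)) {x \<in> set xs. f x \<noteq> None} \<longleftrightarrow> inj_on f {x \<in> set xs. f x \<noteq> None}"
    by (auto simp: inj_on_def)
  then show ?thesis
    using assms by (simp add: List.map_filter_def distinct_map o_def)
qed

lemma set_row_entries: "set (row_entries n A i) = {a. \<exists>j<n. A i j = Some a}"
  and set_col_entries: "set (col_entries m A j) = {a. \<exists>i<m. A i j = Some a}"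
  by (simp_all add: row_entries_def col_entries_def set_map_filter Bex_def)

text \<open>The entries are listed row by row; distinctness of this list is turned into uniqueness
  of the cell, a form that applies equally to columns.\<close>

lemma distinct_entries_unique:
  assumes "distinct (entries m n A)" "i < m" "i' < m" "j < n" "j' < n" "A i j = Some a" "A i' j' = Some a"
  shows "i = i' \<and> j = j'"
proof -
  have row: "a \<in> set (row_entries n A i)" "a \<in> set (row_entries n A i')"
    using assms by (auto simp: set_row_entries)
  have d: "distinct (concat (map (row_entries n A) [0..<m]))" using assms(1) by (simp add: entries_def)
  have "i = i'"
  proof (rule ccontr)
    assume "i \<noteq> i'"
    have "[0..<m] = take i [0..<m] @ i # drop (Suc i) [0..<m]"
      using assms(2) id_take_nth_drop[of i "[0..<m]"] by simp
    then have "distinct (concat (map (row_entries n A) (take i [0..<m] @ i # drop (Suc i) [0..<m])))"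
      using d by metis
    then have "set (row_entries n A i) \<inter> set (concat (map (row_entries n A) (drop (Suc i) [0..<m]))) = {}"
        "set (row_entries n A i) \<inter> set (concat (map (row_entries n A) (take i [0..<m]))) = {}"
      by (auto simp only: map_append list.map concat_append concat.simps distinct_append set_append)
    moreover have "i' \<in> set (take i [0..<m]) \<or> i' \<in> set (drop (Suc i) [0..<m])"
      using assms(2,3) \<open>i \<noteq> i'\<close> by (auto simp: take_upt drop_upt)
    then have "a \<in> set (concat (map (row_entries n A) (take i [0..<m]))) \<or>
        a \<in> set (concat (map (row_entries n A) (drop (Suc i) [0..<m])))"
      using row(2) unfolding set_concat set_map by blast
    ultimately show False using row(1) by blast
  qed
  moreover have "distinct (row_entries n A i)"
    using d assms(2) by (auto simp: distinct_concat_iff)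
  then have "j = j'"
    using assms calculation distinct_map_filter_iff[of "[0..<n]" "\<lambda>j. A i j"]
    by (auto simp: row_entries_def inj_on_def)
  ultimately show ?thesis by simp
qed

lemma set_entries: "set (entries m n A) = {a. \<exists>i<m. \<exists>j<n. A i j = Some a}"
  by (auto simp: entries_def set_row_entries)

lemma ordering_systemI:
  assumes "\<And>i. i < k \<Longrightarrow> mset (\<omega> i) = mset (R i) \<and> simple_ordering (\<omega> i)"
    and "\<And>i. i < k \<Longrightarrow> distinct (R i)" "\<And>i. i < k \<Longrightarrow> sum_list (R i) = 0"
    and "\<And>i j. i < k \<Longrightarrow> j < k \<Longrightarrow> i \<noteq> j \<Longrightarrow> set (R i) \<inter> set (R j) = {}"
    and "(\<Union>i<k. set (R i)) = E"
  shows "ordering_system k \<omega> E"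
proof -
  have "set (\<omega> i) = set (R i)" "distinct (\<omega> i)" "sum_list (\<omega> i) = 0" if "i < k" for i
    using assms(1-3)[OF that] by (metis mset_eq_setD, metis mset_eq_imp_distinct_iff, metis sum_mset_sum_list)
  then show ?thesis using assms unfolding ordering_system_def by simp
qed

lemma ordering_systems_of_array:
  assumes A: "archdeacon_array m n A" and simple: "simple_array m n A \<omega>r \<omega>c"
  shows "ordering_system m \<omega>r (set (entries m n A))" "ordering_system n \<omega>c (set (entries m n A))"
proof -
  have dist: "distinct (entries m n A)" using A by (simp add: archdeacon_array_def)
  note uniq = distinct_entries_unique[OF dist]
  show "ordering_system m \<omega>r (set (entries m n A))"
  proof (rule ordering_systemI[of m \<omega>r "row_entries n A"])
    fix i assume i: "i < m"
    show "distinct (row_entries n A i)"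
      unfolding row_entries_def distinct_map_filter_iff[OF distinct_upt]
      using uniq i by (auto simp: inj_on_def)
    fix j assume "j < m" "i \<noteq> j"
    then show "set (row_entries n A i) \<inter> set (row_entries n A j) = {}"
      unfolding set_row_entries using uniq i by blast
  next
    show "(\<Union>i<m. set (row_entries n A i)) = set (entries m n A)"
      unfolding set_entries set_row_entries by blast
  qed (use A simple in \<open>auto simp: archdeacon_array_def simple_array_def\<close>)
  show "ordering_system n \<omega>c (set (entries m n A))"
  proof (rule ordering_systemI[of n \<omega>c "col_entries m A"])
    fix i assume i: "i < n"
    show "distinct (col_entries m A i)"
      unfolding col_entries_def distinct_map_filter_iff[OF distinct_upt]
      using uniq i by (auto simp: inj_on_def)
    fix j assume "j < n" "i \<noteq> j"
    then show "set (col_entries m A i) \<inter> set (col_entries m A j) = {}"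
      unfolding set_col_entries using uniq i by blast
  next
    show "(\<Union>j<n. set (col_entries m A j)) = set (entries m n A)"
      unfolding set_entries set_col_entries by blast
  qed (use A simple in \<open>auto simp: archdeacon_array_def simple_array_def\<close>)
qed

section \<open>The permutations given by orderings\<close>

lemma Suc_pred_mod: "p < l \<Longrightarrow> Suc ((p + l - 1) mod l) mod l = (p :: nat)"
proof -
  assume p: "p < l"
  have "Suc ((p + l - 1) mod l) mod l = Suc (p + l - 1) mod l" by (rule mod_Suc_eq)
  also have "Suc (p + l - 1) = p + l" using p by simp
  finally show ?thesis using p by simp
qed

lemma cycle_of_list_nth:
  assumes "distinct cs" "p < length cs"
  shows "cycle_of_list cs (cs ! p) = cs ! (Suc p mod length cs)"
proof -
  have "map (cycle_of_list cs) cs = rotate1 cs" using cyclic_rotation[OF assms(1), of 1] by simp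
  then have "map (cycle_of_list cs) cs ! p = rotate1 cs ! p" by simp
  then show ?thesis using assms(2) by (simp add: nth_rotate1)
qed

text \<open>The cycle containing \<open>s\<close> keeps the point inside its own support, and every
  other factor fixes that support pointwise.\<close>

lemma foldr_disjoint_cycles:
  assumes "distinct js" "\<And>i j. i \<in> set js \<Longrightarrow> j \<in> set js \<Longrightarrow> i \<noteq> j \<Longrightarrow> set (\<omega> i) \<inter> set (\<omega> j) = {}"
  defines "F \<equiv> \<lambda>js. foldr (\<circ>) (map (\<lambda>i. cycle_of_list (\<omega> i)) js) id"
  shows "(\<forall>i\<in>set js. s \<in> set (\<omega> i) \<longrightarrow> F js s = cycle_of_list (\<omega> i) s) \<and>
         ((\<forall>i\<in>set js. s \<notin> set (\<omega> i)) \<longrightarrow> F js s = s)"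
proof -
  have F_Nil: "F [] s = s" by (simp add: F_def)
  have F_Cons: "F (j # js) s = cycle_of_list (\<omega> j) (F js s)" for j js
    by (simp only: F_def list.map foldr.simps o_apply)
  show ?thesis
    using assms(1,2)
  proof (induction js)
    case Nil
    then show ?case by (simp add: F_Nil)
  next
    case (Cons j js)
    have IH: "\<forall>i\<in>set js. s \<in> set (\<omega> i) \<longrightarrow> F js s = cycle_of_list (\<omega> i) s"
      "(\<forall>i\<in>set js. s \<notin> set (\<omega> i)) \<longrightarrow> F js s = s"
      using Cons.IH Cons.prems by auto
    have in_cyc: "cycle_of_list (\<omega> i) s \<in> set (\<omega> i)" if "s \<in> set (\<omega> i)" for i
      using that permutes_in_image[OF cycle_permutes[of "\<omega> i"], of s] by simp
    have "cycle_of_list (\<omega> j) (F js s) = cycle_of_list (\<omega> j) s" if "s \<in> set (\<omega> j)"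
    proof -
      have "\<forall>i\<in>set js. s \<notin> set (\<omega> i)" using Cons.prems that by auto
      then show ?thesis using IH(2) by simp
    qed
    moreover have "cycle_of_list (\<omega> j) (F js s) = cycle_of_list (\<omega> i) s" if "s \<in> set (\<omega> i)" "i \<in> set js" for i
    proof -
      have "cycle_of_list (\<omega> i) s \<notin> set (\<omega> j)" using in_cyc[OF that(1)] Cons.prems that by auto
      then show ?thesis using IH(1) that id_outside_supp[of "cycle_of_list (\<omega> i) s" "\<omega> j"] by simp
    qed
    moreover have "cycle_of_list (\<omega> j) (F js s) = s" if "\<forall>i\<in>set (j # js). s \<notin> set (\<omega> i)"
      using that IH(2) id_outside_supp[of s "\<omega> j"] by simp
    ultimately show ?case unfolding F_Cons by (metis list.set_intros(1) list.set_intros(2) set_ConsD)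
  qed
qed

lemma ordering_perm_nth:
  assumes sys: "ordering_system k \<omega> E" and "i < k" "p < length (\<omega> i)"
  shows "ordering_perm k \<omega> (\<omega> i ! p) = \<omega> i ! (Suc p mod length (\<omega> i))"
proof -
  have "ordering_perm k \<omega> (\<omega> i ! p) = cycle_of_list (\<omega> i) (\<omega> i ! p)"
    using foldr_disjoint_cycles[of "[0..<k]" \<omega> "\<omega> i ! p"] assms
    by (auto simp: ordering_perm_def ordering_system_def)
  then show ?thesis using assms cycle_of_list_nth by (auto simp: ordering_system_def)
qed

lemma ordering_perm_outside:
  assumes sys: "ordering_system k \<omega> E" and "s \<notin> E"
  shows "ordering_perm k \<omega> s = s"
  using foldr_disjoint_cycles[of "[0..<k]" \<omega> s] assms
  by (auto simp: ordering_perm_def ordering_system_def)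

lemma ordering_system_obtain:
  assumes "ordering_system k \<omega> E" "s \<in> E"
  obtains i p where "i < k" "p < length (\<omega> i)" "\<omega> i ! p = s"
  using assms unfolding ordering_system_def by (auto simp: in_set_conv_nth)

lemma ordering_system_in: "ordering_system k \<omega> E \<Longrightarrow> i < k \<Longrightarrow> p < length (\<omega> i) \<Longrightarrow> \<omega> i ! p \<in> E"
  unfolding ordering_system_def by (auto intro!: nth_mem)

lemma ordering_system_unique:
  assumes sys: "ordering_system k \<omega> E" and i: "i < k" "p < length (\<omega> i)" and j: "j < k" "q < length (\<omega> j)"
    and eq: "\<omega> i ! p = \<omega> j ! q"
  shows "i = j \<and> p = q"
proof -
  have "i = j"
    using sys i j eq nth_mem[OF i(2)] nth_mem[OF j(2)] unfolding ordering_system_def by (metis disjoint_iff)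
  then show ?thesis using sys i j eq nth_eq_iff_index_eq unfolding ordering_system_def by metis
qed

lemma ordering_perm_bij:
  assumes sys: "ordering_system k \<omega> E" and fin: "finite E"
  shows "bij_betw (ordering_perm k \<omega>) E E"
proof -
  have into: "ordering_perm k \<omega> ` E \<subseteq> E"
  proof clarify
    fix s assume "s \<in> E"
    then obtain i p where ip: "i < k" "p < length (\<omega> i)" "\<omega> i ! p = s" using ordering_system_obtain[OF sys] by blast
    have "Suc p mod length (\<omega> i) < length (\<omega> i)" using ip(2) by (intro mod_less_divisor) auto
    then show "ordering_perm k \<omega> s \<in> E"
      using ordering_perm_nth[OF sys ip(1,2)] ip(3) ordering_system_in[OF sys ip(1)] by simp
  qed
  have "E \<subseteq> ordering_perm k \<omega> ` E"
  proof
    fix s assume "s \<in> E"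
    then obtain i p where ip: "i < k" "p < length (\<omega> i)" "\<omega> i ! p = s" using ordering_system_obtain[OF sys] by blast
    define q where "q = (p + length (\<omega> i) - 1) mod length (\<omega> i)"
    have q: "q < length (\<omega> i)" using ip(2) unfolding q_def by (intro mod_less_divisor) auto
    have "Suc q mod length (\<omega> i) = p" using ip(2) unfolding q_def by (rule Suc_pred_mod)
    then have "ordering_perm k \<omega> (\<omega> i ! q) = s" using ordering_perm_nth[OF sys ip(1) q] ip(3) by simp
    then show "s \<in> ordering_perm k \<omega> ` E" using ordering_system_in[OF sys ip(1) q] by blast
  qed
  then show ?thesis
    using into fin by (metis bij_betw_def eq_card_imp_inj_on subset_antisym)
qed

lemma rev_next:
  assumes "distinct xs" "p < length xs" "k < length xs" "rev xs ! k = xs ! (Suc p mod length xs)"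
  shows "rev xs ! (Suc k mod length xs) = xs ! p"
proof -
  let ?l = "length xs"
  have "xs ! (?l - Suc k) = xs ! (Suc p mod ?l)" using assms(3,4) by (simp add: rev_nth)
  then have eq: "?l - Suc k = Suc p mod ?l"
    using assms by (subst (asm) nth_eq_iff_index_eq) (auto intro: mod_less_divisor)
  show ?thesis
  proof (cases "Suc p = ?l")
    case True
    then have "Suc k = ?l" using eq assms(3) by simp
    moreover have "rev xs ! 0 = xs ! p"
    proof -
      have "length xs - Suc 0 = p" "0 < length xs" using True by auto
      then show ?thesis using rev_nth[of 0 xs] by metis
    qed
    ultimately show ?thesis by simp
  next
    case False
    then have "Suc p < ?l" using assms(2) by simp
    then have "Suc k < ?l" "?l - Suc (Suc k) = p" using eq assms(3) by auto
    then show ?thesis by (simp add: rev_nth)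
  qed
qed

text \<open>Reversal exchanges successor and predecessor, cyclically: in the reversed list the image
  of \<open>u\<close> is followed by \<open>u\<close>. This is the rule that the boundary of a face
  has to obey at a corner.\<close>

lemma ordering_perm_rev:
  assumes sys: "ordering_system k \<omega> E" and i: "i < k" "q < length (\<omega> i)"
    and u: "u \<in> E" "rev (\<omega> i) ! q = ordering_perm k \<omega> u"
  shows "rev (\<omega> i) ! (Suc q mod length (\<omega> i)) = u"
proof -
  obtain j p where jp: "j < k" "p < length (\<omega> j)" "\<omega> j ! p = u" using ordering_system_obtain[OF sys u(1)] by blast
  have eq: "rev (\<omega> i) ! q = \<omega> j ! (Suc p mod length (\<omega> j))"
    using ordering_perm_nth[OF sys jp(1,2)] jp(3) u(2) by simp
  have "Suc p mod length (\<omega> j) < length (\<omega> j)" using jp(2) by (intro mod_less_divisor) auto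
  then have "i = j"
    using ordering_system_unique[OF sys i(1) _ jp(1), of "length (\<omega> i) - Suc q"] eq i(2) by (auto simp: rev_nth)
  moreover have "distinct (\<omega> i)" using sys i(1) by (simp add: ordering_system_def)
  ultimately show ?thesis using rev_next[of "\<omega> i" p q] jp i(2) eq by simp
qed

section \<open>Cycles of partial sums\<close>

lemma nth_partial_sums: "k < length \<omega> \<Longrightarrow> partial_sums \<omega> ! k = sum_list (take (Suc k) \<omega>)"
  by (simp add: partial_sums_def del: take_Suc)

lemma length_partial_sums [simp]: "length (partial_sums \<omega>) = length \<omega>"
  by (simp add: partial_sums_def)

lemma cycle_edges_image: "cycle_edges vs = (\<lambda>i. {vs ! i, vs ! (Suc i mod length vs)}) ` {..<length vs}"
  unfolding cycle_edges_def by blast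

text \<open>The list of partial sums starts after the first step and ends with 0, whereas a disc
  starts at offset 0. The two enumerations of the edges differ by a cyclic shift of the
  index.\<close>

lemma cycle_edges_partial_sums:
  assumes sum0: "sum_list \<omega> = 0"
  shows "cycle_edges (map ((+) g) (partial_sums \<omega>)) =
    {{g + sum_list (take k \<omega>), g + sum_list (take (Suc k) \<omega>)} | k. k < length \<omega>}"
proof -
  let ?l = "length \<omega>" and ?h = "\<lambda>k. g + sum_list (take k \<omega>)" and ?vs = "map ((+) g) (partial_sums \<omega>)"
  have "{?vs ! i, ?vs ! (Suc i mod length ?vs)} = {?h (Suc i mod ?l), ?h (Suc (Suc i mod ?l))}"
    if i: "i < ?l" for i
  proof -
    have "?h (Suc i) = ?h (Suc i mod ?l)" using i sum0 by (cases "Suc i = ?l") auto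
    moreover have "Suc i mod ?l < ?l" using i by (intro mod_less_divisor) auto
    ultimately show ?thesis using i by (simp add: nth_partial_sums)
  qed
  then have "cycle_edges ?vs = (\<lambda>k. {?h k, ?h (Suc k)}) ` (\<lambda>i. Suc i mod ?l) ` {..<?l}"
    unfolding cycle_edges_image image_image by (intro image_cong) auto
  also have "(\<lambda>i. Suc i mod ?l) ` {..<?l} = {..<?l}"
  proof (intro equalityI subsetI)
    fix k assume "k \<in> {..<?l}"
    then have "k < ?l" by simp
    then have "Suc ((k + ?l - 1) mod ?l) mod ?l = k" "(k + ?l - 1) mod ?l < ?l"
      by (rule Suc_pred_mod, intro mod_less_divisor) auto
    then show "k \<in> (\<lambda>i. Suc i mod ?l) ` {..<?l}" by (metis imageI lessThan_iff)
  next
    fix k assume "k \<in> (\<lambda>i. Suc i mod ?l) ` {..<?l}"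
    then show "k \<in> {..<?l}" by (auto intro!: mod_less_divisor)
  qed
  finally show ?thesis by blast
qed

text \<open>In a list of sum 0 a suffix is the negative of the complementary prefix. So reversing
  and negating goes through the same partial sums backwards, while reversing alone also changes
  their sign.\<close>

lemma sum_list_take_neg_rev:
  fixes \<omega> :: "'g::ab_group_add list"
  assumes "sum_list \<omega> = 0" "k \<le> length \<omega>"
  shows "sum_list (take k (map uminus (rev \<omega>))) = sum_list (take (length \<omega> - k) \<omega>)"
    and "sum_list (take k (rev \<omega>)) = - sum_list (take (length \<omega> - k) \<omega>)"
proof -
  have neg: "sum_list (map uminus xs) = - sum_list xs" for xs :: "'g list" by (induction xs) auto
  have "sum_list (take (length \<omega> - k) \<omega>) + sum_list (drop (length \<omega> - k) \<omega>) = 0"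
    using assms(1) by (metis append_take_drop_id sum_list_append)
  then have "sum_list (drop (length \<omega> - k) \<omega>) = - sum_list (take (length \<omega> - k) \<omega>)"
    by (metis minus_unique)
  moreover have "sum_list (take k (rev \<omega>)) = sum_list (drop (length \<omega> - k) \<omega>)"
    by (simp add: take_rev sum_list_rev)
  ultimately show "sum_list (take k (rev \<omega>)) = - sum_list (take (length \<omega> - k) \<omega>)" by simp
  then show "sum_list (take k (map uminus (rev \<omega>))) = sum_list (take (length \<omega> - k) \<omega>)"
    by (simp add: take_map neg)
qed

lemma simple_ordering_iff: "simple_ordering \<omega> \<longleftrightarrow> inj_on (\<lambda>k. sum_list (take (Suc k) \<omega>)) {..<length \<omega>}"
  by (simp add: simple_ordering_def partial_sums_def distinct_map atLeast0LessThan)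

text \<open>Up to sign, the partial sums of the reversed list are the sums of the proper prefixes.
  The empty prefix takes the place of the full list, and both have sum 0.\<close>

lemma simple_ordering_rev:
  fixes \<omega> :: "'g::ab_group_add list"
  assumes "simple_ordering \<omega>" "sum_list \<omega> = 0"
  shows "simple_ordering (rev \<omega>)"
proof -
  let ?l = "length \<omega>" and ?h = "\<lambda>k. sum_list (take k \<omega>)"
  have inj: "k = k'" if "k < ?l" "k' < ?l" "?h (Suc k) = ?h (Suc k')" for k k'
    using assms(1) that unfolding simple_ordering_iff inj_on_def by auto
  have 0: "k = 0" if "k < ?l" "?h k = ?h 0" for k
  proof (cases k)
    case (Suc j)
    have "j = ?l - 1" by (rule inj) (use Suc that assms(2) in auto)
    then show ?thesis using Suc that(1) by simp
  qed simp
  have "k = k'" if k: "k < ?l" "k' < ?l" and eq: "?h k = ?h k'" for k k'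
  proof (cases "k = 0 \<or> k' = 0")
    case True
    then show ?thesis using 0[of k] 0[of k'] k eq by auto
  next
    case False
    then obtain a b where ab: "k = Suc a" "k' = Suc b" by (metis not0_implies_Suc)
    have "a = b" by (rule inj) (use k eq ab in auto)
    then show ?thesis using ab by simp
  qed
  note inj' = this
  show ?thesis
    unfolding simple_ordering_iff
  proof (rule inj_onI)
    fix a b assume ab: "a \<in> {..<length (rev \<omega>)}" "b \<in> {..<length (rev \<omega>)}"
      "sum_list (take (Suc a) (rev \<omega>)) = sum_list (take (Suc b) (rev \<omega>))"
    then have "?h (?l - Suc a) = ?h (?l - Suc b)"
      using sum_list_take_neg_rev(2)[OF assms(2), of "Suc a"] sum_list_take_neg_rev(2)[OF assms(2), of "Suc b"]
      by auto
    then have "?l - Suc a = ?l - Suc b" using inj'[of "?l - Suc a" "?l - Suc b"] ab by auto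
    then show "a = b" using ab by auto
  qed
qed

lemma ordering_system_rev: "ordering_system k \<omega> E \<Longrightarrow> ordering_system k (\<lambda>i. rev (\<omega> i)) E"
  by (auto simp: ordering_system_def simple_ordering_rev sum_list_rev)

text \<open>Nonempty lists of length below 3 and sum 0 have the form \<open>[0]\<close> or
  \<open>[a, - a]\<close>, which the asymmetry of the entries excludes.\<close>

lemma is_graph_cycle_translate:
  fixes \<omega> :: "'g::ab_group_add list"
  assumes sum: "sum_list \<omega> = 0" and simple: "simple_ordering \<omega>" and ne: "\<omega> \<noteq> []"
    and asym: "\<And>s. s \<in> set \<omega> \<Longrightarrow> - s \<notin> set \<omega>"
  shows "is_graph_cycle (cycle_edges (map ((+) g) (partial_sums \<omega>)))"
proof -
  have "3 \<le> length \<omega>"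
  proof (rule ccontr)
    assume "\<not> 3 \<le> length \<omega>"
    then consider "length \<omega> = 0" | "length \<omega> = 1" | "length \<omega> = 2" by linarith
    then show False
    proof cases
      case 1
      then show ?thesis using ne by simp
    next
      case 2
      then obtain a where "\<omega> = [a]" by (auto simp: length_Suc_conv)
      then show ?thesis using sum asym[of a] by simp
    next
      case 3
      then obtain a b where ab: "\<omega> = [a, b]" by (auto simp: numeral_2_eq_2 length_Suc_conv)
      then have "b = - a" using sum by (metis minus_unique sum_list_simps add.right_neutral)
      then show ?thesis using asym[of a] ab by simp
    qed
  qed
  moreover have "distinct (map ((+) g) (partial_sums \<omega>))"
    using simple by (simp add: simple_ordering_def distinct_map)
  ultimately show ?thesis unfolding is_graph_cycle_def by (intro exI[of _ "map ((+) g) (partial_sums \<omega>)"]) simp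
qed

lemma translates_are_cycles:
  assumes sys: "ordering_system k \<omega> E" and asym: "\<And>s. s \<in> E \<Longrightarrow> - s \<notin> E"
    and C: "C \<in> translates_of_orderings k \<omega>"
  shows "is_graph_cycle C"
proof -
  obtain i g where ig: "i < k" "\<omega> i \<noteq> []" "C = cycle_edges (map ((+) g) (partial_sums (\<omega> i)))"
    using C unfolding translates_of_orderings_def by blast
  have "sum_list (\<omega> i) = 0" "simple_ordering (\<omega> i)" "set (\<omega> i) \<subseteq> E"
    using sys ig(1) unfolding ordering_system_def by blast+
  then show ?thesis unfolding ig(3) by (intro is_graph_cycle_translate) (use ig(2) asym in auto)
qed

lemma image_cycle_edges: "(\<lambda>e. f ` e) ` cycle_edges vs = cycle_edges (map f vs)"
  unfolding cycle_edges_image image_image length_map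
proof (rule image_cong[OF refl])
  fix i assume "i \<in> {..<length vs}"
  moreover have "Suc i mod length vs < length vs" using calculation by (intro mod_less_divisor) auto
  ultimately show "f ` {vs ! i, vs ! (Suc i mod length vs)} = {map f vs ! i, map f vs ! (Suc i mod length vs)}"
    by simp
qed

lemma group_regular_translates: "group_regular (translates_of_orderings k \<omega>)"
  unfolding group_regular_def
proof (intro conjI allI)
  fix x y :: 'a
  show "\<exists>!g. g + x = y" by (intro ex1I[of _ "y - x"]) auto
next
  fix g :: 'a
  let ?C = "\<lambda>i h. cycle_edges (map ((+) h) (partial_sums (\<omega> i)))"
  have im: "(\<lambda>e. (+) g ` e) ` ?C i h = ?C i (g + h)" for i h
  proof -
    have shift: "map ((+) g) (map ((+) h) xs) = map ((+) (g + h)) xs" for xs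
      by (induction xs) (auto simp: add.assoc)
    show ?thesis by (simp only: image_cycle_edges shift)
  qed
  show "(\<lambda>C. (\<lambda>e. (+) g ` e) ` C) ` translates_of_orderings k \<omega> = translates_of_orderings k \<omega>"
  proof (intro equalityI subsetI)
    fix C assume "C \<in> (\<lambda>C. (\<lambda>e. (+) g ` e) ` C) ` translates_of_orderings k \<omega>"
    then obtain i h where "C = (\<lambda>e. (+) g ` e) ` ?C i h" "i < k" "\<omega> i \<noteq> []"
      unfolding translates_of_orderings_def by blast
    then show "C \<in> translates_of_orderings k \<omega>" unfolding im translates_of_orderings_def by blast
  next
    fix C assume "C \<in> translates_of_orderings k \<omega>"
    then obtain i h where ih: "C = ?C i h" "i < k" "\<omega> i \<noteq> []"
      unfolding translates_of_orderings_def by blast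
    then have "?C i (h - g) \<in> translates_of_orderings k \<omega>" unfolding translates_of_orderings_def by blast
    moreover have "(\<lambda>e. (+) g ` e) ` ?C i (h - g) = C" unfolding im ih(1) by simp
    ultimately show "C \<in> (\<lambda>C. (\<lambda>e. (+) g ` e) ` C) ` translates_of_orderings k \<omega>" by (metis imageI)
  qed
qed

section \<open>The surface of an Archdeacon array\<close>

locale compatible_systems =
  fixes m n :: nat and \<omega>r \<omega>c :: "nat \<Rightarrow> 'g::ab_group_add list" and E :: "'g set" and cs :: "'g list"
  assumes rows: "ordering_system m \<omega>r E" and cols: "ordering_system n \<omega>c E"
    and finite_entries: "finite E" and asym: "s \<in> E \<Longrightarrow> - s \<notin> E"
    and cs: "cs \<noteq> []" "distinct cs" "length cs = card E"
    and compatible: "ordering_perm n \<omega>c \<circ> ordering_perm m \<omega>r = cycle_of_list cs"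
begin

abbreviation "row_perm \<equiv> ordering_perm m \<omega>r"
abbreviation "col_perm \<equiv> ordering_perm n \<omega>c"

definition steps :: "nat \<Rightarrow> 'g list" where
  "steps f = (if f < m then rev (\<omega>r f) else map uminus (rev (\<omega>c (f - m))))"

text \<open>\<open>cs\<close> lists one orbit of the composed permutation; the negated row images
  are interleaved, so entries and negated entries alternate around a vertex. The reduction modulo
  \<open>card E\<close> makes the sequence periodic.\<close>

definition rotation :: "nat \<Rightarrow> 'g" where
  "rotation j = (let e = cs ! ((j div 2) mod card E) in if even j then e else - row_perm e)"

lemma card_pos: "0 < card E"
  using cs by (metis length_greater_0_conv)

lemma row_perm_in: "e \<in> E \<Longrightarrow> row_perm e \<in> E"
  using ordering_perm_bij[OF rows finite_entries] by (auto simp: bij_betw_def)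

text \<open>A cycle of length greater than 1 moves each of its elements, while both permutations fix
  everything outside \<open>E\<close>. A one-element list would give the identity, which reveals no
  support; a single entry, however, would form a row of sum 0 and be 0, against asymmetry.\<close>

lemma set_cs: "set cs = E"
proof -
  have "E \<noteq> {}" using card_pos by auto
  then obtain e where e: "e \<in> E" by blast
  have "1 < card E"
  proof (rule ccontr)
    assume "\<not> 1 < card E"
    then have "card E = 1" using card_pos by simp
    then have E: "E = {e}" using e by (metis card_1_singletonE singletonD)
    obtain i p where ip: "i < m" "p < length (\<omega>r i)" "\<omega>r i ! p = e"
      using ordering_system_obtain[OF rows e] by blast
    have "distinct (\<omega>r i)" "sum_list (\<omega>r i) = 0" "set (\<omega>r i) \<subseteq> {e}"
      using rows ip(1) E unfolding ordering_system_def by blast+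
    moreover have "set (\<omega>r i) \<noteq> {}" using ip(2) by auto
    ultimately have "set (\<omega>r i) = {e}" by (metis subset_singletonD)
    then have "length (\<omega>r i) = 1" using distinct_card[OF \<open>distinct (\<omega>r i)\<close>] by simp
    then have "\<omega>r i = [e]" using \<open>set (\<omega>r i) = {e}\<close> by (auto simp: length_Suc_conv)
    then have "e = 0" using \<open>sum_list (\<omega>r i) = 0\<close> by simp
    then show False using asym[OF e] e by simp
  qed
  have "set cs \<subseteq> E"
  proof
    fix e assume "e \<in> set cs"
    then obtain p where p: "p < length cs" "cs ! p = e" by (auto simp: in_set_conv_nth)
    have q: "Suc p mod length cs < length cs" using p(1) by (intro mod_less_divisor) auto
    have "Suc p mod length cs \<noteq> p"
      using p(1) \<open>1 < card E\<close> cs(3) by (cases "Suc p = length cs") auto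
    then have ne: "cycle_of_list cs e \<noteq> e"
      using cycle_of_list_nth[OF cs(2) p(1)] p q cs(2) nth_eq_iff_index_eq by metis
    show "e \<in> E"
    proof (rule ccontr)
      assume "e \<notin> E"
      then have "col_perm (row_perm e) = e" using ordering_perm_outside[OF rows] ordering_perm_outside[OF cols] by simp
      then show False using ne fun_cong[OF compatible, of e] by simp
    qed
  qed
  then show ?thesis
    using cs distinct_card finite_entries by (metis card_subset_eq)
qed

lemma cs_nth_in: "cs ! (q mod card E) \<in> E"
  using set_cs cs(3) card_pos by (metis mod_less_divisor nth_mem)

lemma cs_step: "col_perm (row_perm (cs ! (q mod card E))) = cs ! (Suc q mod card E)"
proof -
  have "q mod card E < length cs" using cs(3) card_pos by simp
  from cycle_of_list_nth[OF cs(2) this] show ?thesis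
    using fun_cong[OF compatible, of "cs ! (q mod card E)"] cs(3) by (simp add: mod_Suc_eq)
qed

lemmas rev_rows = ordering_system_rev[OF rows] and rev_cols = ordering_system_rev[OF cols]

lemma steps_in:
  assumes "f < m + n" "k < length (steps f)"
  shows "if f < m then steps f ! k \<in> E else - (steps f ! k) \<in> E"
  using assms ordering_system_in[OF rev_rows, of f k] ordering_system_in[OF rev_cols, of "f - m" k]
  by (auto simp: steps_def)

lemma steps_unique:
  assumes f: "f < m + n" "k < length (steps f)" and f': "f' < m + n" "k' < length (steps f')"
    and eq: "steps f ! k = steps f' ! k'"
  shows "f = f' \<and> k = k'"
proof -
  have "f < m \<longleftrightarrow> f' < m"
    using steps_in[OF f] steps_in[OF f'] eq asym by (auto split: if_splits)
  then consider "f < m" "f' < m" | "\<not> f < m" "\<not> f' < m" by blast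
  then show ?thesis
  proof cases
    case 1
    then show ?thesis
      using ordering_system_unique[OF rev_rows, of f k f' k'] f f' eq by (simp add: steps_def)
  next
    case 2
    have "f - m = f' - m \<and> k = k'"
      by (rule ordering_system_unique[OF rev_cols]) (use 2 f f' eq in \<open>auto simp: steps_def\<close>)
    then show ?thesis using 2 by linarith
  qed
qed

lemma rotation_in: "rotation j \<in> plus_minus E"
  using cs_nth_in[of "j div 2"] row_perm_in by (auto simp: rotation_def Let_def plus_minus_def)

text \<open>Even indices reach \<open>E\<close> through \<open>cs\<close>, odd ones reach the
  negatives because \<open>row_perm\<close> is onto. Injectivity follows by counting, as
  \<open>E\<close> and its negative are disjoint.\<close>

lemma rotation_bij: "bij_betw rotation {..<2 * card E} (plus_minus E)"
proof -
  have "plus_minus E \<subseteq> rotation ` {..<2 * card E}"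
  proof
    fix s assume "s \<in> plus_minus E"
    then consider "s \<in> E" | "- s \<in> E" by (auto simp: plus_minus_def)
    then show "s \<in> rotation ` {..<2 * card E}"
    proof cases
      case 1
      then obtain p where "p < card E" "cs ! p = s" using set_cs cs(3) by (metis in_set_conv_nth)
      then have "rotation (2 * p) = s" "2 * p < 2 * card E" by (auto simp: rotation_def)
      then show ?thesis by (metis imageI lessThan_iff)
    next
      case 2
      then obtain e where "e \<in> E" "row_perm e = - s"
        using ordering_perm_bij[OF rows finite_entries] by (metis bij_betw_def imageE)
      moreover obtain p where "p < card E" "cs ! p = e" using set_cs cs(3) \<open>e \<in> E\<close> by (metis in_set_conv_nth)
      ultimately have "rotation (2 * p + 1) = s" "2 * p + 1 < 2 * card E" by (auto simp: rotation_def)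
      then show ?thesis by (metis imageI lessThan_iff)
    qed
  qed
  then have im: "rotation ` {..<2 * card E} = plus_minus E" using rotation_in by auto
  have "E \<inter> uminus ` E = {}" using asym by auto
  then have "card (plus_minus E) = 2 * card E"
    using finite_entries by (simp add: plus_minus_def card_Un_disjoint card_image)
  then have "inj_on rotation {..<2 * card E}"
    using im by (intro eq_card_imp_inj_on) simp_all
  then show ?thesis using im by (simp add: bij_betw_def)
qed

text \<open>For even \<open>j\<close> the sign of the given step places the corner on a row disc,
  for odd \<open>j\<close> on a column disc. In the latter case \<open>col_perm\<close> applied to
  \<open>row_perm e\<close> is the next element of \<open>cs\<close>; this is where compatibility
  enters.\<close>

lemma steps_next:
  assumes f: "f < m + n" "k < length (steps f)" and eq: "steps f ! k = - rotation (Suc j)"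
  shows "steps f ! (Suc k mod length (steps f)) = rotation j"
proof -
  define e where "e = cs ! ((j div 2) mod card E)"
  have e: "e \<in> E" using cs_nth_in by (simp add: e_def)
  show ?thesis
  proof (cases "even j")
    case True
    then have "rotation (Suc j) = - row_perm e" "rotation j = e" by (auto simp: rotation_def e_def)
    then have st: "steps f ! k = row_perm e" using eq by simp
    then have fm: "f < m" using steps_in[OF f] row_perm_in[OF e] asym[OF row_perm_in[OF e]] by (auto split: if_splits)
    then show ?thesis
      using ordering_perm_rev[OF rows fm _ e, of k] st f(2) \<open>rotation j = e\<close> by (simp add: steps_def)
  next
    case False
    then have "Suc j div 2 = Suc (j div 2)" by presburger
    then have rj: "rotation j = - row_perm e" "rotation (Suc j) = col_perm (row_perm e)"
      using False cs_step[of "j div 2"] by (auto simp: rotation_def e_def)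
    have u: "row_perm e \<in> E" by (rule row_perm_in[OF e])
    have pcu: "col_perm (row_perm e) \<in> E"
      using ordering_perm_bij[OF cols finite_entries] u by (auto simp: bij_betw_def)
    have st: "steps f ! k = - col_perm (row_perm e)" using eq rj by simp
    then have fm: "\<not> f < m" using steps_in[OF f] asym[OF pcu] by (auto split: if_splits)
    have h: "f - m < n" using f(1) fm by linarith
    have k: "k < length (\<omega>c (f - m))" using f(2) fm by (simp add: steps_def)
    then have "Suc k mod length (\<omega>c (f - m)) < length (\<omega>c (f - m))" by (intro mod_less_divisor) auto
    then show ?thesis
      using ordering_perm_rev[OF cols h k u] st k fm rj by (simp add: steps_def)
  qed
qed

lemma neg_sum: "sum_list (map uminus xs) = - sum_list xs" for xs :: "'g list"
  by (induction xs) auto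

sublocale two_coloured_darts "m + n" steps E rotation m
proof unfold_locales
  show "finite E" by (rule finite_entries)
  show "E \<noteq> {}" using card_pos by auto
  show "- s \<notin> E" if "s \<in> E" for s using asym that .
  show "\<exists>f<m + n. \<exists>k<length (steps f). steps f ! k = s" if "s \<in> plus_minus E" for s
  proof -
    consider "s \<in> E" | "- s \<in> E" using \<open>s \<in> plus_minus E\<close> by (auto simp: plus_minus_def)
    then show ?thesis
    proof cases
      case 1
      then obtain i p where "i < m" "p < length (rev (\<omega>r i))" "rev (\<omega>r i) ! p = s"
        using ordering_system_obtain[OF rev_rows] by blast
      then show ?thesis by (intro exI[of _ i] conjI exI[of _ p]) (auto simp: steps_def)
    next
      case 2
      then obtain i p where "i < n" "p < length (rev (\<omega>c i))" "rev (\<omega>c i) ! p = - s"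
        using ordering_system_obtain[OF rev_cols] by blast
      then show ?thesis by (intro exI[of _ "m + i"] conjI exI[of _ p]) (auto simp: steps_def)
    qed
  qed
  show "steps f ! k \<in> plus_minus E" if "f < m + n" "k < length (steps f)" for f k
  proof (cases "f < m")
    case True
    then show ?thesis using steps_in[OF that] by (simp add: plus_minus_def)
  next
    case False
    then have "- (- (steps f ! k)) \<in> uminus ` E" using steps_in[OF that] by (intro imageI) simp
    then show ?thesis by (simp add: plus_minus_def)
  qed
  show "f = f' \<and> k = k'" if "f < m + n" "k < length (steps f)" "f' < m + n" "k' < length (steps f')"
    "steps f ! k = steps f' ! k'" for f k f' k'
    using steps_unique that by blast
  show "sum_list (steps f) = 0" if "f < m + n" for f
    using rows cols that unfolding ordering_system_def steps_def by (auto simp: neg_sum sum_list_rev)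
  show "bij_betw rotation {..<2 * card E} (plus_minus E)" by (rule rotation_bij)
  show "rotation (j + 2 * card E) = rotation j" for j by (simp add: rotation_def)
  show "steps f ! (Suc k mod length (steps f)) = rotation j"
    if "f < m + n" "k < length (steps f)" "steps f ! k = - rotation (Suc j)" for f k j
    using steps_next that by blast
  show "(steps f ! k \<in> E) = (f < m)" if "f < m + n" "k < length (steps f)" for f k
    using steps_in[OF that] asym by (auto split: if_splits)
qed

section \<open>Identification of the face cycles with the given decompositions\<close>

lemma face_edges_row:
  assumes "f < m"
  shows "face_edges f g = cycle_edges (map ((+) g) (partial_sums (rev (\<omega>r f))))"
proof -
  have "sum_list (rev (\<omega>r f)) = 0" using rows assms by (simp add: ordering_system_def sum_list_rev)
  from cycle_edges_partial_sums[OF this] show ?thesis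
    using face_edges_eq[of f g] assms by (simp add: steps_def)
qed

text \<open>The disc traverses the cycle of \<open>\<omega>c j\<close> backwards; as a set of
  undirected edges it is the same cycle.\<close>

lemma face_edges_col:
  assumes "j < n"
  shows "face_edges (m + j) g = cycle_edges (map ((+) g) (partial_sums (\<omega>c j)))"
proof -
  have sum0: "sum_list (\<omega>c j) = 0" using cols assms by (simp add: ordering_system_def)
  let ?l = "length (\<omega>c j)" and ?h = "\<lambda>k. g + sum_list (take k (\<omega>c j))"
  have steps: "steps (m + j) = map uminus (rev (\<omega>c j))" by (simp add: steps_def)
  have "face_edges (m + j) g = {{?h (?l - k), ?h (?l - Suc k)} | k. k < ?l}"
  proof -
    have "{g + sum_list (take k (steps (m + j))), g + sum_list (take (Suc k) (steps (m + j)))} = {?h (?l - k), ?h (?l - Suc k)}"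
      if "k < ?l" for k
      using that unfolding steps by (simp only: sum_list_take_neg_rev(1)[OF sum0] less_imp_le Suc_leI)
    then show ?thesis
      using face_edges_eq[of "m + j" g] assms by (auto simp: steps)
  qed
  also have "\<dots> = {{?h k, ?h (Suc k)} | k. k < ?l}"
  proof -
    have "{?h (?l - k), ?h (?l - Suc k)} = {?h (?l - Suc k), ?h (Suc (?l - Suc k))}" if "k < ?l" for k
      using that by (simp add: Suc_diff_Suc insert_commute)
    moreover have "\<exists>k'<?l. k = ?l - Suc k'" if "k < ?l" for k
      using that by (intro exI[of _ "?l - Suc k"]) auto
    ultimately show ?thesis by (smt (verit) Collect_cong diff_Suc_less less_nat_zero_code linorder_neqE_nat)
  qed
  also have "\<dots> = cycle_edges (map ((+) g) (partial_sums (\<omega>c j)))"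
    by (rule cycle_edges_partial_sums[OF sum0, symmetric])
  finally show ?thesis .
qed

lemma cycles_rows: "cycles True = translates_of_orderings m (\<lambda>i. rev (\<omega>r i))"
proof (intro equalityI subsetI)
  fix C assume "C \<in> cycles True"
  then obtain f g where fg: "f < m" "steps f \<noteq> []" "C = face_edges f g"
    unfolding cycles_def colour_faces_def by auto
  then have "rev (\<omega>r f) \<noteq> []" by (simp add: steps_def)
  then show "C \<in> translates_of_orderings m (\<lambda>i. rev (\<omega>r i))"
    using fg(1) unfolding fg(3) face_edges_row[OF fg(1)] translates_of_orderings_def by blast
next
  fix C assume "C \<in> translates_of_orderings m (\<lambda>i. rev (\<omega>r i))"
  then obtain f g where fg: "f < m" "rev (\<omega>r f) \<noteq> []" "C = cycle_edges (map ((+) g) (partial_sums (rev (\<omega>r f))))"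
    unfolding translates_of_orderings_def by blast
  then have "(f, g) \<in> colour_faces True" by (simp add: colour_faces_def steps_def)
  then show "C \<in> cycles True" unfolding fg(3) face_edges_row[OF fg(1), symmetric] cycles_def by blast
qed

lemma cycles_cols: "cycles False = translates_of_orderings n \<omega>c"
proof (intro equalityI subsetI)
  fix C assume "C \<in> cycles False"
  then obtain f g where fg: "\<not> f < m" "f < m + n" "steps f \<noteq> []" "C = face_edges f g"
    unfolding cycles_def colour_faces_def by auto
  define j where "j = f - m"
  have j: "f = m + j" "j < n" using fg by (auto simp: j_def)
  have "\<omega>c j \<noteq> []" using fg(1,3) by (simp add: steps_def j)
  then show "C \<in> translates_of_orderings n \<omega>c"
    using j(2) unfolding fg(4) j(1) face_edges_col[OF j(2)] translates_of_orderings_def by blast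
next
  fix C assume "C \<in> translates_of_orderings n \<omega>c"
  then obtain j g where jg: "j < n" "\<omega>c j \<noteq> []" "C = cycle_edges (map ((+) g) (partial_sums (\<omega>c j)))"
    unfolding translates_of_orderings_def by blast
  then have "(m + j, g) \<in> colour_faces False" by (simp add: colour_faces_def steps_def)
  then show "C \<in> cycles False" unfolding jg(3) face_edges_col[OF jg(1), symmetric] cycles_def by blast
qed

lemma is_graph_cycle_cycles:
  assumes "C \<in> cycles c" shows "is_graph_cycle C"
proof (cases c)
  case True
  then show ?thesis using assms cycles_rows translates_are_cycles[OF rev_rows asym] by auto
next
  case False
  then show ?thesis using assms cycles_cols translates_are_cycles[OF cols asym] by auto
qed

end

text \<open>The type of points is the concrete one that codes discs, edges and vertices, because an
  existential statement must fix it. For a finite group the surface is moreover compact.\<close>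

theorem theorem5p4:
  fixes m n :: nat
    and A :: "nat \<Rightarrow> nat \<Rightarrow> 'g::ab_group_add option"
    and \<omega>r \<omega>c :: "nat \<Rightarrow> 'g list"
  assumes "archdeacon_array m n A"
    and "simple_array m n A \<omega>r \<omega>c"
    and "compatible_orderings m n A \<omega>r \<omega>c"
  shows "group_regular (translates_of_orderings m (\<lambda>i. rev (\<omega>r i))) \<and>
    group_regular (translates_of_orderings n \<omega>c) \<and>
    (\<exists>(X :: (nat \<times> 'g \<times> complex) topology) \<psi>.
       surface X \<and> orientable X \<and> (finite (UNIV :: 'g set) \<longrightarrow> compact_space X) \<and>
       biembedding UNIV (cayley_edges (plus_minus (set (entries m n A))))
         (translates_of_orderings m (\<lambda>i. rev (\<omega>r i))) (translates_of_orderings n \<omega>c) X \<psi>)"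
proof -
  let ?E = "set (entries m n A)"
  obtain cs where cs: "cs \<noteq> []" "distinct cs" "length cs = card ?E"
      "ordering_perm n \<omega>c \<circ> ordering_perm m \<omega>r = cycle_of_list cs"
    using assms(3) unfolding compatible_orderings_def by blast
  interpret compatible_systems m n \<omega>r \<omega>c ?E cs
    using ordering_systems_of_array[OF assms(1,2)] cs assms(1)
    by unfold_locales (auto simp: archdeacon_array_def)
  have "biembedding UNIV (cayley_edges (plus_minus ?E)) (translates_of_orderings m (\<lambda>i. rev (\<omega>r i)))
      (translates_of_orderings n \<omega>c) surf graph_map"
    using biembedding_surf is_graph_cycle_cycles cycles_rows cycles_cols by metis
  then show ?thesis
    using group_regular_translates surface_surf orientable_space compact_surf by blast
qed

end
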